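(* Let $\mathcal{E}$ be a skeletally small Krull-Schmidt exact category with enough projectives, and let $\mathcal{T}$ be a support $\tau$-tilting subcategory of $\mathcal{E}$. Then $|\mathcal{T}|$ equals the number (cardinality) of isomorphism classes of indecomposable projective objects $Q$ of $\mathcal{E}$ such that $\mathrm{Hom}_{\mathcal{E}}(Q,\mathcal{T})\neq 0$, i.e. such that $\mathrm{Hom}_{\mathcal{E}}(Q,T)\ne0$ for some $T\in\mathcal{T}$.
   Context: Subcategories are full and closed under isomorphisms. $\mathcal{E}$ is a (Quillen) exact category with conflations $X\rightarrowtail Y\twoheadrightarrow Z$ (inflation followed by deflation); $\mathcal{P}$ is the subcategory of projective objects. Krull-Schmidt means that every object is a finite direct sum of objects with local endomorphism rings. A morphism is admissible if it equals $i\circ d$ with $d$ a deflation and $i$ an inflation. A sequence of composable morphisms is exact if all morphisms are admissible and $\mathrm{Im}=\mathrm{Ker}$ at each intermediate object. A subcategory is additively closed if it is closed under direct summands of finite direct sums. $\mathsf{Fac}\,\mathcal{T}$ is the subcategory of objects $X$ admitting a deflation $T\twoheadrightarrow X$ with $T\in\mathcal{T}$. A left $\mathcal{T}$-approximation of $X$ is a morphism $f:X\to T$, $T\in\mathcal{T}$, through which every morphism from $X$ to an object of $\mathcal{T}$ factors. An additively closed subcategory $\mathcal{T}$ is support $\tau$-tilting if (1) $\mathrm{Ext}^1_{\mathcal{E}}(\mathcal{T},\mathsf{Fac}\,\mathcal{T})=0$; and (2) for every $P\in\mathcal{P}$ there is an exact sequence $P\xrightarrow{f}T^0\twoheadrightarrow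 T^1$ with $T^0,T^1\in\mathcal{T}$ and $f$ a left $\mathcal{T}$-approximation. For an additively closed subcategory $\mathcal{T}$, $|\mathcal{T}|$ is the cardinal of the set of isomorphism classes of indecomposable objects in $\mathcal{T}$. *)

theory Defs
  imports "HOL-Algebra.Ring"
begin

unbundle cardinal_syntax

section \<open>Additive categories\<close>

text \<open>
  A subcategory is full and closed under isomorphisms, so it is given by its set of objects.
  The objects and arrows of a category form sets in HOL, and therefore so do the isomorphism
  classes: every category considered here is skeletally small, and this is not a separate axiom.
  The composite \<open>g \<odot>\<^bsub>C\<^esub> f\<close> is ``first \<open>f\<close>, then \<open>g\<close>''.
\<close>

record ('o, 'm) precat =
  Obj :: "'o set"
  Arr :: "'m set"
  Dom :: "'m \<Rightarrow> 'o"
  Cod :: "'m \<Rightarrow> 'o"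
  Id :: "'o \<Rightarrow> 'm"
  Comp :: "'m \<Rightarrow> 'm \<Rightarrow> 'm" (infixl "\<odot>\<index>" 70)
  Add :: "'m \<Rightarrow> 'm \<Rightarrow> 'm"
  Zero :: "'o \<Rightarrow> 'o \<Rightarrow> 'm"

definition Hom :: "('o, 'm, 'z) precat_scheme \<Rightarrow> 'o \<Rightarrow> 'o \<Rightarrow> 'm set" where
  "Hom C X Y = {f \<in> Arr C. Dom C f = X \<and> Cod C f = Y}"

definition Hom_group :: "('o, 'm, 'z) precat_scheme \<Rightarrow> 'o \<Rightarrow> 'o \<Rightarrow> 'm monoid" where
  "Hom_group C X Y = \<lparr>carrier = Hom C X Y, monoid.mult = Add C, one = Zero C X Y\<rparr>"

definition End_ring :: "('o, 'm, 'z) precat_scheme \<Rightarrow> 'o \<Rightarrow> 'm ring" where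
  "End_ring C X = \<lparr>carrier = Hom C X X, monoid.mult = Comp C, one = Id C X,
                   ring.zero = Zero C X X, ring.add = Add C\<rparr>"

locale category =
  fixes C :: "('o, 'm, 'z) precat_scheme" (structure)
  assumes Dom_Obj: "f \<in> Arr C \<Longrightarrow> Dom C f \<in> Obj C"
    and Cod_Obj: "f \<in> Arr C \<Longrightarrow> Cod C f \<in> Obj C"
    and Id_Hom: "X \<in> Obj C \<Longrightarrow> Id C X \<in> Hom C X X"
    and Comp_Hom: "\<lbrakk>f \<in> Hom C X Y; g \<in> Hom C Y Z\<rbrakk> \<Longrightarrow> g \<odot> f \<in> Hom C X Z"
    and Comp_Id: "f \<in> Hom C X Y \<Longrightarrow> f \<odot> Id C X = f"
    and Id_Comp: "f \<in> Hom C X Y \<Longrightarrow> Id C Y \<odot> f = f"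
    and Comp_assoc: "\<lbrakk>f \<in> Hom C W X; g \<in> Hom C X Y; h \<in> Hom C Y Z\<rbrakk>
      \<Longrightarrow> (h \<odot> g) \<odot> f = h \<odot> (g \<odot> f)"

locale preadditive_category = category +
  assumes Hom_comm_group: "\<lbrakk>X \<in> Obj C; Y \<in> Obj C\<rbrakk> \<Longrightarrow> comm_group (Hom_group C X Y)"
    and Comp_Add: "\<lbrakk>f \<in> Hom C X Y; f' \<in> Hom C X Y; g \<in> Hom C Y Z\<rbrakk>
      \<Longrightarrow> g \<odot> Add C f f' = Add C (g \<odot> f) (g \<odot> f')"
    and Add_Comp: "\<lbrakk>f \<in> Hom C X Y; g \<in> Hom C Y Z; g' \<in> Hom C Y Z\<rbrakk>
      \<Longrightarrow> Add C g g' \<odot> f = Add C (g \<odot> f) (g' \<odot> f)"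

text \<open>
  The object \<open>Z\<close> is a direct sum (biproduct) of the finite list \<open>Xs\<close>. The product
  \<open>finprod\<close> is taken in the additively written group of endomorphisms of \<open>Z\<close>, so it is the
  sum of the idempotents \<open>i k \<odot> p k\<close>. The direct sums of the empty list are the zero objects.
\<close>

definition is_direct_sum :: "('o, 'm, 'z) precat_scheme \<Rightarrow> 'o \<Rightarrow> 'o list \<Rightarrow> bool" where
  "is_direct_sum C Z Xs \<longleftrightarrow> Z \<in> Obj C \<and> set Xs \<subseteq> Obj C \<and>
     (\<exists>i p.
        (\<forall>k < length Xs. i k \<in> Hom C (Xs ! k) Z \<and> p k \<in> Hom C Z (Xs ! k)) \<and>
        (\<forall>j < length Xs. \<forall>k < length Xs.
           p j \<odot>\<^bsub>C\<^esub> i k = (if j = k then Id C (Xs ! k) else Zero C (Xs ! k) (Xs ! j))) \<and>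
        finprod (Hom_group C Z Z) (\<lambda>k. i k \<odot>\<^bsub>C\<^esub> p k) {..<length Xs} = Id C Z)"

locale additive_category = preadditive_category +
  assumes direct_sum_exists: "set Xs \<subseteq> Obj C \<Longrightarrow> \<exists>Z. is_direct_sum C Z Xs"

definition is_zero_object :: "('o, 'm, 'z) precat_scheme \<Rightarrow> 'o \<Rightarrow> bool" where
  "is_zero_object C Z \<longleftrightarrow> Z \<in> Obj C \<and>
     (\<forall>X \<in> Obj C. (\<exists>!f. f \<in> Hom C X Z) \<and> (\<exists>!f. f \<in> Hom C Z X))"

definition is_iso :: "('o, 'm, 'z) precat_scheme \<Rightarrow> 'm \<Rightarrow> bool" where
  "is_iso C f \<longleftrightarrow> f \<in> Arr C \<and>
     (\<exists>g \<in> Hom C (Cod C f) (Dom C f).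
        g \<odot>\<^bsub>C\<^esub> f = Id C (Dom C f) \<and> f \<odot>\<^bsub>C\<^esub> g = Id C (Cod C f))"

definition isomorphic :: "('o, 'm, 'z) precat_scheme \<Rightarrow> 'o \<Rightarrow> 'o \<Rightarrow> bool" where
  "isomorphic C X Y \<longleftrightarrow> (\<exists>f \<in> Hom C X Y. is_iso C f)"

definition iso_class :: "('o, 'm, 'z) precat_scheme \<Rightarrow> 'o \<Rightarrow> 'o set" where
  "iso_class C X = {Y \<in> Obj C. isomorphic C X Y}"

definition direct_summand :: "('o, 'm, 'z) precat_scheme \<Rightarrow> 'o \<Rightarrow> 'o \<Rightarrow> bool" where
  "direct_summand C X Z \<longleftrightarrow> (\<exists>Y. is_direct_sum C Z [X, Y])"

definition indecomposable :: "('o, 'm, 'z) precat_scheme \<Rightarrow> 'o \<Rightarrow> bool" where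
  "indecomposable C X \<longleftrightarrow> X \<in> Obj C \<and> \<not> is_zero_object C X \<and>
     (\<forall>A B. is_direct_sum C X [A, B] \<longrightarrow> is_zero_object C A \<or> is_zero_object C B)"

text \<open>Local rings in the noncommutative sense: the non-units are closed under addition.\<close>

definition local_ring :: "('a, 'b) ring_scheme \<Rightarrow> bool" where
  "local_ring R \<longleftrightarrow> ring R \<and> \<one>\<^bsub>R\<^esub> \<noteq> \<zero>\<^bsub>R\<^esub> \<and>
     (\<forall>a \<in> carrier R - Units R. \<forall>b \<in> carrier R - Units R. a \<oplus>\<^bsub>R\<^esub> b \<notin> Units R)"

definition krull_schmidt :: "('o, 'm, 'z) precat_scheme \<Rightarrow> bool" where
  "krull_schmidt C \<longleftrightarrow>
     (\<forall>X \<in> Obj C. \<exists>Xs. is_direct_sum C X Xs \<and> (\<forall>Y \<in> set Xs. local_ring (End_ring C Y)))"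

definition subcategory :: "('o, 'm, 'z) precat_scheme \<Rightarrow> 'o set \<Rightarrow> bool" where
  "subcategory C T \<longleftrightarrow> T \<subseteq> Obj C \<and> (\<forall>X \<in> T. \<forall>Y \<in> Obj C. isomorphic C X Y \<longrightarrow> Y \<in> T)"

definition additively_closed :: "('o, 'm, 'z) precat_scheme \<Rightarrow> 'o set \<Rightarrow> bool" where
  "additively_closed C T \<longleftrightarrow> subcategory C T \<and>
     (\<forall>Xs Z X. set Xs \<subseteq> T \<longrightarrow> is_direct_sum C Z Xs \<longrightarrow> direct_summand C X Z \<longrightarrow> X \<in> T)"

definition left_approximation ::
  "('o, 'm, 'z) precat_scheme \<Rightarrow> 'o set \<Rightarrow> 'o \<Rightarrow> 'm \<Rightarrow> bool" where
  "left_approximation C T X f \<longleftrightarrow> (\<exists>Y \<in> T. f \<in> Hom C X Y \<and>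
     (\<forall>Y' \<in> T. \<forall>h \<in> Hom C X Y'. \<exists>g \<in> Hom C Y Y'. h = g \<odot>\<^bsub>C\<^esub> f))"

text \<open>The number of isomorphism classes of indecomposable objects lying in \<open>S\<close>, as a cardinal.\<close>

definition num_indec :: "('o, 'm, 'z) precat_scheme \<Rightarrow> 'o set \<Rightarrow> 'o set rel" where
  "num_indec C S = |iso_class C ` {X \<in> S. indecomposable C X}|"


section \<open>Exact categories\<close>

definition is_kernel :: "('o, 'm, 'z) precat_scheme \<Rightarrow> 'm \<Rightarrow> 'm \<Rightarrow> bool" where
  "is_kernel C i p \<longleftrightarrow> i \<in> Arr C \<and> p \<in> Arr C \<and> Cod C i = Dom C p \<and>
     p \<odot>\<^bsub>C\<^esub> i = Zero C (Dom C i) (Cod C p) \<and>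
     (\<forall>W. \<forall>f \<in> Hom C W (Dom C p). p \<odot>\<^bsub>C\<^esub> f = Zero C W (Cod C p) \<longrightarrow>
        (\<exists>!g. g \<in> Hom C W (Dom C i) \<and> i \<odot>\<^bsub>C\<^esub> g = f))"

definition is_cokernel :: "('o, 'm, 'z) precat_scheme \<Rightarrow> 'm \<Rightarrow> 'm \<Rightarrow> bool" where
  "is_cokernel C p i \<longleftrightarrow> i \<in> Arr C \<and> p \<in> Arr C \<and> Cod C i = Dom C p \<and>
     p \<odot>\<^bsub>C\<^esub> i = Zero C (Dom C i) (Cod C p) \<and>
     (\<forall>W. \<forall>f \<in> Hom C (Cod C i) W. f \<odot>\<^bsub>C\<^esub> i = Zero C (Dom C i) W \<longrightarrow>
        (\<exists>!g. g \<in> Hom C (Cod C p) W \<and> g \<odot>\<^bsub>C\<^esub> p = f))"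

text \<open>The pushout of \<open>f\<close> and \<open>i\<close> is the square \<open>i' \<odot> f = f' \<odot> i\<close>,
  the pullback of \<open>f\<close> and \<open>p\<close> is the square \<open>f \<odot> p' = p \<odot> f'\<close>.\<close>

definition is_pushout :: "('o, 'm, 'z) precat_scheme \<Rightarrow> 'm \<Rightarrow> 'm \<Rightarrow> 'm \<Rightarrow> 'm \<Rightarrow> bool" where
  "is_pushout C i f i' f' \<longleftrightarrow> (\<exists>A B A' B'.
     i \<in> Hom C A B \<and> f \<in> Hom C A A' \<and> i' \<in> Hom C A' B' \<and> f' \<in> Hom C B B' \<and>
     i' \<odot>\<^bsub>C\<^esub> f = f' \<odot>\<^bsub>C\<^esub> i \<and>
     (\<forall>W. \<forall>u \<in> Hom C A' W. \<forall>v \<in> Hom C B W. u \<odot>\<^bsub>C\<^esub> f = v \<odot>\<^bsub>C\<^esub> i \<longrightarrow>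
        (\<exists>!w. w \<in> Hom C B' W \<and> w \<odot>\<^bsub>C\<^esub> i' = u \<and> w \<odot>\<^bsub>C\<^esub> f' = v)))"

definition is_pullback :: "('o, 'm, 'z) precat_scheme \<Rightarrow> 'm \<Rightarrow> 'm \<Rightarrow> 'm \<Rightarrow> 'm \<Rightarrow> bool" where
  "is_pullback C p f p' f' \<longleftrightarrow> (\<exists>A B A' B'.
     p \<in> Hom C B A \<and> f \<in> Hom C A' A \<and> p' \<in> Hom C B' A' \<and> f' \<in> Hom C B' B \<and>
     f \<odot>\<^bsub>C\<^esub> p' = p \<odot>\<^bsub>C\<^esub> f' \<and>
     (\<forall>W. \<forall>u \<in> Hom C W A'. \<forall>v \<in> Hom C W B. f \<odot>\<^bsub>C\<^esub> u = p \<odot>\<^bsub>C\<^esub> v \<longrightarrow>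
        (\<exists>!w. w \<in> Hom C W B' \<and> p' \<odot>\<^bsub>C\<^esub> w = u \<and> f' \<odot>\<^bsub>C\<^esub> w = v)))"

text \<open>
  An exact structure is the set of its conflations, given as pairs \<open>(i, p)\<close> of an inflation
  and a deflation.
\<close>

record ('o, 'm) exact_cat = "('o, 'm) precat" +
  conflations :: "('m \<times> 'm) set"

definition inflation :: "('o, 'm, 'z) exact_cat_scheme \<Rightarrow> 'm \<Rightarrow> bool" where
  "inflation C i \<longleftrightarrow> (\<exists>p. (i, p) \<in> conflations C)"

definition deflation :: "('o, 'm, 'z) exact_cat_scheme \<Rightarrow> 'm \<Rightarrow> bool" where
  "deflation C p \<longleftrightarrow> (\<exists>i. (i, p) \<in> conflations C)"

text \<open>Quillen's axioms, in the self-dual form due to Keller and Buehler.\<close>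

locale exact_category = additive_category C
  for C :: "('o, 'm, 'z) exact_cat_scheme" (structure) +
  assumes conflation_kernel: "(i, p) \<in> conflations C \<Longrightarrow> is_kernel C i p"
    and conflation_cokernel: "(i, p) \<in> conflations C \<Longrightarrow> is_cokernel C p i"
    and conflation_iso:
      "\<lbrakk>(i, p) \<in> conflations C; is_iso C a; is_iso C b; is_iso C c;
        a \<in> Hom C (Dom C i) X; b \<in> Hom C (Cod C i) Y; c \<in> Hom C (Cod C p) Z;
        i' \<in> Hom C X Y; p' \<in> Hom C Y Z; b \<odot> i = i' \<odot> a; c \<odot> p = p' \<odot> b\<rbrakk>
       \<Longrightarrow> (i', p') \<in> conflations C"
    and inflation_Id: "X \<in> Obj C \<Longrightarrow> inflation C (Id C X)"
    and deflation_Id: "X \<in> Obj C \<Longrightarrow> deflation C (Id C X)"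
    and inflation_Comp:
      "\<lbrakk>inflation C i; inflation C j; Cod C i = Dom C j\<rbrakk> \<Longrightarrow> inflation C (j \<odot> i)"
    and deflation_Comp:
      "\<lbrakk>deflation C p; deflation C q; Cod C p = Dom C q\<rbrakk> \<Longrightarrow> deflation C (q \<odot> p)"
    and inflation_pushout:
      "\<lbrakk>inflation C i; f \<in> Arr C; Dom C f = Dom C i\<rbrakk>
       \<Longrightarrow> \<exists>i' f'. is_pushout C i f i' f' \<and> inflation C i'"
    and deflation_pullback:
      "\<lbrakk>deflation C p; f \<in> Arr C; Cod C f = Cod C p\<rbrakk>
       \<Longrightarrow> \<exists>p' f'. is_pullback C p f p' f' \<and> deflation C p'"

definition projectives :: "('o, 'm, 'z) exact_cat_scheme \<Rightarrow> 'o set" where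
  "projectives C = {P \<in> Obj C. \<forall>p. deflation C p \<longrightarrow>
     (\<forall>f \<in> Hom C P (Cod C p). \<exists>g \<in> Hom C P (Dom C p). p \<odot>\<^bsub>C\<^esub> g = f)}"

definition enough_projectives :: "('o, 'm, 'z) exact_cat_scheme \<Rightarrow> bool" where
  "enough_projectives C \<longleftrightarrow>
     (\<forall>X \<in> Obj C. \<exists>P \<in> projectives C. \<exists>p \<in> Hom C P X. deflation C p)"

text \<open>\<open>i\<close> represents the image of the admissible morphism \<open>f\<close>.\<close>

definition is_image :: "('o, 'm, 'z) exact_cat_scheme \<Rightarrow> 'm \<Rightarrow> 'm \<Rightarrow> bool" where
  "is_image C i f \<longleftrightarrow> inflation C i \<and>
     (\<exists>d. deflation C d \<and> Cod C d = Dom C i \<and> f = i \<odot>\<^bsub>C\<^esub> d)"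

definition admissible :: "('o, 'm, 'z) exact_cat_scheme \<Rightarrow> 'm \<Rightarrow> bool" where
  "admissible C f \<longleftrightarrow> (\<exists>i. is_image C i f)"

text \<open>
  Images and kernels are subobjects, determined up to isomorphism; they agree iff they have a
  common representative.
\<close>

definition exact_sequence :: "('o, 'm, 'z) exact_cat_scheme \<Rightarrow> 'm list \<Rightarrow> bool" where
  "exact_sequence C fs \<longleftrightarrow> (\<forall>f \<in> set fs. admissible C f) \<and>
     (\<forall>k. Suc k < length fs \<longrightarrow> Cod C (fs ! k) = Dom C (fs ! Suc k) \<and>
        (\<exists>i. is_image C i (fs ! k) \<and> is_kernel C i (fs ! Suc k)))"

text \<open>
  \<open>Ext1 C X Y\<close> is the Yoneda Ext of equivalence classes of conflations from \<open>Y\<close> to \<open>X\<close>.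
  Its group structure (Baer sum) is not needed to say that it vanishes, i.e. has one element.
\<close>

definition extensions :: "('o, 'm, 'z) exact_cat_scheme \<Rightarrow> 'o \<Rightarrow> 'o \<Rightarrow> ('m \<times> 'm) set" where
  "extensions C X Y = {(i, p) \<in> conflations C. Dom C i = Y \<and> Cod C p = X}"

definition extension_equiv ::
  "('o, 'm, 'z) exact_cat_scheme \<Rightarrow> 'o \<Rightarrow> 'o \<Rightarrow> ('m \<times> 'm) rel" where
  "extension_equiv C X Y = {((i, p), (i', p')).
     (i, p) \<in> extensions C X Y \<and> (i', p') \<in> extensions C X Y \<and>
     (\<exists>h \<in> Hom C (Cod C i) (Cod C i'). is_iso C h \<and> h \<odot>\<^bsub>C\<^esub> i = i' \<and> p' \<odot>\<^bsub>C\<^esub> h = p)}"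

definition Ext1 :: "('o, 'm, 'z) exact_cat_scheme \<Rightarrow> 'o \<Rightarrow> 'o \<Rightarrow> ('m \<times> 'm) set set" where
  "Ext1 C X Y = extensions C X Y // extension_equiv C X Y"

definition Fac :: "('o, 'm, 'z) exact_cat_scheme \<Rightarrow> 'o set \<Rightarrow> 'o set" where
  "Fac C T = {X \<in> Obj C. \<exists>Y \<in> T. \<exists>p \<in> Hom C Y X. deflation C p}"

definition support_tau_tilting :: "('o, 'm, 'z) exact_cat_scheme \<Rightarrow> 'o set \<Rightarrow> bool" where
  "support_tau_tilting C T \<longleftrightarrow> additively_closed C T \<and>
     (\<forall>X \<in> T. \<forall>Y \<in> Fac C T. is_singleton (Ext1 C X Y)) \<and>
     (\<forall>P \<in> projectives C. \<exists>T0 \<in> T. \<exists>T1 \<in> T. \<exists>f \<in> Hom C P T0. \<exists>g \<in> Hom C T0 T1.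
        exact_sequence C [f, g] \<and> deflation C g \<and> left_approximation C T P f)"

end

theory Submission
  imports Defs "HOL-Library.Multiset"
begin

text \<open>
  A left \<open>T\<close>-approximation of a projective object \<open>Q\<close> factors as a deflation onto its image \<open>J Q\<close>
  followed by an inflation with cokernel in \<open>T\<close>. The images \<open>J Q\<close> are projective relative to
  the objects to which every map from a projective object factors through \<open>J\<close>, and with respect
  to them \<open>T\<close> is a classical tilting subcategory: besides the coresolutions \<open>J \<rightarrow> T0 \<rightarrow> T1\<close> there
  are resolutions \<open>J1 \<rightarrow> J0 \<rightarrow> X\<close> of the objects \<open>X\<close> of \<open>T\<close>. By Schanuel's lemma and its dual,
  \<open>[J] \<mapsto> [T0] - [T1]\<close> and \<open>[X] \<mapsto> [J0] - [J1]\<close> are well defined on split Grothendieck groups, and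
  a pushout and a pullback show that they are mutually inverse. In the bases of indecomposable
  objects they are given by inverse integer matrices, so the bases are equipotent. Finally,
  \<open>Q \<mapsto> J Q\<close> matches the indecomposable projective \<open>Q\<close> with \<open>Hom(Q, T) \<noteq> 0\<close> with the
  indecomposable \<open>J\<close>, since \<open>End (J Q)\<close> is a quotient of the local ring \<open>End Q\<close>.
\<close>

section \<open>Additive categories with arrows in a ring\<close>

text \<open>The objects \<open>J Q\<close> are in general not projective in the exact category. They
  lift only along deflations whose source is a \<open>faithful\<close> object, so Schanuel's
  argument works only as long as the middle terms of all resolutions are of this kind;
  \<open>P\<close> and \<open>T\<close> both consist of such objects. The existence of resolutions
  is where vanishing of Ext against all of \<open>fac T\<close>, and not just against
  \<open>T\<close>, enters: the object \<open>E\<close> that the kernel \<open>N\<close> embeds into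
  is only known to be a quotient of an object of \<open>T\<close>. The exact category is not assumed
  to be weakly idempotent complete. Krull-Schmidt supplies complements of retracts, and these give
  cancellation of deflations, by which the maps induced on images are deflations. Arrows are made
  elements of one ring so that identities between them become ring identities without carrier
  conditions. The price is that 0 lies in every Hom set: an arrow no longer determines its source
  and target, and predicates such as \<open>iso\<close>, \<open>kernel\<close> or \<open>CF\<close>
  have to name their objects.\<close>

locale ring_category =
  fixes Ob :: "'o set" and H :: "'o \<Rightarrow> 'o \<Rightarrow> 'a::ring set" and e :: "'o \<Rightarrow> 'a"
  assumes H_Ob: "f \<in> H X Y \<Longrightarrow> X \<in> Ob \<and> Y \<in> Ob"
    and H_zero: "X \<in> Ob \<Longrightarrow> Y \<in> Ob \<Longrightarrow> 0 \<in> H X Y"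
    and H_add: "f \<in> H X Y \<Longrightarrow> g \<in> H X Y \<Longrightarrow> f + g \<in> H X Y"
    and H_minus: "f \<in> H X Y \<Longrightarrow> - f \<in> H X Y"
    and H_id: "X \<in> Ob \<Longrightarrow> e X \<in> H X X"
    and H_comp: "f \<in> H X Y \<Longrightarrow> g \<in> H Y Z \<Longrightarrow> g * f \<in> H X Z"
    and id_right: "f \<in> H X Y \<Longrightarrow> f * e X = f"
    and id_left: "f \<in> H X Y \<Longrightarrow> e Y * f = f"
begin

lemma H_diff: "f \<in> H X Y \<Longrightarrow> g \<in> H X Y \<Longrightarrow> f - g \<in> H X Y"
  using H_add[OF _ H_minus, of f X Y g] by simp

text \<open>Simplification keeps products nested to the right, where an identity meets its arrow in
  front of a further factor \<open>x\<close>; hence this variant of \<open>id_left\<close> with a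
  tail.\<close>

lemma id_left_assoc: "f \<in> H X Y \<Longrightarrow> e Y * (f * x) = f * x"
  by (metis id_left mult.assoc)

lemmas id_simps = id_right id_left id_left_assoc

text \<open>Gives both sides of an equation the same tail, so that it still rewrites inside
  right-nested products.\<close>

lemma mult_eq_assoc: "a * b = c \<Longrightarrow> a * (b * x) = c * (x::'a)"
  by (simp add: mult.assoc[symmetric])

definition iso :: "'o \<Rightarrow> 'o \<Rightarrow> 'a \<Rightarrow> bool" where
  "iso X Y f \<longleftrightarrow> f \<in> H X Y \<and> (\<exists>g \<in> H Y X. g * f = e X \<and> f * g = e Y)"

definition isom :: "'o \<Rightarrow> 'o \<Rightarrow> bool" where
  "isom X Y \<longleftrightarrow> (\<exists>f. iso X Y f)"

definition cls :: "'o \<Rightarrow> 'o set" where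
  "cls X = {Y. isom X Y}"

lemma iso_H: "iso X Y f \<Longrightarrow> f \<in> H X Y"
  by (simp add: iso_def)

lemma isoI: "f \<in> H X Y \<Longrightarrow> g \<in> H Y X \<Longrightarrow> g * f = e X \<Longrightarrow> f * g = e Y \<Longrightarrow> iso X Y f"
  by (auto simp: iso_def)

lemma isoE:
  assumes "iso X Y f"
  obtains g where "f \<in> H X Y" "g \<in> H Y X" "g * f = e X" "f * g = e Y" "iso Y X g"
  using assms by (auto simp: iso_def)

lemma iso_id: "X \<in> Ob \<Longrightarrow> iso X X (e X)"
  by (metis H_id id_left isoI)

lemma iso_comp:
  assumes "iso X Y f" "iso Y Z g" shows "iso X Z (g * f)"
proof -
  obtain f' where f: "f \<in> H X Y" "f' \<in> H Y X" "f' * f = e X" "f * f' = e Y" using assms(1) by (rule isoE)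
  obtain g' where g: "g \<in> H Y Z" "g' \<in> H Z Y" "g' * g = e Y" "g * g' = e Z" using assms(2) by (rule isoE)
  show ?thesis
  proof (rule isoI[where g = "f' * g'"])
    show "f' * g' * (g * f) = e X"
      by (simp add: mult.assoc mult_eq_assoc[OF g(3)] id_left[OF f(1)] f)
    show "g * f * (f' * g') = e Z"
      by (simp add: mult.assoc mult_eq_assoc[OF f(4)] id_left[OF g(2)] g)
  qed (use f g H_comp in blast)+
qed

lemma isom_refl: "X \<in> Ob \<Longrightarrow> isom X X"
  using iso_id isom_def by blast

lemma isom_sym: "isom X Y \<Longrightarrow> isom Y X"
  by (meson isoE isom_def)

lemma isom_trans: "isom X Y \<Longrightarrow> isom Y Z \<Longrightarrow> isom X Z"
  unfolding isom_def by (meson iso_comp)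

lemma isom_Ob: "isom X Y \<Longrightarrow> X \<in> Ob \<and> Y \<in> Ob"
  using H_Ob iso_H isom_def by blast

lemma cls_eq: "X \<in> Ob \<Longrightarrow> cls X = cls Y \<longleftrightarrow> isom X Y"
  unfolding cls_def using isom_refl isom_sym isom_trans by blast

lemma iso_idem:
  assumes "iso X X f" "f * f = f" shows "f = e X"
proof -
  obtain g where g: "f \<in> H X X" "g \<in> H X X" "g * f = e X" "f * g = e X" using assms(1) by (rule isoE)
  have "f = e X * f" using g by (simp add: id_left)
  also have "\<dots> = g * (f * f)" using g by (metis mult.assoc)
  finally show ?thesis using g assms by simp
qed

definition biprod :: "'o \<Rightarrow> 'o \<Rightarrow> 'o \<Rightarrow> 'a \<Rightarrow> 'a \<Rightarrow> 'a \<Rightarrow> 'a \<Rightarrow> bool" where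
  "biprod A B U i p j q \<longleftrightarrow> i \<in> H A U \<and> p \<in> H U A \<and> j \<in> H B U \<and> q \<in> H U B \<and>
     p * i = e A \<and> q * j = e B \<and> p * j = 0 \<and> q * i = 0 \<and> i * p + j * q = e U"

lemma biprod_H:
  assumes "biprod A B U i p j q"
  shows "i \<in> H A U" "p \<in> H U A" "j \<in> H B U" "q \<in> H U B"
  using assms by (auto simp: biprod_def)

lemma biprod_Ob:
  assumes "biprod A B U i p j q"
  shows "A \<in> Ob" "B \<in> Ob" "U \<in> Ob"
  using assms by (meson biprod_def H_Ob)+

text \<open>The identity \<open>i * p + j * q = e U\<close> is oriented so that \<open>j * q\<close> is eliminated.\<close>

lemma biprod_simps:
  assumes "biprod A B U i p j q"
  shows "p * i = e A" "q * j = e B" "p * j = 0" "q * i = 0" "j * q = e U - i * p"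
    "p * (i * x) = e A * x" "q * (j * x) = e B * x" "p * (j * x) = 0" "q * (i * x) = 0"
    "j * (q * x) = e U * x - i * (p * x)"
    "e U * i = i" "e U * j = j" "e A * p = p" "e B * q = q"
    "e U * (i * x) = i * x" "e U * (j * x) = j * x" "e A * (p * x) = p * x" "e B * (q * x) = q * x"
    "p * e U = p" "q * e U = q" "i * e A = i" "j * e B = j"
proof -
  note b = assms[unfolded biprod_def]
  show 1: "p * i = e A" "q * j = e B" "p * j = 0" "q * i = 0" using b by auto
  show 2: "j * q = e U - i * p" using b by (simp add: eq_diff_eq add.commute)
  show "p * (i * x) = e A * x" "q * (j * x) = e B * x" "p * (j * x) = 0" "q * (i * x) = 0"
    using 1[THEN mult_eq_assoc] by auto
  show "j * (q * x) = e U * x - i * (p * x)"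
    using 2[THEN mult_eq_assoc] by (simp add: left_diff_distrib mult.assoc)
qed (use assms[THEN biprod_H(1)] assms[THEN biprod_H(2)] assms[THEN biprod_H(3)] assms[THEN biprod_H(4)] in \<open>auto simp: id_simps\<close>)

lemma biprodI:
  assumes "i \<in> H A U" "p \<in> H U A" "j \<in> H B U" "q \<in> H U B"
    "p * i = e A" "q * j = e B" "p * j = 0" "q * i = 0" "i * p + j * q = e U"
  shows "biprod A B U i p j q"
  using assms by (simp add: biprod_def)

lemma biprod_swap: "biprod A B U i p j q \<Longrightarrow> biprod B A U j q i p"
  by (simp add: biprod_def add.commute)

text \<open>Contrapositive form of the condition on non-units in \<open>local_ring\<close>.\<close>

definition loc :: "'o \<Rightarrow> bool" where
  "loc X \<longleftrightarrow> X \<in> Ob \<and> e X \<noteq> 0 \<and>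
     (\<forall>a \<in> H X X. \<forall>b \<in> H X X. iso X X (a + b) \<longrightarrow> iso X X a \<or> iso X X b)"

lemma loc_Ob: "loc X \<Longrightarrow> X \<in> Ob"
  by (simp add: loc_def)

lemma loc_add:
  "loc X \<Longrightarrow> a \<in> H X X \<Longrightarrow> b \<in> H X X \<Longrightarrow> iso X X (a + b) \<Longrightarrow> iso X X a \<or> iso X X b"
  by (simp add: loc_def)

lemma loc_iso_or:
  "loc X \<Longrightarrow> a \<in> H X X \<Longrightarrow> b \<in> H X X \<Longrightarrow> a + b = e X \<Longrightarrow> iso X X a \<or> iso X X b"
  by (metis iso_id loc_def)

text \<open>Sums equal to the identity are enough: multiplying \<open>a + b\<close> by its inverse
  \<open>u\<close> turns the summands into \<open>u * a\<close> and \<open>e X - u * a\<close>, and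
  the invertible factor \<open>u\<close> can be cancelled again.\<close>

lemma locI:
  assumes X: "X \<in> Ob" "e X \<noteq> 0" and l: "\<And>a. a \<in> H X X \<Longrightarrow> iso X X a \<or> iso X X (e X - a)"
  shows "loc X"
  unfolding loc_def
proof (intro conjI ballI impI X)
  fix a b assume ab: "a \<in> H X X" "b \<in> H X X" "iso X X (a + b)"
  obtain u where u: "u \<in> H X X" "u * (a + b) = e X" "(a + b) * u = e X" "iso X X u" using ab(3) by (rule isoE)
  have s: "e X - u * a = u * b" using u by (auto simp: algebra_simps)
  have c: "iso X X c" if "c \<in> H X X" "iso X X (u * c)" for c
  proof -
    have "iso X X ((a + b) * (u * c))" using that ab(3) iso_comp by blast
    then show ?thesis using that by (simp add: mult.assoc[symmetric] u id_left)
  qed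
  show "iso X X a \<or> iso X X b" using l[of "u * a"] c ab u s H_comp by metis
qed

text \<open>With \<open>u\<close> inverse to \<open>r * s\<close>, the endomorphism
  \<open>s * (u * r)\<close> of \<open>Y\<close> is idempotent. It or its complement is invertible,
  hence equal to \<open>e Y\<close>; were it 0, then \<open>e X\<close> would be 0 too.\<close>

lemma loc_iso:
  assumes XY: "loc X" "loc Y" and s: "s \<in> H X Y" and r: "r \<in> H Y X" and rs: "iso X X (r * s)"
  shows "iso X Y s"
proof -
  obtain u where u: "u \<in> H X X" "u * (r * s) = e X" "(r * s) * u = e X" using rs by (rule isoE)
  let ?f = "s * (u * r)"
  have f: "?f \<in> H Y Y" using s r u H_comp by blast
  have ff: "?f * ?f = ?f"
    using mult_eq_assoc[OF u(2), of "u * r"] u by (simp add: mult.assoc id_left_assoc)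
  have Y: "Y \<in> Ob" using XY loc_Ob by blast
  then have "iso Y Y ?f \<or> iso Y Y (e Y - ?f)"
    using loc_iso_or[OF XY(2) f H_diff[OF H_id f]] by simp
  then show ?thesis
  proof
    assume "iso Y Y ?f"
    then have "?f = e Y" using ff iso_idem by blast
    then show ?thesis using s r u by (intro isoI[where g = "u * r"]) (auto simp: mult.assoc intro: H_comp)
  next
    assume i: "iso Y Y (e Y - ?f)"
    have "(e Y - ?f) * (e Y - ?f) = e Y - ?f"
      using ff by (simp add: algebra_simps f[THEN id_left] f[THEN id_right, unfolded mult.assoc] H_id[OF Y, THEN id_left])
    then have "e Y - ?f = e Y" using i iso_idem by blast
    then have "?f = 0" by simp
    have "e X = e X * e X" using XY(1) by (simp add: loc_Ob id_left[OF H_id])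
    also have "\<dots> = u * r * ?f * s" by (metis u(2) mult.assoc)
    also have "\<dots> = 0" using \<open>?f = 0\<close> by simp
    finally show ?thesis using XY(1) by (simp add: loc_def)
  qed
qed

lemma loc_isom:
  assumes X: "loc X" and XY: "isom X Y" shows "loc Y"
proof -
  obtain f g where f: "f \<in> H X Y" "g \<in> H Y X" "g * f = e X" "f * g = e Y"
    using XY unfolding isom_def iso_def by blast
  note fs = f(3,4)[THEN mult_eq_assoc] f(1)[THEN id_left] f(1)[THEN id_right] f(2)[THEN id_left] f(2)[THEN id_right]
     f(3,4)
  have inv: "iso Y Y a" if a: "a \<in> H Y Y" "iso X X (g * (a * f))" for a
  proof -
    have i: "iso X Y f" "iso Y X g" using f by (auto intro: isoI)
    have "iso Y Y (f * (g * (a * f)) * g)"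
      using iso_comp[OF i(2) iso_comp[OF a(2) i(1)]] by (simp add: mult.assoc)
    then show ?thesis by (simp add: mult.assoc fs a(1)[THEN id_left] a(1)[THEN id_right] id_left_assoc[OF a(1)])
  qed
  show ?thesis
  proof (rule locI)
    show "Y \<in> Ob" using isom_Ob XY by blast
    show "e Y \<noteq> 0"
    proof
      assume "e Y = 0"
      then have "f = 0" using fs by auto
      then show False using f X by (simp add: loc_def)
    qed
    fix a assume a: "a \<in> H Y Y"
    have 1: "g * (a * f) \<in> H X X" using a f H_comp by blast
    have 2: "e Y - a \<in> H Y Y" using a H_diff H_id \<open>Y \<in> Ob\<close> by blast
    have "g * ((e Y - a) * f) = e X - g * (a * f)" by (simp add: algebra_simps fs)
    then show "iso Y Y a \<or> iso Y Y (e Y - a)"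
      using loc_iso_or[OF X 1, of "e X - g * (a * f)"] inv[OF a] inv[OF 2] H_diff[OF H_id[OF loc_Ob[OF X]] 1] by auto
  qed
qed

end

section \<open>The Krull-Schmidt theorem\<close>

locale ring_additive_category = ring_category Ob H e
  for Ob :: "'o set" and H :: "'o \<Rightarrow> 'o \<Rightarrow> 'a::ring set" and e :: "'o \<Rightarrow> 'a" +
  assumes biprod_exists: "A \<in> Ob \<Longrightarrow> B \<in> Ob \<Longrightarrow> \<exists>U i p j q. biprod A B U i p j q"
    and zero_exists: "\<exists>Z \<in> Ob. e Z = 0"
begin

text \<open>Local summands are split off one at a time: in this recursive form, proofs about finite
  sums are inductions that involve binary biproducts only.\<close>

inductive decomp :: "'o \<Rightarrow> 'o list \<Rightarrow> bool" where
  Nil: "Z \<in> Ob \<Longrightarrow> e Z = 0 \<Longrightarrow> decomp Z []"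
| Cons: "biprod X A Z i p j q \<Longrightarrow> loc X \<Longrightarrow> decomp A Xs \<Longrightarrow> decomp Z (X # Xs)"

lemma decomp_loc: "decomp Z Xs \<Longrightarrow> X \<in> set Xs \<Longrightarrow> loc X"
  by (induction rule: decomp.induct) auto

lemma biprod_comp_iso:
  assumes b: "biprod A B U i p j q" and f: "f \<in> H U V" "g \<in> H V U" "g * f = e U" "f * g = e V"
  shows "biprod A B V (f * i) (p * g) (f * j) (q * g)"
proof (rule biprodI)
  note bH = biprod_H[OF b] and bs = biprod_simps[OF b]
  show "f * i \<in> H A V" "p * g \<in> H V A" "f * j \<in> H B V" "q * g \<in> H V B"
    using bH f by (blast intro: H_comp)+
  note s = f(3,4)[THEN mult_eq_assoc] f(1,2)[THEN id_left] f(1,2)[THEN id_right] f(1,2)[THEN id_left_assoc]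
  show "p * g * (f * i) = e A" "q * g * (f * j) = e B" "p * g * (f * j) = 0" "q * g * (f * i) = 0"
    by (simp_all add: mult.assoc s bs)
  show "f * i * (p * g) + f * j * (q * g) = e V"
    by (simp add: mult.assoc s bs f algebra_simps)
qed

lemma decomp_iso:
  assumes "decomp Z Xs" "isom Z Z'" shows "decomp Z' Xs"
proof -
  obtain f g where f: "f \<in> H Z Z'" "g \<in> H Z' Z" "g * f = e Z" "f * g = e Z'"
    using assms(2) unfolding isom_def iso_def by blast
  show ?thesis using assms(1)
  proof cases
    case Nil
    then have "e Z' = 0" using f by (metis id_left mult_zero_right mult_zero_left mult.assoc)
    then show ?thesis using Nil H_Ob f by (blast intro: decomp.Nil)
  next
    case (Cons X A i p j q Xs)
    then show ?thesis using biprod_comp_iso[OF Cons(2) f] by (blast intro: decomp.Cons)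
  qed
qed

text \<open>Exchange property. The biproduct splits \<open>r * s\<close> into two parts, one of
  which is invertible because \<open>X\<close> is local: either \<open>X\<close> maps isomorphically
  to \<open>Y\<close> and takes its place, or the problem moves into \<open>U'\<close>. The
  inclusion \<open>s\<close> is retained, the projection \<open>r\<close> is not.\<close>

lemma exchange:
  assumes "decomp U Ys" "loc X" "s \<in> H X U" "r \<in> H U X" "iso X X (r * s)"
  shows "\<exists>A Ys' Y r' i p. biprod X A U s r' i p \<and> decomp A Ys' \<and> isom X Y \<and>
    mset Ys = add_mset Y (mset Ys')"
  using assms
proof (induction arbitrary: s r rule: decomp.induct)
  case (Nil Z)
  then have "r * s = 0" by (metis id_right mult_zero_right mult_zero_left)
  then have "e X = 0" using \<open>iso X X (r * s)\<close> by (metis isoE mult_zero_left)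
  then show ?case using Nil.prems by (simp add: loc_def)
next
  case (Cons Y U' U i p j q Ys)
  note b = Cons(1) and s = \<open>s \<in> H X U\<close> and r = \<open>r \<in> H U X\<close>
  note bH = biprod_H[OF b] and bs = biprod_simps[OF b]
  note ss = s[THEN id_left] r[THEN id_left] s[THEN id_right] r[THEN id_right]
    s[THEN id_left_assoc] r[THEN id_left_assoc]
  have "r * s = r * (i * (p * s)) + r * (j * (q * s))"
    by (simp add: bs ss algebra_simps)
  moreover have "r * (i * (p * s)) \<in> H X X" "r * (j * (q * s)) \<in> H X X"
    using s r bH by (blast intro: H_comp)+
  ultimately consider "iso X X ((r * i) * (p * s))" | "iso X X ((r * j) * (q * s))"
    using loc_add[OF Cons.prems(1)] Cons.prems(4) unfolding mult.assoc by metis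
  then show ?case
  proof cases
    case 1
    have "iso X Y (p * s)" using loc_iso[OF \<open>loc X\<close> \<open>loc Y\<close> _ _ 1] s r bH H_comp by blast
    then obtain h where h: "h \<in> H Y X" "h * (p * s) = e X" "p * s * h = e Y"
      by (metis isoE)
    note hs = h(1)[THEN id_left] h(1)[THEN id_right] h(1)[THEN id_left_assoc] h(2) h(3)[unfolded mult.assoc]
       mult_eq_assoc[OF h(3), unfolded mult.assoc]
    \<comment> \<open>The old complement \<open>U'\<close> stays; its projection is corrected so as
      to vanish on \<open>s\<close>.\<close>
    have "biprod X U' U s (h * p) j (q - q * (s * (h * p)))"
    proof (rule biprodI)
      show "s \<in> H X U" "h * p \<in> H U X" "j \<in> H U' U" "q - q * (s * (h * p)) \<in> H U U'"
        using s h bH by (blast intro: H_comp H_diff)+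
      show "s * (h * p) + j * (q - q * (s * (h * p))) = e U"
        by (simp add: bs ss hs algebra_simps)
    qed (simp_all add: bs ss hs algebra_simps)
    then show ?thesis using Cons \<open>iso X Y (p * s)\<close> unfolding isom_def
      by (metis mset.simps(2))
  next
    case 2
    have "q * s \<in> H X U'" "r * j \<in> H U' X" using s r bH H_comp by blast+
    from Cons.IH[OF Cons.prems(1) this 2]
    obtain A' Ys' Y' r1 i1 p1 where A': "biprod X A' U' (q * s) r1 i1 p1" "decomp A' Ys'" "isom X Y'"
      "mset Ys = add_mset Y' (mset Ys')" by blast
    note AH = biprod_H[OF A'(1)] and As = biprod_simps[OF A'(1), unfolded mult.assoc]
    \<comment> \<open>The new complement of \<open>X\<close> consists of \<open>Y\<close> and of the
      complement \<open>A'\<close> of \<open>X\<close> in \<open>U'\<close>.\<close>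
    obtain A iy py ia pa where A: "biprod Y A' A iy py ia pa"
      using biprod_exists[of Y A'] biprod_Ob[OF b] biprod_Ob[OF A'(1)] by blast
    note CH = biprod_H[OF A] and Cs = biprod_simps[OF A]
    have "biprod X A U s (r1 * q) (i * py + j * (i1 * pa)) (iy * (p - p * (s * (r1 * q))) + ia * (p1 * q))"
    proof (rule biprodI)
      show "s \<in> H X U" "r1 * q \<in> H U X" "i * py + j * (i1 * pa) \<in> H A U"
        "iy * (p - p * (s * (r1 * q))) + ia * (p1 * q) \<in> H U A"
        using s bH AH CH by (blast intro: H_comp H_diff H_add)+
    qed (simp_all add: bs ss As Cs algebra_simps)
    moreover have "decomp A (Y # Ys')" using A A' Cons.hyps by (blast intro: decomp.Cons)
    ultimately show ?thesis using A' by (metis add_mset_commute mset.simps(2))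
  qed
qed

text \<open>Reassociation of \<open>(X + A') + B\<close> to \<open>X + (A' + B)\<close>, where
  \<open>V\<close> is a biproduct of \<open>A'\<close> and \<open>B\<close>.\<close>

lemma decomp_append:
  assumes "decomp A Xs" "decomp B Ys" "biprod A B U i p j q" shows "decomp U (Xs @ Ys)"
  using assms
proof (induction arbitrary: U i p j q rule: decomp.induct)
  case (Nil A)
  note b = biprod_simps[OF Nil(4)] and bH = biprod_H[OF Nil(4)]
  have "i = 0" using b(21) Nil by simp
  then have "j * q = e U" "q * j = e B" using b by auto
  then have "isom B U" using bH unfolding isom_def by (blast intro: isoI)
  then show ?case using Nil decomp_iso by simp
next
  case (Cons X A' A iX pX iA pA Xs)
  note b = biprod_simps[OF Cons(1)] and bH = biprod_H[OF Cons(1)]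
  note c = biprod_simps[OF Cons(6)] and cH = biprod_H[OF Cons(6)]
  obtain V i1 p1 i2 p2 where V: "biprod A' B V i1 p1 i2 p2"
    using biprod_exists biprod_Ob[OF Cons(1)] biprod_Ob[OF Cons(6)] by blast
  note v = biprod_simps[OF V] and vH = biprod_H[OF V]
  have "biprod X V U (i * iX) (pX * p) (i * (iA * p1) + j * p2) (i1 * (pA * p) + i2 * q)"
  proof (rule biprodI)
    show "i * iX \<in> H X U" "pX * p \<in> H U X" "i * (iA * p1) + j * p2 \<in> H V U"
      "i1 * (pA * p) + i2 * q \<in> H U V"
      using bH cH vH by (blast intro: H_comp H_add)+
  qed (simp_all add: b c v algebra_simps)
  moreover have "decomp V (Xs @ Ys)" using Cons.IH Cons.prems V by blast
  ultimately show ?case using \<open>loc X\<close> by (simp add: decomp.Cons)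
qed

text \<open>Both complements are cokernels of the same inclusion \<open>i\<close>; the projections
  \<open>p\<close> and \<open>p'\<close> may differ.\<close>

lemma biprod_complement_isom:
  assumes "biprod A B U i p j q" "biprod A B' U i p' j' q'" shows "isom B B'"
proof -
  note b = biprod_simps[OF assms(1)] and bH = biprod_H[OF assms(1)]
  note c = biprod_simps[OF assms(2)] and cH = biprod_H[OF assms(2)]
  have "iso B B' (q' * j)"
  proof (rule isoI[where g = "q * j'"])
    show "q' * j \<in> H B B'" "q * j' \<in> H B' B" using bH cH by (blast intro: H_comp)+
    show "q * j' * (q' * j) = e B" "q' * j * (q * j') = e B'"
      by (simp_all add: b c algebra_simps)
  qed
  then show ?thesis unfolding isom_def by blast
qed

text \<open>The first summand \<open>X\<close> of one list is exchanged against an isomorphic member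
  of the other. Its inclusion \<open>i\<close> is unchanged, so the complements agree up to
  isomorphism and the induction continues.\<close>

lemma decomp_unique:
  assumes "decomp Z Xs" "decomp Z Ys" shows "image_mset cls (mset Xs) = image_mset cls (mset Ys)"
  using assms
proof (induction arbitrary: Ys rule: decomp.induct)
  case (Nil Z)
  from \<open>decomp Z Ys\<close> show ?case
  proof cases
    case (Cons X A i p j q Xs)
    then have "e X = 0" using biprod_simps(1,19)[OF Cons(2)] Nil(2) by simp
    then show ?thesis using Cons by (simp add: loc_def)
  qed simp
next
  case (Cons X A Z i p j q Xs)
  note bH = biprod_H[OF Cons(1)]
  have "iso X X (p * i)" using biprod_simps(1)[OF Cons(1)] Cons(2) iso_id loc_Ob by simp
  then obtain A' Ys' Y r' i' p' where A': "biprod X A' Z i r' i' p'" "decomp A' Ys'" "isom X Y"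
      "mset Ys = add_mset Y (mset Ys')"
    using exchange[OF Cons.prems Cons(2) bH(1,2)] by blast
  have "decomp A Ys'"
    using A'(2) biprod_complement_isom[OF A'(1) Cons(1)] decomp_iso by blast
  then show ?case using Cons.IH A' cls_eq[of X Y] isom_Ob by auto
qed

end

section \<open>Split Grothendieck group and complements of retracts\<close>

locale ring_krull_schmidt = ring_additive_category Ob H e
  for Ob :: "'o set" and H :: "'o \<Rightarrow> 'o \<Rightarrow> 'a::ring set" and e :: "'o \<Rightarrow> 'a" +
  assumes decomp_exists: "X \<in> Ob \<Longrightarrow> \<exists>Xs. decomp X Xs"
begin

text \<open>The class of \<open>X\<close> in the split Grothendieck group: by the Krull-Schmidt theorem, a multiset of
  isomorphism classes.\<close>

definition K :: "'o \<Rightarrow> 'o set multiset" where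
  "K X = image_mset cls (mset (SOME Xs. decomp X Xs))"

lemma K_decomp: "decomp X Xs \<Longrightarrow> K X = image_mset cls (mset Xs)"
  unfolding K_def by (rule decomp_unique) (rule someI[of "decomp X"])

lemma K_biprod: "biprod A B U i p j q \<Longrightarrow> K U = K A + K B"
proof -
  assume b: "biprod A B U i p j q"
  then obtain Xs Ys where "decomp A Xs" "decomp B Ys" using decomp_exists biprod_Ob(1,2)[OF b] by blast
  then show ?thesis using K_decomp[of A Xs] K_decomp[of B Ys] K_decomp[OF decomp_append[OF _ _ b]] by simp
qed

lemma biprod_zero_right:
  assumes "X \<in> Ob" "Z \<in> Ob" "e Z = 0" shows "biprod X Z X (e X) (e X) 0 0"
  using assms by (intro biprodI) (auto simp: H_id H_zero id_left[OF H_id])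

lemma decomp_single: "loc X \<Longrightarrow> decomp X [X]"
  using zero_exists biprod_zero_right loc_Ob decomp.Cons decomp.Nil by meson

lemma K_loc: "loc X \<Longrightarrow> K X = {#cls X#}"
  using K_decomp[OF decomp_single] by simp

text \<open>Weak idempotent completeness, drawn from Krull-Schmidt: the local summands of the
  retract \<open>A\<close> are split off from \<open>U\<close> one after the other by
  \<open>exchange\<close>. The proof of \<open>deflation_cancel\<close> rests on it.\<close>

lemma retract_complement:
  assumes "s \<in> H A U" "r \<in> H U A" "r * s = e A"
  shows "\<exists>B j q. biprod A B U s r j q"
proof -
  obtain Xs where "decomp A Xs" using decomp_exists assms H_Ob by blast
  then have "\<exists>B r' j q. biprod A B U s r' j q" using assms
  proof (induction arbitrary: U s r rule: decomp.induct)
    case (Nil A)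
    have "s = 0" using id_right[OF \<open>s \<in> H A U\<close>] Nil by simp
    then have "biprod A U U s 0 (e U) (e U)"
      using Nil H_Ob[OF Nil(3)] by (intro biprodI) (auto simp: H_id H_zero id_left[OF H_id])
    then show ?case by blast
  next
    case (Cons X A' A i p j q Xs)
    note b = biprod_simps[OF Cons(1)] and bH = biprod_H[OF Cons(1)]
    note s = \<open>s \<in> H A U\<close> and r = \<open>r \<in> H U A\<close> and rs = \<open>r * s = e A\<close> mult_eq_assoc[OF \<open>r * s = e A\<close>]
    note ss = s[THEN id_left] r[THEN id_left] s[THEN id_right] r[THEN id_right]
      s[THEN id_left_assoc] r[THEN id_left_assoc]
    have UO: "U \<in> Ob" using s H_Ob by blast
    then obtain Us where Us: "decomp U Us" using decomp_exists by blast
    have 1: "s * i \<in> H X U" "p * r \<in> H U X" using s r bH H_comp by blast+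
    have "(p * r) * (s * i) = e X" by (simp add: mult.assoc rs b)
    then have "iso X X ((p * r) * (s * i))" using iso_id Cons(2) loc_Ob by simp
    from exchange[OF Us Cons(2) 1 this]
    obtain U' r1 i1 p1 where U': "biprod X U' U (s * i) r1 i1 p1" by blast
    note c = biprod_simps[OF U', unfolded mult.assoc] and cH = biprod_H[OF U']
    \<comment> \<open>What remains of \<open>A\<close> without \<open>X\<close> is a retract of the
      complement \<open>U'\<close> of \<open>X\<close> in \<open>U\<close>.\<close>
    have 2: "p1 * (s * j) \<in> H A' U'" "q * (r * i1) \<in> H U' A'" using s r bH cH H_comp by blast+
    have "q * (r * i1) * (p1 * (s * j)) = e A'" by (simp add: ss rs b c algebra_simps)
    from Cons.IH[OF 2 this]
    obtain B r2 i2 p2 where B: "biprod A' B U' (p1 * (s * j)) r2 i2 p2" by blast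
    note d = biprod_simps[OF B, unfolded mult.assoc] and dH = biprod_H[OF B]
    \<comment> \<open>Since \<open>p1\<close> kills the copy \<open>s * i\<close> of
      \<open>X\<close>, only the part \<open>s * j\<close> contributes, and on it \<open>r2\<close>
      and \<open>p2\<close> give the identity and 0.\<close>
    have "r2 * (p1 * s) = r2 * (p1 * (s * i * p)) + r2 * (p1 * (s * j)) * q"
      by (simp add: mult.assoc b ss algebra_simps)
    then have q: "r2 * (p1 * s) = q" by (simp add: c d b mult.assoc)
    have "p2 * (p1 * s) = p2 * (p1 * (s * i * p)) + p2 * (p1 * (s * j)) * q"
      by (simp add: mult.assoc b ss algebra_simps)
    then have z: "p2 * (p1 * s) = 0" by (simp add: c d b mult.assoc)
    have "biprod A B U s (i * (r1 - r1 * (s * (j * (r2 * p1)))) + j * (r2 * p1)) (i1 * i2) (p2 * p1)"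
    proof (rule biprodI)
      show "s \<in> H A U" "i * (r1 - r1 * (s * (j * (r2 * p1)))) + j * (r2 * p1) \<in> H U A"
        "i1 * i2 \<in> H B U" "p2 * p1 \<in> H U B"
        using s bH cH dH by (blast intro: H_comp H_add H_diff)+
      show "(i * (r1 - r1 * (s * (j * (r2 * p1)))) + j * (r2 * p1)) * s = e A" by (simp add: q z ss rs b c d algebra_simps)
      show "p2 * p1 * (i1 * i2) = e B" by (simp add: q z ss rs b c d algebra_simps)
      show "(i * (r1 - r1 * (s * (j * (r2 * p1)))) + j * (r2 * p1)) * (i1 * i2) = 0" by (simp add: q z ss rs b c d algebra_simps)
      show "p2 * p1 * s = 0" by (simp add: q z ss rs b c d algebra_simps)
      show "s * (i * (r1 - r1 * (s * (j * (r2 * p1)))) + j * (r2 * p1)) + i1 * i2 * (p2 * p1) = e U" by (simp add: q z ss rs b c d algebra_simps)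
    qed
    then show ?case by blast
  qed
  then obtain B r' j q where B: "biprod A B U s r' j q" by blast
  note b = biprod_simps[OF B] and bH = biprod_H[OF B]
  note ss = assms(3) mult_eq_assoc[OF assms(3)] assms(2)[THEN id_left] assms(2)[THEN id_left_assoc]
    assms(2)[THEN id_right]
  \<comment> \<open>The induction preserves the inclusion \<open>s\<close> but yields some
    projection \<open>r'\<close>. Shearing the inclusion of the complement by
    \<open>s * (r * j)\<close> brings back the given \<open>r\<close>.\<close>
  have "biprod A B U s r (j - s * (r * j)) q"
  proof (rule biprodI)
    show "s \<in> H A U" "r \<in> H U A" "j - s * (r * j) \<in> H B U" "q \<in> H U B"
      using assms bH by (blast intro: H_comp H_diff)+
  qed (simp_all add: ss b algebra_simps)
  then show ?thesis by blast
qed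

text \<open>If \<open>X\<close> is local, one of the complementary idempotents \<open>i * p\<close>
  and \<open>j * q\<close> is invertible, hence the identity, and the other summand vanishes.
  Conversely, an indecomposable \<open>X\<close> is isomorphic to the first local summand in a
  decomposition.\<close>

lemma loc_iff_indecomposable:
  "loc X \<longleftrightarrow> X \<in> Ob \<and> e X \<noteq> 0 \<and> (\<forall>A B i p j q. biprod A B X i p j q \<longrightarrow> e A = 0 \<or> e B = 0)"
proof (intro iffI conjI allI impI)
  assume X: "loc X"
  show "X \<in> Ob" "e X \<noteq> 0" using X by (auto simp: loc_def)
  fix A B i p j q assume b: "biprod A B X i p j q"
  note h = biprod_H[OF b] and bs = biprod_simps[OF b]
  have *: "e D = 0" if c: "biprod C D X k r l s" "iso X X (k * r)" for C D k r l s
  proof -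
    note cs = biprod_simps[OF c(1)]
    have "k * r = e X" by (rule iso_idem[OF c(2)]) (simp add: mult.assoc cs)
    then have "l * s = 0" using cs(5) by simp
    then have "s * (l * s) * l = 0" by simp
    then show "e D = 0" by (simp add: mult.assoc cs(2,6,7,14,18))
  qed
  have "i * p \<in> H X X" "j * q \<in> H X X" using h by (blast intro: H_comp)+
  then have "iso X X (i * p) \<or> iso X X (j * q)" by (rule loc_iso_or[OF X]) (simp add: bs)
  then show "e A = 0 \<or> e B = 0" using *[OF b] *[OF biprod_swap[OF b]] by blast
next
  assume X: "X \<in> Ob \<and> e X \<noteq> 0 \<and> (\<forall>A B i p j q. biprod A B X i p j q \<longrightarrow> e A = 0 \<or> e B = 0)"
  then obtain Xs where "decomp X Xs" using decomp_exists by blast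
  then show "loc X"
  proof cases
    case Nil
    then show ?thesis using X by blast
  next
    case (Cons Y A i p j q Ys)
    then have "e A = 0" using X unfolding loc_def by blast
    moreover note biprod_simps(5,14)[OF Cons(2)] biprod_simps(1)[OF Cons(2)]
    ultimately have "i * p = e X" by (metis diff_eq_diff_eq diff_self mult_zero_left mult_zero_right eq_iff_diff_eq_0)
    then have "iso Y X i"
      using biprod_H[OF Cons(2)] biprod_simps(1)[OF Cons(2)] by (intro isoI[where g = p])
    then show ?thesis using loc_isom[OF Cons(3)] unfolding isom_def by blast
  qed
qed

end

section \<open>Finite direct sums as iterated biproducts\<close>

context ring_category
begin

definition direct_sum :: "'o \<Rightarrow> 'o list \<Rightarrow> (nat \<Rightarrow> 'a) \<Rightarrow> (nat \<Rightarrow> 'a) \<Rightarrow> bool" where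
  "direct_sum Z Xs i p \<longleftrightarrow> Z \<in> Ob \<and> set Xs \<subseteq> Ob \<and>
     (\<forall>k < length Xs. i k \<in> H (Xs ! k) Z \<and> p k \<in> H Z (Xs ! k)) \<and>
     (\<forall>j < length Xs. \<forall>k < length Xs. p j * i k = (if j = k then e (Xs ! k) else 0)) \<and>
     (\<Sum>k < length Xs. i k * p k) = e Z"

lemma direct_sum_pair:
  "(\<exists>i p. direct_sum Z [A, B] i p) \<longleftrightarrow> (\<exists>i p j q. biprod A B Z i p j q)"
proof
  assume "\<exists>i p. direct_sum Z [A, B] i p"
  then obtain i p where ds: "direct_sum Z [A, B] i p" by blast
  have "\<forall>k < 2. i k \<in> H ([A, B] ! k) Z \<and> p k \<in> H Z ([A, B] ! k)"
    "\<forall>j < 2. \<forall>k < 2. p j * i k = (if j = k then e ([A, B] ! k) else 0)"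
    "(\<Sum>k < 2. i k * p k) = e Z"
    using ds by (auto simp: direct_sum_def numeral_2_eq_2)
  then have "biprod A B Z (i 0) (p 0) (i 1) (p 1)"
    unfolding biprod_def by (simp add: All_less_Suc numeral_2_eq_2)
  then show "\<exists>i p j q. biprod A B Z i p j q" by blast
next
  assume "\<exists>i p j q. biprod A B Z i p j q"
  then obtain i p j q where b: "biprod A B Z i p j q" by blast
  then have "direct_sum Z [A, B] (\<lambda>k. if k = 0 then i else j) (\<lambda>k. if k = 0 then p else q)"
    using biprod_Ob[OF b] by (simp add: direct_sum_def biprod_def All_less_Suc)
  then show "\<exists>i p. direct_sum Z [A, B] i p" by blast
qed

text \<open>The complement of \<open>X\<close> is not built inside \<open>Z\<close>: an
  independently given sum \<open>A\<close> of the tail is compared with it component by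
  component.\<close>

lemma direct_sum_Cons:
  assumes Z: "direct_sum Z (X # Xs) i p" and A: "direct_sum A Xs i' p'"
  shows "biprod X A Z (i 0) (p 0) (\<Sum>k < length Xs. i (Suc k) * p' k) (\<Sum>k < length Xs. i' k * p (Suc k))"
proof -
  let ?n = "length Xs"
  have zH: "i (Suc k) \<in> H (Xs ! k) Z" "p (Suc k) \<in> H Z (Xs ! k)" if "k < ?n" for k
    using Z that unfolding direct_sum_def by (metis Suc_mono length_Cons nth_Cons_Suc)+
  have aH: "i' k \<in> H (Xs ! k) A" "p' k \<in> H A (Xs ! k)" if "k < ?n" for k
    using A that unfolding direct_sum_def by blast+
  have sumH: "(\<Sum>k < m. f k) \<in> H U V" if "U \<in> Ob" "V \<in> Ob" "\<And>k. k < m \<Longrightarrow> f k \<in> H U V" for f U V and m :: nat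
    using that(3) by (induction m) (auto intro: H_add H_zero[OF that(1,2)])
  have O: "Z \<in> Ob" "A \<in> Ob" using Z A unfolding direct_sum_def by auto
  have zz: "p (Suc j) * i (Suc k) = (if j = k then e (Xs ! k) else 0)" if "j < ?n" "k < ?n" for j k
    using Z that unfolding direct_sum_def by (metis Suc_inject Suc_mono length_Cons nth_Cons_Suc)
  have z0: "p 0 * i (Suc k) = 0" "p (Suc k) * i 0 = 0" if "k < ?n" for k
    using Z that unfolding direct_sum_def by (metis Suc_mono length_Cons nat.distinct(1) zero_less_Suc)+
  have aa: "p' j * i' k = (if j = k then e (Xs ! k) else 0)" if "j < ?n" "k < ?n" for j k
    using A that unfolding direct_sum_def by blast
  show ?thesis
  proof (rule biprodI)
    show "i 0 \<in> H X Z" "p 0 \<in> H Z X" using Z unfolding direct_sum_def by auto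
    show "(\<Sum>k < ?n. i (Suc k) * p' k) \<in> H A Z" "(\<Sum>k < ?n. i' k * p (Suc k)) \<in> H Z A"
      using zH aH H_comp by (blast intro: sumH O)+
    show "p 0 * i 0 = e X" using Z unfolding direct_sum_def by auto
    show "p 0 * (\<Sum>k < ?n. i (Suc k) * p' k) = 0"
      unfolding sum_distrib_left by (rule sum.neutral) (simp add: mult.assoc[symmetric] z0)
    show "(\<Sum>k < ?n. i' k * p (Suc k)) * i 0 = 0"
      unfolding sum_distrib_right by (rule sum.neutral) (simp add: mult.assoc z0)
    have Zs: "i 0 * p 0 + (\<Sum>k < ?n. i (Suc k) * p (Suc k)) = e Z"
      using Z unfolding direct_sum_def by (simp add: sum.lessThan_Suc_shift del: sum.lessThan_Suc)
    have As: "(\<Sum>k < ?n. i' k * p' k) = e A" using A unfolding direct_sum_def by simp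
    have "(\<Sum>k < ?n. i' k * p (Suc k)) * (\<Sum>k < ?n. i (Suc k) * p' k)
        = (\<Sum>j < ?n. \<Sum>k < ?n. if j = k then i' k * p' k else 0)"
      unfolding sum_product
    proof (intro sum.cong refl)
      fix j k assume jk: "j \<in> {..<?n}" "k \<in> {..<?n}"
      have "i' j * p (Suc j) * (i (Suc k) * p' k) = i' j * (p (Suc j) * i (Suc k) * p' k)"
        by (simp add: mult.assoc)
      then show "i' j * p (Suc j) * (i (Suc k) * p' k) = (if j = k then i' k * p' k else 0)"
        using jk zz[of j k] id_left[OF aH(2)[of k]] by simp
    qed
    then show "(\<Sum>k < ?n. i' k * p (Suc k)) * (\<Sum>k < ?n. i (Suc k) * p' k) = e A" using As by simp
    have "(\<Sum>k < ?n. i (Suc k) * p' k) * (\<Sum>k < ?n. i' k * p (Suc k))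
        = (\<Sum>j < ?n. \<Sum>k < ?n. if j = k then i (Suc k) * p (Suc k) else 0)"
      unfolding sum_product
    proof (intro sum.cong refl)
      fix j k assume jk: "j \<in> {..<?n}" "k \<in> {..<?n}"
      have "i (Suc j) * p' j * (i' k * p (Suc k)) = i (Suc j) * (p' j * i' k * p (Suc k))"
        by (simp add: mult.assoc)
      then show "i (Suc j) * p' j * (i' k * p (Suc k)) = (if j = k then i (Suc k) * p (Suc k) else 0)"
        using jk aa[of j k] id_left[OF zH(2)[of k]] by simp
    qed
    then show "i 0 * p 0 + (\<Sum>k < ?n. i (Suc k) * p' k) * (\<Sum>k < ?n. i' k * p (Suc k)) = e Z"
      using Zs by simp
  qed
qed

end

context ring_additive_category
begin

lemma direct_sum_decomp:
  assumes ex: "\<And>Xs. set Xs \<subseteq> Ob \<Longrightarrow> \<exists>Z i p. direct_sum Z Xs i p"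
    and Z: "direct_sum Z Xs i p" "\<And>X. X \<in> set Xs \<Longrightarrow> loc X"
  shows "decomp Z Xs"
  using Z
proof (induction Xs arbitrary: Z i p)
  case Nil
  then show ?case by (auto simp: direct_sum_def intro: decomp.Nil)
next
  case (Cons X Xs)
  have "set Xs \<subseteq> Ob" using Cons.prems loc_Ob by auto
  then obtain A i' p' where A: "direct_sum A Xs i' p'" using ex by blast
  show ?case
    using decomp.Cons[OF direct_sum_Cons[OF Cons.prems(1) A]] Cons.IH[OF A] Cons.prems(2) by simp
qed

end

section \<open>Exact structures\<close>

context ring_category
begin

definition pushout :: "'o \<Rightarrow> 'o \<Rightarrow> 'o \<Rightarrow> 'o \<Rightarrow> 'a \<Rightarrow> 'a \<Rightarrow> 'a \<Rightarrow> 'a \<Rightarrow> bool" where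
  "pushout A B A' B' i f i' f' \<longleftrightarrow>
     i \<in> H A B \<and> f \<in> H A A' \<and> i' \<in> H A' B' \<and> f' \<in> H B B' \<and> i' * f = f' * i \<and>
     (\<forall>W. \<forall>u \<in> H A' W. \<forall>v \<in> H B W. u * f = v * i \<longrightarrow>
        (\<exists>!w. w \<in> H B' W \<and> w * i' = u \<and> w * f' = v))"

definition pullback :: "'o \<Rightarrow> 'o \<Rightarrow> 'o \<Rightarrow> 'o \<Rightarrow> 'a \<Rightarrow> 'a \<Rightarrow> 'a \<Rightarrow> 'a \<Rightarrow> bool" where
  "pullback A B A' B' p f p' f' \<longleftrightarrow>
     p \<in> H B A \<and> f \<in> H A' A \<and> p' \<in> H B' A' \<and> f' \<in> H B' B \<and> f * p' = p * f' \<and>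
     (\<forall>W. \<forall>u \<in> H W A'. \<forall>v \<in> H W B. f * u = p * v \<longrightarrow>
        (\<exists>!w. w \<in> H W B' \<and> p' * w = u \<and> f' * w = v))"

lemma pushout_eqs:
  assumes "pushout A B A' B' i f i' f'"
  shows "i \<in> H A B" "f \<in> H A A'" "i' \<in> H A' B'" "f' \<in> H B B'" "i' * f = f' * i"
  using assms by (auto simp: pushout_def)

lemma pushout_ex:
  assumes "pushout A B A' B' i f i' f'" "u \<in> H A' W" "v \<in> H B W" "u * f = v * i"
  obtains w where "w \<in> H B' W" "w * i' = u" "w * f' = v"
  using assms unfolding pushout_def by metis

lemma pushout_eqI:
  assumes "pushout A B A' B' i f i' f'" "w \<in> H B' W" "z \<in> H B' W" "w * i' = z * i'" "w * f' = z * f'"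
  shows "w = z"
proof -
  note p = pushout_eqs[OF assms(1)]
  have "z * i' * f = z * f' * i" using p(5) by (simp add: mult.assoc)
  then have "\<exists>!w. w \<in> H B' W \<and> w * i' = z * i' \<and> w * f' = z * f'"
    using assms(1,3) p(3,4)[THEN H_comp] unfolding pushout_def by blast
  then show ?thesis using assms(2-) by blast
qed

lemma pullback_eqs:
  assumes "pullback A B A' B' p f p' f'"
  shows "p \<in> H B A" "f \<in> H A' A" "p' \<in> H B' A'" "f' \<in> H B' B" "f * p' = p * f'"
  using assms by (auto simp: pullback_def)

lemma pullback_ex:
  assumes "pullback A B A' B' p f p' f'" "u \<in> H W A'" "v \<in> H W B" "f * u = p * v"
  obtains w where "w \<in> H W B'" "p' * w = u" "f' * w = v"
  using assms unfolding pullback_def by metis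

lemma pullback_eqI:
  assumes "pullback A B A' B' p f p' f'" "w \<in> H W B'" "z \<in> H W B'" "p' * w = p' * z" "f' * w = f' * z"
  shows "w = z"
proof -
  note p = pullback_eqs[OF assms(1)]
  have "f * (p' * z) = p * (f' * z)" using p(5) by (metis mult.assoc)
  moreover have "p' * z \<in> H W A'" "f' * z \<in> H W B" using p assms(3) H_comp by blast+
  ultimately have "\<exists>!w. w \<in> H W B' \<and> p' * w = p' * z \<and> f' * w = f' * z"
    using assms(1) unfolding pullback_def by blast
  then show ?thesis using assms(2-) by blast
qed

lemma pullback_sym: "pullback A B A' B' p f p' f' \<Longrightarrow> pullback A A' B B' f p f' p'"
  unfolding pullback_def by metis

text \<open>Uniqueness of factorizations is demanded at 0 only; subtraction extends it to all pairs
  in \<open>kernel_mono\<close>.\<close>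

definition kernel :: "'o \<Rightarrow> 'a \<Rightarrow> 'o \<Rightarrow> 'a \<Rightarrow> 'o \<Rightarrow> bool" where
  "kernel A i B p C \<longleftrightarrow> i \<in> H A B \<and> p \<in> H B C \<and> p * i = 0 \<and>
     (\<forall>W. \<forall>f \<in> H W B. p * f = 0 \<longrightarrow> (\<exists>g \<in> H W A. i * g = f)) \<and>
     (\<forall>W. \<forall>g \<in> H W A. i * g = 0 \<longrightarrow> g = 0)"

definition cokernel :: "'o \<Rightarrow> 'a \<Rightarrow> 'o \<Rightarrow> 'a \<Rightarrow> 'o \<Rightarrow> bool" where
  "cokernel A i B p C \<longleftrightarrow> i \<in> H A B \<and> p \<in> H B C \<and> p * i = 0 \<and>
     (\<forall>W. \<forall>f \<in> H B W. f * i = 0 \<longrightarrow> (\<exists>g \<in> H C W. g * p = f)) \<and>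
     (\<forall>W. \<forall>g \<in> H C W. g * p = 0 \<longrightarrow> g = 0)"

lemma kernelI:
  assumes "i \<in> H A B" "p \<in> H B C" "p * i = 0"
    "\<And>W f. f \<in> H W B \<Longrightarrow> p * f = 0 \<Longrightarrow> \<exists>g \<in> H W A. i * g = f"
    "\<And>W g. g \<in> H W A \<Longrightarrow> i * g = 0 \<Longrightarrow> g = 0"
  shows "kernel A i B p C"
  using assms by (auto simp: kernel_def)

lemma cokernelI:
  assumes "i \<in> H A B" "p \<in> H B C" "p * i = 0"
    "\<And>W f. f \<in> H B W \<Longrightarrow> f * i = 0 \<Longrightarrow> \<exists>g \<in> H C W. g * p = f"
    "\<And>W g. g \<in> H C W \<Longrightarrow> g * p = 0 \<Longrightarrow> g = 0"
  shows "cokernel A i B p C"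
  using assms by (auto simp: cokernel_def)

lemma kernel_H:
  assumes "kernel A i B p C" shows "i \<in> H A B" "p \<in> H B C" "p * i = 0"
  using assms by (auto simp: kernel_def)

lemma kernel_ex:
  assumes "kernel A i B p C" "f \<in> H W B" "p * f = 0"
  obtains g where "g \<in> H W A" "i * g = f"
  using assms unfolding kernel_def by metis

lemma kernel_mono:
  assumes "kernel A i B p C" "g \<in> H W A" "h \<in> H W A" "i * g = i * h" shows "g = h"
proof -
  have "i * (g - h) = 0" using assms by (simp add: algebra_simps)
  then have "g - h = 0" using assms(1) H_diff[OF assms(2,3)] unfolding kernel_def by metis
  then show ?thesis by simp
qed

lemma cokernel_H:
  assumes "cokernel A i B p C" shows "i \<in> H A B" "p \<in> H B C" "p * i = 0"
  using assms by (auto simp: cokernel_def)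

lemma cokernel_ex:
  assumes "cokernel A i B p C" "f \<in> H B W" "f * i = 0"
  obtains g where "g \<in> H C W" "g * p = f"
  using assms unfolding cokernel_def by metis

lemma cokernel_epi:
  assumes "cokernel A i B p C" "g \<in> H C W" "h \<in> H C W" "g * p = h * p" shows "g = h"
proof -
  have "(g - h) * p = 0" using assms by (simp add: algebra_simps)
  then have "g - h = 0" using assms(1) H_diff[OF assms(2,3)] unfolding cokernel_def by metis
  then show ?thesis by simp
qed

lemma kernel_unique:
  assumes k: "kernel A i B p C" and k': "kernel A' i' B p C"
  obtains h where "iso A A' h" "i' * h = i"
proof -
  note K = kernel_H[OF k] and K' = kernel_H[OF k']
  obtain g where g: "g \<in> H A' A" "i * g = i'" using kernel_ex[OF k K'(1,3)] .
  obtain h where h: "h \<in> H A A'" "i' * h = i" using kernel_ex[OF k' K(1,3)] .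
  have A: "A \<in> Ob" "A' \<in> Ob" using g H_Ob by blast+
  have "i * (g * h) = i * e A" using g h K by (simp add: mult.assoc[symmetric] id_right)
  then have 1: "g * h = e A" using kernel_mono[OF k H_comp[OF h(1) g(1)] H_id[OF A(1)]] by simp
  have "i' * (h * g) = i' * e A'" using g h K' by (simp add: mult.assoc[symmetric] id_right)
  then have 2: "h * g = e A'" using kernel_mono[OF k' H_comp[OF g(1) h(1)] H_id[OF A(2)]] by simp
  show ?thesis using that isoI[OF h(1) g(1) 1 2] h(2) .
qed

lemma cokernel_unique:
  assumes k: "cokernel A i B p C" and k': "cokernel A i B p' C'"
  obtains h where "iso C C' h" "h * p = p'"
proof -
  note K = cokernel_H[OF k] and K' = cokernel_H[OF k']
  obtain g where g: "g \<in> H C' C" "g * p' = p" using cokernel_ex[OF k' K(2,3)] .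
  obtain h where h: "h \<in> H C C'" "h * p = p'" using cokernel_ex[OF k K'(2,3)] .
  have A: "C \<in> Ob" "C' \<in> Ob" using g H_Ob by blast+
  have "(g * h) * p = e C * p" using g h K by (simp add: mult.assoc id_left)
  then have 1: "g * h = e C" using cokernel_epi[OF k H_comp[OF h(1) g(1)] H_id[OF A(1)]] by simp
  have "(h * g) * p' = e C' * p'" using g h K' by (simp add: mult.assoc id_left)
  then have 2: "h * g = e C'" using cokernel_epi[OF k' H_comp[OF g(1) h(1)] H_id[OF A(2)]] by simp
  show ?thesis using that isoI[OF h(1) g(1) 1 2] h(2) .
qed

end

section \<open>Consequences of Quillen's axioms\<close>

locale ring_exact_category = ring_krull_schmidt Ob H e
  for Ob :: "'o set" and H :: "'o \<Rightarrow> 'o \<Rightarrow> 'a::ring set" and e :: "'o \<Rightarrow> 'a" +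
  fixes CF :: "'o \<Rightarrow> 'a \<Rightarrow> 'o \<Rightarrow> 'a \<Rightarrow> 'o \<Rightarrow> bool"
  assumes CF_kernel: "CF A i B p C \<Longrightarrow> kernel A i B p C"
    and CF_cokernel: "CF A i B p C \<Longrightarrow> cokernel A i B p C"
    and CF_iso: "CF A i B p C \<Longrightarrow> iso A A' a \<Longrightarrow> iso B B' b \<Longrightarrow> iso C C' c \<Longrightarrow>
      i' \<in> H A' B' \<Longrightarrow> p' \<in> H B' C' \<Longrightarrow> b * i = i' * a \<Longrightarrow> c * p = p' * b \<Longrightarrow> CF A' i' B' p' C'"
    and CF_id_left: "X \<in> Ob \<Longrightarrow> \<exists>p C. CF X (e X) X p C"
    and CF_id_right: "X \<in> Ob \<Longrightarrow> \<exists>i A. CF A i X (e X) X"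
    and CF_comp_left: "CF A i B p C \<Longrightarrow> CF B j D q F \<Longrightarrow> \<exists>r G. CF A (j * i) D r G"
    and CF_comp_right: "CF A i B p C \<Longrightarrow> CF D j C q F \<Longrightarrow> \<exists>G k. CF G k B (q * p) F"
    and CF_pushout: "CF A i B p C \<Longrightarrow> f \<in> H A A' \<Longrightarrow>
      \<exists>B' i' f' p' C'. pushout A B A' B' i f i' f' \<and> CF A' i' B' p' C'"
    and CF_pullback: "CF A i B p C \<Longrightarrow> f \<in> H C' C \<Longrightarrow>
      \<exists>B' p' f' A' i'. pullback C B C' B' p f p' f' \<and> CF A' i' B' p' C'"
begin

definition deflation :: "'o \<Rightarrow> 'o \<Rightarrow> 'a \<Rightarrow> bool" where
  "deflation B C p \<longleftrightarrow> (\<exists>A i. CF A i B p C)"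

lemma CF_H:
  assumes "CF A i B p C"
  shows "i \<in> H A B" "p \<in> H B C" "p * i = 0" "A \<in> Ob" "B \<in> Ob" "C \<in> Ob"
  using kernel_H[OF CF_kernel[OF assms]] H_Ob by auto

lemmas CF_ker_ex = kernel_ex[OF CF_kernel]
lemmas CF_mono = kernel_mono[OF CF_kernel]
lemmas CF_coker_ex = cokernel_ex[OF CF_cokernel]
lemmas CF_epi = cokernel_epi[OF CF_cokernel]

lemma CF_mono0: "CF A i B p C \<Longrightarrow> g \<in> H W A \<Longrightarrow> i * g = 0 \<Longrightarrow> g = 0"
  using CF_kernel[unfolded kernel_def] by metis

lemma CF_epi0: "CF A i B p C \<Longrightarrow> g \<in> H C W \<Longrightarrow> g * p = 0 \<Longrightarrow> g = 0"
  using CF_cokernel[unfolded cokernel_def] by metis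

lemma CF_of_kernel:
  assumes "CF A i B p C" "kernel A' i' B p C" shows "CF A' i' B p C"
proof -
  note h = CF_H[OF assms(1)] and k = kernel_H[OF assms(2)]
  obtain a where a: "iso A A' a" "i' * a = i" using kernel_unique[OF CF_kernel[OF assms(1)] assms(2)] .
  show ?thesis
    using a(2) h k by (intro CF_iso[OF assms(1) a(1) iso_id[of B] iso_id[of C]])
      (auto simp: id_left id_right)
qed

lemma CF_of_cokernel:
  assumes "CF A i B p C" "cokernel A i B p' C'" shows "CF A i B p' C'"
proof -
  note h = CF_H[OF assms(1)] and k = cokernel_H[OF assms(2)]
  obtain a where a: "iso C C' a" "a * p = p'" using cokernel_unique[OF CF_cokernel[OF assms(1)] assms(2)] .
  show ?thesis
    using a(2) h k by (intro CF_iso[OF assms(1) iso_id[of A] iso_id[of B] a(1)])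
      (auto simp: id_left id_right)
qed

text \<open>The axiom provides an inflation in some pushout, and the given pushout is isomorphic to
  that one. The map \<open>p'\<close> induced by 0 and \<open>p\<close> is a cokernel of
  \<open>i'\<close>, so the end term \<open>C\<close> is unchanged.\<close>

lemma pushout_CF:
  assumes cf: "CF A i B p C" and po: "pushout A B A' B' i f i' f'"
  obtains p' where "CF A' i' B' p' C" "p' * f' = p"
proof -
  note P = pushout_eqs[OF po] and h = CF_H[OF cf]
  obtain B2 i2 f2 q D where po2: "pushout A B A' B2 i f i2 f2" and cf2: "CF A' i2 B2 q D"
    using CF_pushout[OF cf P(2)] by blast
  note Q = pushout_eqs[OF po2] and h2 = CF_H[OF cf2]
  obtain w where w: "w \<in> H B2 B'" "w * i2 = i'" "w * f2 = f'" using pushout_ex[OF po2 P(3,4,5)] .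
  obtain z where z: "z \<in> H B' B2" "z * i' = i2" "z * f' = f2" using pushout_ex[OF po Q(3,4,5)] .
  have O: "B' \<in> Ob" "B2 \<in> Ob" using z H_Ob by blast+
  have 1: "z * w = e B2"
    using w z Q by (intro pushout_eqI[OF po2 H_comp[OF w(1) z(1)] H_id[OF O(2)]]) (auto simp: mult.assoc id_left)
  have 2: "w * z = e B'"
    using w z P by (intro pushout_eqI[OF po H_comp[OF z(1) w(1)] H_id[OF O(1)]]) (auto simp: mult.assoc id_left)
  have cf3: "CF A' i' B' (q * z) D"
  proof (rule CF_iso[OF cf2 iso_id isoI[OF w(1) z(1) 1 2] iso_id])
    show "e D * q = q * z * w" by (simp add: mult.assoc 1 h2(2)[THEN id_left] h2(2)[THEN id_right])
  qed (use h2 z P w in \<open>auto simp: id_right intro: H_comp\<close>)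
  have A'C: "A' \<in> Ob" "C \<in> Ob" using P h H_Ob by blast+
  obtain p' where p': "p' \<in> H B' C" "p' * i' = 0" "p' * f' = p"
    using pushout_ex[OF po H_zero[OF A'C] h(2)] h(3) by auto
  have "cokernel A' i' B' p' C"
  proof (rule cokernelI)
    fix W u assume u: "u \<in> H B' W" "u * i' = 0"
    have "u * f' * i = u * i' * f" by (simp add: mult.assoc P(5))
    then have "u * f' * i = 0" using u by simp
    then obtain g where g: "g \<in> H C W" "g * p = u * f'"
      using CF_coker_ex[OF cf H_comp[OF P(4) u(1)]] by blast
    have "g * p' = u"
      by (rule pushout_eqI[OF po H_comp[OF p'(1) g(1)] u(1)]) (simp_all add: mult.assoc p' g u)
    then show "\<exists>g \<in> H C W. g * p' = u" using g by blast
  next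
    fix W g assume g: "g \<in> H C W" "g * p' = 0"
    have "g * p = g * p' * f'" by (simp add: mult.assoc p')
    then show "g = 0" using CF_epi0[OF cf g(1)] g(2) by simp
  qed (use P p' in auto)
  from CF_of_cokernel[OF cf3 this] p'(3) show ?thesis using that by blast
qed

lemma pullback_CF:
  assumes cf: "CF A i B p C" and po: "pullback C B C' B' p f p' f'"
  obtains i' where "CF A i' B' p' C'" "f' * i' = i"
proof -
  note P = pullback_eqs[OF po] and h = CF_H[OF cf]
  obtain B2 p2 f2 D q where po2: "pullback C B C' B2 p f p2 f2" and cf2: "CF D q B2 p2 C'"
    using CF_pullback[OF cf P(2)] by blast
  note Q = pullback_eqs[OF po2] and h2 = CF_H[OF cf2]
  obtain w where w: "w \<in> H B2 B'" "p' * w = p2" "f' * w = f2" using pullback_ex[OF po Q(3,4,5)] .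
  obtain z where z: "z \<in> H B' B2" "p2 * z = p'" "f2 * z = f'" using pullback_ex[OF po2 P(3,4,5)] .
  have O: "B' \<in> Ob" "B2 \<in> Ob" using z H_Ob by blast+
  have 1: "z * w = e B2"
    using w z Q by (intro pullback_eqI[OF po2 H_comp[OF w(1) z(1)] H_id[OF O(2)]])
      (auto simp: mult.assoc[symmetric] id_right)
  have 2: "w * z = e B'"
    using w z P by (intro pullback_eqI[OF po H_comp[OF z(1) w(1)] H_id[OF O(1)]])
      (auto simp: mult.assoc[symmetric] id_right)
  have cf3: "CF D (w * q) B' p' C'"
  proof (rule CF_iso[OF cf2 iso_id isoI[OF w(1) z(1) 1 2] iso_id])
    show "w * q = w * q * e D" by (simp add: mult.assoc h2(1)[THEN id_right])
  qed (use h2 z P w in \<open>auto simp: id_left intro: H_comp\<close>)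
  have AC': "A \<in> Ob" "C' \<in> Ob" using P h H_Ob by blast+
  obtain i' where i': "i' \<in> H A B'" "p' * i' = 0" "f' * i' = i"
    using pullback_ex[OF po H_zero[OF AC'] h(1)] h(3) by auto
  have "kernel A i' B' p' C'"
  proof (rule kernelI)
    fix W u assume u: "u \<in> H W B'" "p' * u = 0"
    have "p * (f' * u) = f * (p' * u)" by (simp add: mult.assoc[symmetric] P(5))
    then have "p * (f' * u) = 0" using u by simp
    then obtain g where g: "g \<in> H W A" "i * g = f' * u"
      using CF_ker_ex[OF cf H_comp[OF u(1) P(4)]] by blast
    have "i' * g = u"
      by (rule pullback_eqI[OF po H_comp[OF g(1) i'(1)] u(1)])
        (simp_all add: mult.assoc[symmetric] i' g u)
    then show "\<exists>g \<in> H W A. i' * g = u" using g by blast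
  next
    fix W g assume g: "g \<in> H W A" "i' * g = 0"
    have "i * g = f' * (i' * g)" by (simp add: mult.assoc[symmetric] i')
    then show "g = 0" using CF_mono0[OF cf g(1)] g(2) by simp
  qed (use P i' in auto)
  from CF_of_kernel[OF cf3 this] i'(3) show ?thesis using that by blast
qed

text \<open>A map on \<open>B\<close> that kills \<open>i * k\<close> descends along
  \<open>f\<close> on \<open>A\<close> and then glues over the pushout. So \<open>f'\<close> is a
  cokernel of \<open>i * k\<close>, a composite of inflations, and has the same kernel object
  \<open>D\<close> as \<open>f\<close>.\<close>

lemma pushout_CF_deflation:
  assumes cf: "CF A i B p C" and po: "pushout A B A' B' i f i' f'" and k: "CF D k A f A'"
  shows "CF D (i * k) B f' B'"
proof -
  note P = pushout_eqs[OF po] and h = CF_H[OF cf] and hk = CF_H[OF k]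
  obtain r F where r: "CF D (i * k) B r F" using CF_comp_left[OF k cf] by blast
  have "cokernel D (i * k) B f' B'"
  proof (rule cokernelI)
    show "f' * (i * k) = 0" using mult_eq_assoc[OF P(5)] hk(3) by (metis mult.assoc mult_zero_right)
  next
    fix W u assume u: "u \<in> H B W" "u * (i * k) = 0"
    then obtain v where v: "v \<in> H A' W" "v * f = u * i"
      using CF_coker_ex[OF k H_comp[OF P(1) u(1)]] by (metis mult.assoc)
    obtain w where "w \<in> H B' W" "w * i' = v" "w * f' = u" using pushout_ex[OF po v(1) u(1) v(2)] .
    then show "\<exists>g \<in> H B' W. g * f' = u" by blast
  next
    fix W g assume g: "g \<in> H B' W" "g * f' = 0"
    have "g * i' * f = g * f' * i" by (simp add: mult.assoc P(5))
    then have "g * i' = 0" using g(2) CF_epi0[OF k H_comp[OF P(3) g(1)]] by simp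
    then show "g = 0"
      using pushout_eqI[OF po g(1) H_zero] g H_Ob[OF g(1)] by simp
  qed (use P hk H_comp in blast)+
  with r show ?thesis by (rule CF_of_cokernel)
qed


text \<open>The idempotent \<open>e B - i * r\<close> kills \<open>i\<close> and so factors through
  \<open>p\<close>; the factor is the section.\<close>

lemma CF_split_retraction:
  assumes cf: "CF A i B p C" and r: "r \<in> H B A" "r * i = e A"
  shows "\<exists>s. biprod A C B i r s p"
proof -
  note h = CF_H[OF cf]
  note hs = h(3)[THEN mult_eq_assoc] r(2)[THEN mult_eq_assoc] h(1,2)[THEN id_left] h(1,2)[THEN id_right]
    r(1)[THEN id_left] r(1)[THEN id_right] h(1,2)[THEN id_left_assoc] r(1)[THEN id_left_assoc]
  have "e B - i * r \<in> H B B" using h r by (blast intro: H_id H_diff H_comp)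
  moreover have "(e B - i * r) * i = 0" by (simp add: algebra_simps hs r)
  ultimately obtain s where s: "s \<in> H C B" "s * p = e B - i * r" using CF_coker_ex[OF cf] by blast
  have "(p * s) * p = e C * p" by (simp add: mult.assoc s algebra_simps hs)
  then have 1: "p * s = e C" by (rule CF_epi[OF cf H_comp[OF s(1) h(2)] H_id[OF h(6)]])
  have "(r * s) * p = 0" by (simp add: mult.assoc s algebra_simps hs)
  then have "r * s = 0" by (rule CF_epi0[OF cf H_comp[OF s(1) r(1)]])
  then have "biprod A C B i r s p" using 1 h r s by (intro biprodI) auto
  then show ?thesis by blast
qed

lemma CF_split_section:
  assumes cf: "CF A i B p C" and s: "s \<in> H C B" "p * s = e C"
  shows "\<exists>r. biprod A C B i r s p"
proof -
  note h = CF_H[OF cf]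
  note hs = h(3)[THEN mult_eq_assoc] s(2)[THEN mult_eq_assoc] h(1,2)[THEN id_left] h(1,2)[THEN id_right]
    s(1)[THEN id_left] s(1)[THEN id_right] h(1,2)[THEN id_left_assoc] s(1)[THEN id_left_assoc]
  have "e B - s * p \<in> H B B" using h s by (blast intro: H_id H_diff H_comp)
  moreover have "p * (e B - s * p) = 0" by (simp add: algebra_simps hs s)
  ultimately obtain r where r: "r \<in> H B A" "i * r = e B - s * p" using CF_ker_ex[OF cf] by blast
  have "i * (r * i) = i * e A" by (simp add: mult.assoc[symmetric] r) (simp add: algebra_simps hs h)
  then have 1: "r * i = e A" by (rule CF_mono[OF cf H_comp[OF h(1) r(1)] H_id[OF h(4)]])
  have "i * (r * s) = 0" by (simp add: mult.assoc[symmetric] r) (simp add: algebra_simps hs s)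
  then have "r * s = 0" by (rule CF_mono0[OF cf H_comp[OF s(1) r(1)]])
  then have "biprod A C B i r s p" using 1 h r s by (intro biprodI) auto
  then show ?thesis by blast
qed

text \<open>The sum of \<open>p\<close> with an identity is the pullback of \<open>p\<close> along
  the projection \<open>m1\<close>.\<close>

lemma CF_biprod_id:
  assumes cf: "CF A i B p C" and B: "biprod B B' V j1 q1 j2 q2" and D: "biprod C B' D l1 m1 l2 m2"
  shows "\<exists>i'. CF A i' V (l1 * (p * q1) + l2 * q2) D"
proof -
  note h = CF_H[OF cf]
  note b = biprod_simps[OF B] biprod_simps[OF D] and bH = biprod_H[OF B] biprod_H[OF D]
  have "pullback C B D V p m1 (l1 * (p * q1) + l2 * q2) q1"
    unfolding pullback_def
  proof (intro conjI allI ballI impI)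
    show "l1 * (p * q1) + l2 * q2 \<in> H V D" using bH h by (blast intro: H_comp H_add)
    show "m1 * (l1 * (p * q1) + l2 * q2) = p * q1"
      by (simp add: algebra_simps b h(2)[THEN id_left_assoc])
    fix W u v assume u: "u \<in> H W D" and v: "v \<in> H W B" and uv: "m1 * u = p * v"
    show "\<exists>!w. w \<in> H W V \<and> (l1 * (p * q1) + l2 * q2) * w = u \<and> q1 * w = v"
    proof (rule ex1I[where a = "j1 * v + j2 * (m2 * u)"], intro conjI)
      show "j1 * v + j2 * (m2 * u) \<in> H W V" using bH u v by (blast intro: H_comp H_add)
      show "(l1 * (p * q1) + l2 * q2) * (j1 * v + j2 * (m2 * u)) = u"
        by (simp add: algebra_simps b v[THEN id_left] u[THEN id_left] uv[symmetric])
      show "q1 * (j1 * v + j2 * (m2 * u)) = v"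
        by (simp add: algebra_simps b v[THEN id_left])
    next
      fix w assume w: "w \<in> H W V \<and> (l1 * (p * q1) + l2 * q2) * w = u \<and> q1 * w = v"
      have "m2 * u = m2 * ((l1 * (p * q1) + l2 * q2) * w)" using w by simp
      also have "\<dots> = q2 * w" by (simp add: algebra_simps b)
      finally show "w = j1 * v + j2 * (m2 * u)" using w id_left[of w W V]
        by (simp add: b algebra_simps)
    qed
  qed (use bH h in auto)
  from pullback_CF[OF cf this] show ?thesis by metis
qed

text \<open>The sum of the deflations is a composite through \<open>C + B'\<close> of two sums of a
  deflation with an identity, hence a deflation. Its kernel is then found componentwise.\<close>

lemma CF_biprod:
  assumes cf: "CF A i B p C" and cf': "CF A' i' B' p' C'"
    and U: "biprod A A' U i1 p1 i2 p2" and V: "biprod B B' V j1 q1 j2 q2" and W: "biprod C C' W k1 r1 k2 r2"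
  shows "CF U (j1 * (i * p1) + j2 * (i' * p2)) V (k1 * (p * q1) + k2 * (p' * q2)) W"
proof -
  note h = CF_H[OF cf] and h' = CF_H[OF cf']
  obtain D l1 m1 l2 m2 where D: "biprod C B' D l1 m1 l2 m2"
    using biprod_exists[OF h(6) h'(5)] by blast
  note b = biprod_simps[OF U] biprod_simps[OF V] biprod_simps[OF W] biprod_simps[OF D]
    and bH = biprod_H[OF U] biprod_H[OF V] biprod_H[OF W] biprod_H[OF D]
  obtain \<alpha> where \<alpha>: "CF A \<alpha> V (l1 * (p * q1) + l2 * q2) D" using CF_biprod_id[OF cf V D] by blast
  obtain \<beta> where \<beta>: "CF A' \<beta> D (k2 * (p' * m2) + k1 * m1) W"
    using CF_biprod_id[OF cf' biprod_swap[OF D] biprod_swap[OF W]] by blast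
  have "(k2 * (p' * m2) + k1 * m1) * (l1 * (p * q1) + l2 * q2) = k1 * (p * q1) + k2 * (p' * q2)"
    by (simp add: algebra_simps b h(2)[THEN id_left_assoc])
  then obtain G k where G: "CF G k V (k1 * (p * q1) + k2 * (p' * q2)) W"
    using CF_comp_right[OF \<alpha> \<beta>] by auto
  note hs = h(1,2)[THEN id_left_assoc] h'(1,2)[THEN id_left_assoc] h(3)[THEN mult_eq_assoc] h'(3)[THEN mult_eq_assoc]
  have "kernel U (j1 * (i * p1) + j2 * (i' * p2)) V (k1 * (p * q1) + k2 * (p' * q2)) W"
  proof (rule kernelI)
    show "j1 * (i * p1) + j2 * (i' * p2) \<in> H U V" "k1 * (p * q1) + k2 * (p' * q2) \<in> H V W"
      using bH h h' by (blast intro: H_comp H_add)+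
    show "(k1 * (p * q1) + k2 * (p' * q2)) * (j1 * (i * p1) + j2 * (i' * p2)) = 0"
      by (simp add: algebra_simps b hs)
    fix X f assume f: "f \<in> H X V" "(k1 * (p * q1) + k2 * (p' * q2)) * f = 0"
    have "p * (q1 * f) = r1 * ((k1 * (p * q1) + k2 * (p' * q2)) * f)"
      "p' * (q2 * f) = r2 * ((k1 * (p * q1) + k2 * (p' * q2)) * f)"
      by (simp_all add: algebra_simps b h(2)[THEN id_left_assoc] h'(2)[THEN id_left_assoc])
    then have z: "p * (q1 * f) = 0" "p' * (q2 * f) = 0" using f by simp_all
    obtain g where g: "g \<in> H X A" "i * g = q1 * f" using CF_ker_ex[OF cf H_comp[OF f(1) bH(6)] z(1)] .
    obtain g' where g': "g' \<in> H X A'" "i' * g' = q2 * f" using CF_ker_ex[OF cf' H_comp[OF f(1) bH(8)] z(2)] .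
    have "(j1 * (i * p1) + j2 * (i' * p2)) * (i1 * g + i2 * g') = f"
      using f by (simp add: algebra_simps b g g' g(1)[THEN id_left] g'(1)[THEN id_left] id_left)
    moreover have "i1 * g + i2 * g' \<in> H X U" using bH g g' by (blast intro: H_comp H_add)
    ultimately show "\<exists>g \<in> H X U. (j1 * (i * p1) + j2 * (i' * p2)) * g = f" by blast
  next
    fix X g assume g: "g \<in> H X U" "(j1 * (i * p1) + j2 * (i' * p2)) * g = 0"
    have "i * (p1 * g) = q1 * ((j1 * (i * p1) + j2 * (i' * p2)) * g)"
      "i' * (p2 * g) = q2 * ((j1 * (i * p1) + j2 * (i' * p2)) * g)"
      by (simp_all add: algebra_simps b hs)
    then have "i * (p1 * g) = 0" "i' * (p2 * g) = 0" using g by simp_all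
    then have "p1 * g = 0" "p2 * g = 0"
      using CF_mono0[OF cf H_comp[OF g(1) bH(2)]] CF_mono0[OF cf' H_comp[OF g(1) bH(4)]] by auto
    moreover have "g = i1 * (p1 * g) + i2 * (p2 * g)" using g by (simp add: b id_left)
    ultimately show "g = 0" by simp
  qed
  from CF_of_kernel[OF G this] show ?thesis .
qed

lemma deflation_H: "deflation B C p \<Longrightarrow> p \<in> H B C"
  unfolding deflation_def using CF_H by blast

text \<open>Quillen's obscure axiom. Pulling \<open>q * d\<close> back along \<open>q\<close> gives a deflation onto \<open>B\<close>
  whose source contains \<open>A\<close> as a retract via \<open>(1, d)\<close>; the complement, which exists because
  the category is Krull-Schmidt, is a kernel of \<open>q\<close>.\<close>

lemma deflation_cancel:
  assumes d: "d \<in> H A B" and q: "q \<in> H B X" and qd: "deflation A X (q * d)"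
  shows "deflation B X q"
proof -
  obtain L l where cf: "CF L l A (q * d) X" using qd unfolding deflation_def by blast
  note h = CF_H[OF cf]
  obtain D p' f' where pb: "pullback X A B D (q * d) q p' f'" using CF_pullback[OF cf q] by blast
  note P = pullback_eqs[OF pb]
  obtain n where n: "CF L n D p' B" "f' * n = l" using pullback_CF[OF cf pb] .
  note hn = CF_H[OF n(1)]
  have O: "A \<in> Ob" "B \<in> Ob" "D \<in> Ob" using P H_Ob by blast+
  obtain \<sigma> where s: "\<sigma> \<in> H A D" "p' * \<sigma> = d" "f' * \<sigma> = e A"
    using pullback_ex[OF pb d H_id[OF O(1)]] h(2)[THEN id_right] by auto
  obtain N \<kappa> \<pi> where N: "biprod A N D \<sigma> f' \<kappa> \<pi>" using retract_complement[OF s(1) P(4) s(3)] by blast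
  note b = biprod_simps[OF N] and bH = biprod_H[OF N]
  define k where "k = p' * \<kappa>"
  have kH: "k \<in> H N B" unfolding k_def using bH P H_comp by blast
  have qk: "q * k = 0" unfolding k_def using P(5) b by (metis mult.assoc mult_zero_right)
  have p': "p' = d * f' + k * \<pi>"
  proof -
    have "p' = p' * (\<sigma> * f' + \<kappa> * \<pi>)" using P(3) b by (simp add: id_right)
    then show ?thesis by (simp add: k_def s(2)[symmetric] distrib_left mult.assoc)
  qed
  have kmono: "g = 0" if g: "g \<in> H W N" "k * g = 0" for W g
  proof -
    have 0: "0 \<in> H W D" using g(1) O H_Ob H_zero by blast
    have "p' * (\<kappa> * g) = p' * 0" "f' * (\<kappa> * g) = f' * 0"
      using g by (simp_all add: k_def mult.assoc b)
    then have "\<kappa> * g = 0" by (rule pullback_eqI[OF pb H_comp[OF g(1) bH(3)] 0])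
    then have "\<pi> * (\<kappa> * g) = 0" by simp
    then show ?thesis using g by (simp add: b id_left)
  qed
  have kker: "\<exists>g \<in> H W N. k * g = w" if w: "w \<in> H W B" "q * w = 0" for W w
  proof -
    have "0 \<in> H W A" using w O H_Ob H_zero by blast
    then obtain v where v: "v \<in> H W D" "p' * v = w" "f' * v = 0"
      using pullback_ex[OF pb w(1)] w(2) by (metis mult_zero_right)
    have "k * (\<pi> * v) = w" using v p' by (simp add: distrib_right mult.assoc)
    then show ?thesis using H_comp[OF v(1) bH(4)] by blast
  qed
  \<comment> \<open>The sign comes from \<open>p' * n = 0\<close>, where the contributions
    \<open>d * l\<close> and \<open>k * (\<pi> * n)\<close> cancel.\<close>
  let ?t = "- (\<pi> * n)"
  have tH: "?t \<in> H L N" using bH hn by (blast intro: H_comp H_minus)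
  have kt: "k * ?t = d * l"
  proof -
    have "p' * n = d * l + k * (\<pi> * n)" by (simp add: p' distrib_right mult.assoc n)
    then show ?thesis using hn(3) by (simp add: neg_eq_iff_add_eq_0 add.commute)
  qed
  \<comment> \<open>A kernel \<open>k\<close> of \<open>q\<close> alone does not make
    \<open>q\<close> a deflation. But \<open>k\<close> is also a pushout of the inflation
    \<open>l\<close>, hence an inflation, and the deflation \<open>q'\<close> that belongs to it
    agrees with \<open>q\<close> on \<open>k\<close> and on \<open>d\<close>, thus after the
    epimorphism \<open>p'\<close>.\<close>
  have "pushout L A N B l ?t k d"
    unfolding pushout_def
  proof (intro conjI allI ballI impI)
    fix W u v assume u: "u \<in> H N W" and v: "v \<in> H A W" and uv: "u * ?t = v * l"
    have "(v * f' + u * \<pi>) * n = 0"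
      using uv by (simp add: distrib_right mult.assoc n neg_eq_iff_add_eq_0 add.commute)
    moreover have "v * f' + u * \<pi> \<in> H D W" using u v bH by (blast intro: H_comp H_add)
    ultimately obtain w where w: "w \<in> H B W" "w * p' = v * f' + u * \<pi>"
      using CF_coker_ex[OF n(1)] by blast
    have wd: "w * d = v"
    proof -
      have "w * d = (w * p') * \<sigma>" by (simp add: mult.assoc s)
      then show ?thesis by (simp add: w(2) distrib_right mult.assoc b v[THEN id_right])
    qed
    have wk: "w * k = u"
    proof -
      have "w * k = (w * p') * \<kappa>" by (simp add: mult.assoc k_def)
      then show ?thesis by (simp add: w(2) distrib_right mult.assoc b u[THEN id_right])
    qed
    show "\<exists>!w. w \<in> H B W \<and> w * k = u \<and> w * d = v"
    proof (rule ex1I[of _ w])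
      fix z assume z: "z \<in> H B W \<and> z * k = u \<and> z * d = v"
      have "z * p' = w * p'"
        using z wd wk by (simp add: p' distrib_left mult.assoc[symmetric])
      then show "z = w" using CF_epi[OF n(1)] z w(1) by blast
    qed (use w wd wk in auto)
  qed (use h tH kH d kt in auto)
  then obtain q' where q': "CF N k B q' X" "q' * d = q * d" using pushout_CF[OF cf] by blast
  have "q' * k = q * k" using qk CF_H(3)[OF q'(1)] by simp
  then have "q' * p' = q * p'" using q'(2) by (simp add: p' distrib_left mult.assoc[symmetric])
  then have "q' = q" by (rule CF_epi[OF n(1) CF_H(2)[OF q'(1)] q])
  then show ?thesis using q'(1) unfolding deflation_def by blast
qed


text \<open>A split sequence is the direct sum of the conflations \<open>A = A -> 0\<close> and
  \<open>0 -> B = B\<close>.\<close>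

lemma CF_of_biprod:
  assumes b: "biprod A B U i p j q" shows "CF A i U q B"
proof -
  note O = biprod_Ob[OF b] and h = biprod_H[OF b]
  obtain r Z where Z: "CF A (e A) A r Z" using CF_id_left[OF O(1)] by blast
  obtain s Z' where Z': "CF Z' s B (e B) B" using CF_id_right[OF O(2)] by blast
  note hZ = CF_H[OF Z] and hZ' = CF_H[OF Z']
  have r: "r = 0" using hZ(3) id_right[OF hZ(2)] by simp
  have "e Z = 0" using CF_epi0[OF Z H_id[OF hZ(6)]] r by simp
  have s: "s = 0" using hZ'(3) id_left[OF hZ'(1)] by simp
  have "e Z' = 0" using CF_mono0[OF Z' H_id[OF hZ'(4)]] s by simp
  have 1: "biprod A Z' A (e A) (e A) 0 0" using biprod_zero_right O hZ' \<open>e Z' = 0\<close> by blast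
  have 2: "biprod Z B B 0 0 (e B) (e B)" using biprod_swap[OF biprod_zero_right] O hZ \<open>e Z = 0\<close> by blast
  from CF_biprod[OF Z Z' 1 b 2] show ?thesis
    using O by (simp add: biprod_simps[OF b] id_left[OF H_id])
qed

end

section \<open>Mutually inverse integer matrices\<close>

text \<open>A diagonal entry 1 of the product forces some \<open>N a t\<close> to be nonzero, so
  \<open>T\<close> is covered by the finite supports of the rows of \<open>N\<close>, which are
  indexed by \<open>A\<close>.\<close>

lemma ordLeq_of_inverse_matrix:
  fixes M :: "'t \<Rightarrow> 'a \<Rightarrow> int" and N :: "'a \<Rightarrow> 't \<Rightarrow> int"
  assumes fin: "\<And>a. a \<in> A \<Longrightarrow> finite {t \<in> T. N a t \<noteq> 0}"
    and MN: "\<And>t. t \<in> T \<Longrightarrow> (\<Sum>a | a \<in> A \<and> M t a \<noteq> 0. M t a * N a t) = 1"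
  shows "finite A \<Longrightarrow> finite T" and "infinite A \<Longrightarrow> |T| \<le>o |A|"
proof -
  have sub: "T \<subseteq> (\<Union>a\<in>A. {t \<in> T. N a t \<noteq> 0})"
  proof
    fix t assume t: "t \<in> T"
    then have "(\<Sum>a | a \<in> A \<and> M t a \<noteq> 0. M t a * N a t) \<noteq> 0" using MN by simp
    then obtain a where "a \<in> A" "M t a * N a t \<noteq> 0" by (metis (mono_tags, lifting) mem_Collect_eq sum.neutral)
    then show "t \<in> (\<Union>a\<in>A. {t \<in> T. N a t \<noteq> 0})" using t by auto
  qed
  show "finite T" if "finite A" using finite_subset[OF sub] that fin by auto
  show "|T| \<le>o |A|" if "infinite A"
  proof -
    have "|{t \<in> T. N a t \<noteq> 0}| \<le>o |A|" if "a \<in> A" for a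
      using ordLeq_total[OF card_of_Well_order card_of_Well_order]
        card_of_ordLeq_finite fin[OF that] \<open>infinite A\<close> by blast
    then have "|\<Union>a\<in>A. {t \<in> T. N a t \<noteq> 0}| \<le>o |A|"
      by (intro card_of_UNION_ordLeq_infinite[OF that card_of_refl[THEN ordIso_imp_ordLeq]] ballI)
    then show ?thesis by (rule ordLeq_transitive[OF card_of_mono1[OF sub]])
  qed
qed

text \<open>In the finite case both cardinalities are the trace of the product.\<close>

lemma ordIso_of_inverse_matrices:
  fixes M :: "'t \<Rightarrow> 'a \<Rightarrow> int" and N :: "'a \<Rightarrow> 't \<Rightarrow> int"
  assumes finN: "\<And>a. a \<in> A \<Longrightarrow> finite {t \<in> T. N a t \<noteq> 0}"
    and finM: "\<And>t. t \<in> T \<Longrightarrow> finite {a \<in> A. M t a \<noteq> 0}"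
    and MN: "\<And>t. t \<in> T \<Longrightarrow> (\<Sum>a | a \<in> A \<and> M t a \<noteq> 0. M t a * N a t) = 1"
    and NM: "\<And>a. a \<in> A \<Longrightarrow> (\<Sum>t | t \<in> T \<and> N a t \<noteq> 0. N a t * M t a) = 1"
  shows "|A| =o |T|"
proof (cases "finite A")
  case A: True
  then have T: "finite T" using ordLeq_of_inverse_matrix(1)[OF finN MN] by blast
  have "int (card T) = (\<Sum>t\<in>T. \<Sum>a | a \<in> A \<and> M t a \<noteq> 0. M t a * N a t)" using MN by simp
  also have "\<dots> = (\<Sum>t\<in>T. \<Sum>a\<in>A. M t a * N a t)"
    using A by (intro sum.cong refl sum.mono_neutral_left) auto
  also have "\<dots> = (\<Sum>a\<in>A. \<Sum>t\<in>T. N a t * M t a)" by (subst sum.swap) (simp add: mult.commute)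
  also have "\<dots> = (\<Sum>a\<in>A. \<Sum>t | t \<in> T \<and> N a t \<noteq> 0. N a t * M t a)"
    using T by (intro sum.cong refl sum.mono_neutral_right) auto
  also have "\<dots> = int (card A)" using NM by simp
  finally have "card A = card T" by simp
  then show ?thesis using finite_same_card_bij[OF A T] card_of_ordIsoI by blast
next
  case A: False
  then have T: "infinite T" using ordLeq_of_inverse_matrix(1)[OF finM NM] by blast
  show ?thesis
    using ordLeq_of_inverse_matrix(2)[OF finN MN A] ordLeq_of_inverse_matrix(2)[OF finM NM T]
    by (simp add: ordIso_iff_ordLeq)
qed

lemma sum_mset_eq_sum_count:
  fixes f :: "'b \<Rightarrow> int"
  assumes "finite S" "set_mset M \<subseteq> S"
  shows "(\<Sum>x\<in>#M. f x) = (\<Sum>x\<in>S. int (count M x) * f x)"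
  using assms(2)
proof (induction M)
  case (add y M)
  have "(\<Sum>x\<in>S. int (count (add_mset y M) x) * f x) =
      (\<Sum>x\<in>S. int (count M x) * f x + (if y = x then f x else 0))"
    by (intro sum.cong) (auto simp: algebra_simps)
  also have "\<dots> = (\<Sum>x\<in>S. int (count M x) * f x) + f y"
    using add.prems assms(1) by (simp add: sum.distrib)
  finally show ?case using add by simp
qed simp

text \<open>Evaluates an additive function on the formal difference of \<open>M\<close> and
  \<open>N\<close>. Elements whose multiplicities cancel drop out, which leaves the support of
  \<open>g\<close>.\<close>

lemma sum_mset_diff:
  fixes f :: "'b \<Rightarrow> int"
  assumes "set_mset M \<subseteq> A" "set_mset N \<subseteq> A" "\<And>x. g x = int (count M x) - int (count N x)"
  shows "finite {x \<in> A. g x \<noteq> 0}"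
    and "(\<Sum>x\<in>#M. f x) - (\<Sum>x\<in>#N. f x) = (\<Sum>x | x \<in> A \<and> g x \<noteq> 0. g x * f x)"
proof -
  let ?S = "set_mset M \<union> set_mset N"
  have sub: "{x \<in> A. g x \<noteq> 0} \<subseteq> ?S" using assms(3) by (auto simp: not_in_iff)
  then show "finite {x \<in> A. g x \<noteq> 0}" by (rule finite_subset) simp
  have "(\<Sum>x\<in>#M. f x) - (\<Sum>x\<in>#N. f x) = (\<Sum>x\<in>?S. g x * f x)"
    by (subst (1 2) sum_mset_eq_sum_count[of ?S])
      (auto simp: sum_subtractf[symmetric] assms(3) left_diff_distrib)
  also have "\<dots> = (\<Sum>x | x \<in> A \<and> g x \<noteq> 0. g x * f x)"
    using sub assms(1,2) by (intro sum.mono_neutral_right) auto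
  finally show "(\<Sum>x\<in>#M. f x) - (\<Sum>x\<in>#N. f x) = (\<Sum>x | x \<in> A \<and> g x \<noteq> 0. g x * f x)" .
qed

section \<open>Tilting pairs\<close>

context ring_category
begin

lemma pushout_sym: "pushout A B A' B' i f i' f' \<Longrightarrow> pushout A A' B B' f i f' i'"
  unfolding pushout_def by metis

definition summand_closed :: "'o set \<Rightarrow> bool" where
  "summand_closed S \<longleftrightarrow> S \<subseteq> Ob \<and> (\<forall>A B U i p j q. biprod A B U i p j q \<longrightarrow> U \<in> S \<longleftrightarrow> A \<in> S \<and> B \<in> S)"

lemma summand_closed_Ob: "summand_closed S \<Longrightarrow> X \<in> S \<Longrightarrow> X \<in> Ob"
  by (auto simp: summand_closed_def)

lemma summand_closed_iff:
  "summand_closed S \<Longrightarrow> biprod A B U i p j q \<Longrightarrow> U \<in> S \<longleftrightarrow> A \<in> S \<and> B \<in> S"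
  unfolding summand_closed_def by metis

end

context ring_krull_schmidt
begin

text \<open>As \<open>X\<close> is a biproduct of itself and a zero object, the equivalence in
  \<open>summand_closed\<close> puts that zero object into \<open>S\<close>; and \<open>Y\<close> is
  another biproduct of the same two objects.\<close>

lemma summand_closed_isom:
  assumes S: "summand_closed S" "X \<in> S" and XY: "isom X Y" shows "Y \<in> S"
proof -
  obtain Z where Z: "Z \<in> Ob" "e Z = 0" using zero_exists by blast
  note b = biprod_zero_right[OF summand_closed_Ob[OF S] Z]
  obtain f g where "f \<in> H X Y" "g \<in> H Y X" "g * f = e X" "f * g = e Y"
    using XY unfolding isom_def iso_def by blast
  from biprod_comp_iso[OF b this] show ?thesis
    using summand_closed_iff[OF S(1)] b S(2) by blast
qed

lemma summand_closed_decomp: "decomp X Xs \<Longrightarrow> summand_closed S \<Longrightarrow> X \<in> S \<Longrightarrow> set Xs \<subseteq> S"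
proof (induction rule: decomp.induct)
  case (Cons X A Z i p j q Xs)
  then show ?case using summand_closed_iff[OF Cons.prems(1) Cons.hyps(1)] by simp
qed simp

lemma set_K_subset:
  assumes S: "summand_closed S" "X \<in> S" shows "set_mset (K X) \<subseteq> cls ` {X \<in> S. loc X}"
proof -
  obtain Xs where Xs: "decomp X Xs" using decomp_exists summand_closed_Ob[OF S] by blast
  then show ?thesis
    using K_decomp[OF Xs] summand_closed_decomp[OF Xs S] decomp_loc[OF Xs] by auto
qed

text \<open>Choosing a representative of each class turns an additive function into a matrix.\<close>

lemma additive_eq_sum_K:
  fixes F :: "'o \<Rightarrow> int"
  assumes S: "summand_closed S"
    and add: "\<And>A B U i p j q. biprod A B U i p j q \<Longrightarrow> U \<in> S \<Longrightarrow> F U = F A + F B"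
  obtains f where "\<And>X. X \<in> S \<Longrightarrow> F X = (\<Sum>c\<in>#K X. f c)" "\<And>X. X \<in> S \<Longrightarrow> loc X \<Longrightarrow> f (cls X) = F X"
proof -
  have zero: "F Z = 0" if Z: "Z \<in> S" "e Z = 0" for Z
    using add[OF biprod_zero_right[of Z Z]] Z summand_closed_Ob[OF S Z(1)] by simp
  have isom: "F X = F Y" if XY: "isom X Y" "X \<in> S" for X Y
  proof -
    obtain Z where Z: "Z \<in> Ob" "e Z = 0" using zero_exists by blast
    note b = biprod_zero_right[OF summand_closed_Ob[OF S XY(2)] Z]
    then have "Z \<in> S" using summand_closed_iff[OF S] XY by blast
    obtain f g where "f \<in> H X Y" "g \<in> H Y X" "g * f = e X" "f * g = e Y"
      using XY unfolding isom_def iso_def by blast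
    from biprod_comp_iso[OF b this] have "F Y = F X + F Z"
      using add summand_closed_isom[OF S XY(2,1)] by blast
    then show ?thesis using zero[OF \<open>Z \<in> S\<close> Z(2)] by simp
  qed
  \<comment> \<open>The representative is arbitrary: by \<open>isom\<close>, the value does not
    depend on it.\<close>
  define f where "f c = F (SOME X. X \<in> S \<and> loc X \<and> cls X = c)" for c
  have f: "f (cls X) = F X" if X: "X \<in> S" "loc X" for X
  proof -
    let ?Y = "SOME Y. Y \<in> S \<and> loc Y \<and> cls Y = cls X"
    have Y: "?Y \<in> S \<and> loc ?Y \<and> cls ?Y = cls X" by (rule someI[of _ X]) (use X in simp)
    then have "isom ?Y X" using cls_eq loc_Ob by blast
    then show ?thesis using isom Y unfolding f_def by blast
  qed
  have "F X = (\<Sum>c\<in>#K X. f c)" if X: "X \<in> S" for X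
  proof -
    obtain Xs where Xs: "decomp X Xs" using decomp_exists summand_closed_Ob[OF S X] by blast
    have "F X = (\<Sum>Y\<in>#mset Xs. f (cls Y))" using Xs X
    proof (induction rule: decomp.induct)
      case (Nil Z)
      then show ?case using zero by simp
    next
      case (Cons X A Z i p j q Xs)
      then show ?case using add[OF Cons.hyps(1)] summand_closed_iff[OF S Cons.hyps(1)] f by simp
    qed
    then show ?thesis using K_decomp[OF Xs] by (simp add: image_mset.compositionality comp_def)
  qed
  then show ?thesis using that f by blast
qed

end

text \<open>\<open>extend\<close> is the vanishing of Ext between objects of \<open>T\<close>, and
  \<open>lift\<close> is projectivity of \<open>P\<close> relative to deflations with source in
  \<open>P\<close> or \<open>T\<close>. They split the pushouts and pullbacks below.\<close>

locale tilting_pair = ring_exact_category Ob H e CF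
  for Ob :: "'o set" and H :: "'o \<Rightarrow> 'o \<Rightarrow> 'a::ring set" and e :: "'o \<Rightarrow> 'a"
    and CF :: "'o \<Rightarrow> 'a \<Rightarrow> 'o \<Rightarrow> 'a \<Rightarrow> 'o \<Rightarrow> bool" +
  fixes P T :: "'o set"
  assumes P_closed: "summand_closed P" and T_closed: "summand_closed T"
    and resolution_exists: "X \<in> T \<Longrightarrow> \<exists>A i B p. CF A i B p X \<and> A \<in> P \<and> B \<in> P"
    and coresolution_exists: "X \<in> P \<Longrightarrow> \<exists>i B p C. CF X i B p C \<and> B \<in> T \<and> C \<in> T"
    and extend: "CF A i B p C \<Longrightarrow> C \<in> T \<Longrightarrow> f \<in> H A Y \<Longrightarrow> Y \<in> T \<Longrightarrow> \<exists>g \<in> H B Y. g * i = f"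
    and lift: "CF A i B p C \<Longrightarrow> B \<in> P \<union> T \<Longrightarrow> f \<in> H Y C \<Longrightarrow> Y \<in> P \<Longrightarrow> \<exists>g \<in> H Y B. p * g = f"
begin

definition res :: "'o \<Rightarrow> 'o \<Rightarrow> 'o \<Rightarrow> bool" where
  "res X A B \<longleftrightarrow> A \<in> P \<and> B \<in> P \<and> (\<exists>i p. CF A i B p X)"

definition cores :: "'o \<Rightarrow> 'o \<Rightarrow> 'o \<Rightarrow> bool" where
  "cores X B C \<longleftrightarrow> B \<in> T \<and> C \<in> T \<and> (\<exists>i p. CF X i B p C)"

text \<open>The lift \<open>g\<close> of \<open>f\<close> and the identity of \<open>C'\<close>
  together induce a section of \<open>p'\<close>.\<close>

lemma pullback_split:
  assumes cf: "CF A i B p C" and pb: "pullback C B C' B' p f p' f'" and g: "g \<in> H C' B" "p * g = f"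
  shows "\<exists>i' r s. biprod A C' B' i' r s p'"
proof -
  note h = pullback_eqs[OF pb]
  obtain i' where i': "CF A i' B' p' C'" using pullback_CF[OF cf pb] .
  have "C' \<in> Ob" using H_Ob[OF h(2)] by blast
  obtain s where "s \<in> H C' B'" "p' * s = e C'"
    using pullback_ex[OF pb H_id[OF \<open>C' \<in> Ob\<close>] g(1)] g(2) h(2)[THEN id_right] by auto
  from CF_split_section[OF i' this] show ?thesis by blast
qed

lemma pushout_split:
  assumes cf: "CF A i B p C" and po: "pushout A B A' B' i f i' f'" and g: "g \<in> H B A'" "g * i = f"
  shows "\<exists>r s p'. biprod A' C B' i' r s p'"
proof -
  note h = pushout_eqs[OF po]
  obtain p' where p': "CF A' i' B' p' C" using pushout_CF[OF cf po] .
  have "A' \<in> Ob" using H_Ob[OF h(2)] by blast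
  obtain r where "r \<in> H B' A'" "r * i' = e A'"
    using pushout_ex[OF po H_id[OF \<open>A' \<in> Ob\<close>] g(1)] g(2) h(2)[THEN id_left] by auto
  from CF_split_retraction[OF p' this] show ?thesis by blast
qed

text \<open>\<open>B\<close> and \<open>B'\<close> both lie in \<open>P\<close>, so each of the two
  deflations lifts through the other, and their pullback \<open>U\<close> splits both as
  \<open>A + B'\<close> and as \<open>A' + B\<close>.\<close>

lemma res_unique:
  assumes "res X A B" "res X A' B'" shows "K B + K A' = K B' + K A"
proof -
  obtain i p where cf: "CF A i B p X" using assms(1) unfolding res_def by blast
  obtain i' p' where cf': "CF A' i' B' p' X" using assms(2) unfolding res_def by blast
  note AB = assms[unfolded res_def]
  note h = CF_H[OF cf] and h' = CF_H[OF cf']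
  obtain U q q' where pb: "pullback X B B' U p p' q q'" using CF_pullback[OF cf h'(2)] by blast
  obtain g where g: "g \<in> H B' B" "p * g = p'" using lift[OF cf _ h'(2)] AB by blast
  obtain g' where g': "g' \<in> H B B'" "p' * g' = p" using lift[OF cf' _ h(2)] AB by blast
  have "K U = K A + K B'" using pullback_split[OF cf pb g] K_biprod by blast
  moreover have "K U = K A' + K B" using pullback_split[OF cf' pullback_sym[OF pb] g'] K_biprod by blast
  ultimately show ?thesis by (simp add: add.commute)
qed

lemma cores_unique:
  assumes "cores X B C" "cores X B' C'" shows "K B + K C' = K B' + K C"
proof -
  obtain i p where cf: "CF X i B p C" using assms(1) unfolding cores_def by blast
  obtain i' p' where cf': "CF X i' B' p' C'" using assms(2) unfolding cores_def by blast
  note AB = assms[unfolded cores_def]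
  note h = CF_H[OF cf] and h' = CF_H[OF cf']
  obtain U q q' where po: "pushout X B B' U i i' q q'" using CF_pushout[OF cf h'(1)] by blast
  obtain g where g: "g \<in> H B B'" "g * i = i'" using extend[OF cf _ h'(1)] AB by blast
  obtain g' where g': "g' \<in> H B' B" "g' * i' = i" using extend[OF cf' _ h(1)] AB by blast
  have "K U = K B' + K C" using pushout_split[OF cf po g] K_biprod by blast
  moreover have "K U = K B + K C'" using pushout_split[OF cf' pushout_sym[OF po] g'] K_biprod by blast
  ultimately show ?thesis by simp
qed

lemma res_biprod:
  assumes "res X A B" "res X' A' B'" "biprod X X' U i p j q"
  obtains A'' B'' where "res U A'' B''" "K A'' = K A + K A'" "K B'' = K B + K B'"
proof -
  obtain f g where cf: "CF A f B g X" using assms(1) unfolding res_def by blast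
  obtain f' g' where cf': "CF A' f' B' g' X'" using assms(2) unfolding res_def by blast
  obtain A'' ai ap aj aq where A: "biprod A A' A'' ai ap aj aq"
    using biprod_exists CF_H(4)[OF cf] CF_H(4)[OF cf'] by blast
  obtain B'' bi bp bj bq where B: "biprod B B' B'' bi bp bj bq"
    using biprod_exists CF_H(5)[OF cf] CF_H(5)[OF cf'] by blast
  have "res U A'' B''"
    using CF_biprod[OF cf cf' A B assms(3)] assms(1,2) summand_closed_iff[OF P_closed A]
      summand_closed_iff[OF P_closed B] unfolding res_def by blast
  then show ?thesis using that K_biprod[OF A] K_biprod[OF B] by blast
qed

lemma cores_biprod:
  assumes "cores X B C" "cores X' B' C'" "biprod X X' U i p j q"
  obtains B'' C'' where "cores U B'' C''" "K B'' = K B + K B'" "K C'' = K C + K C'"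
proof -
  obtain f g where cf: "CF X f B g C" using assms(1) unfolding cores_def by blast
  obtain f' g' where cf': "CF X' f' B' g' C'" using assms(2) unfolding cores_def by blast
  obtain C'' ai ap aj aq where C: "biprod C C' C'' ai ap aj aq"
    using biprod_exists CF_H(6)[OF cf] CF_H(6)[OF cf'] by blast
  obtain B'' bi bp bj bq where B: "biprod B B' B'' bi bp bj bq"
    using biprod_exists CF_H(5)[OF cf] CF_H(5)[OF cf'] by blast
  have "cores U B'' C''"
    using CF_biprod[OF cf cf' assms(3) B C] assms(1,2) summand_closed_iff[OF T_closed C]
      summand_closed_iff[OF T_closed B] unfolding cores_def by blast
  then show ?thesis using that K_biprod[OF B] K_biprod[OF C] by blast
qed

text \<open>For finite-dimensional algebras this is the g-vector. \<open>SOME\<close> is harmless by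
  \<open>res_unique\<close>.\<close>

definition index :: "'o \<Rightarrow> 'o set \<Rightarrow> int" where
  "index X c = (SOME m. \<exists>A B. res X A B \<and> m = int (count (K B) c) - int (count (K A) c))"

definition coindex :: "'o \<Rightarrow> 'o set \<Rightarrow> int" where
  "coindex X c = (SOME m. \<exists>B C. cores X B C \<and> m = int (count (K B) c) - int (count (K C) c))"

lemma index_eq:
  assumes "res X A B" shows "index X c = int (count (K B) c) - int (count (K A) c)"
  unfolding index_def
proof (rule some_equality)
  fix m assume "\<exists>A B. res X A B \<and> m = int (count (K B) c) - int (count (K A) c)"
  then obtain A' B' where m: "res X A' B'" "m = int (count (K B') c) - int (count (K A') c)" by blast
  have "count (K B + K A') c = count (K B' + K A) c" using res_unique[OF assms m(1)] by simp
  then show "m = int (count (K B) c) - int (count (K A) c)" using m(2) by simp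
qed (use assms in blast)

lemma coindex_eq:
  assumes "cores X B C" shows "coindex X c = int (count (K B) c) - int (count (K C) c)"
  unfolding coindex_def
proof (rule some_equality)
  fix m assume "\<exists>B C. cores X B C \<and> m = int (count (K B) c) - int (count (K C) c)"
  then obtain B' C' where m: "cores X B' C'" "m = int (count (K B') c) - int (count (K C') c)" by blast
  have "count (K B + K C') c = count (K B' + K C) c" using cores_unique[OF assms m(1)] by simp
  then show "m = int (count (K B) c) - int (count (K C) c)" using m(2) by simp
qed (use assms in blast)

lemma index_biprod:
  assumes b: "biprod X Y U i p j q" and U: "U \<in> T" shows "index U c = index X c + index Y c"
proof -
  have XY: "X \<in> T" "Y \<in> T" using summand_closed_iff[OF T_closed b] U by auto
  obtain A B where 1: "res X A B" using resolution_exists[OF XY(1)] unfolding res_def by blast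
  obtain A' B' where 2: "res Y A' B'" using resolution_exists[OF XY(2)] unfolding res_def by blast
  obtain A'' B'' where "res U A'' B''" "K A'' = K A + K A'" "K B'' = K B + K B'"
    using res_biprod[OF 1 2 b] .
  then show ?thesis by (simp add: index_eq[OF 1] index_eq[OF 2] index_eq)
qed

lemma coindex_biprod:
  assumes b: "biprod X Y U i p j q" and U: "U \<in> P" shows "coindex U c = coindex X c + coindex Y c"
proof -
  have XY: "X \<in> P" "Y \<in> P" using summand_closed_iff[OF P_closed b] U by auto
  obtain B C where 1: "cores X B C" using coresolution_exists[OF XY(1)] unfolding cores_def by blast
  obtain B' C' where 2: "cores Y B' C'" using coresolution_exists[OF XY(2)] unfolding cores_def by blast
  obtain B'' C'' where "cores U B'' C''" "K B'' = K B + K B'" "K C'' = K C + K C'"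
    using cores_biprod[OF 1 2 b] .
  then show ?thesis by (simp add: coindex_eq[OF 1] coindex_eq[OF 2] coindex_eq)
qed

text \<open>Push the coresolution \<open>B -> U -> V\<close> out along \<open>B -> X\<close>. By
  \<open>extend\<close> the pushout \<open>E\<close> is \<open>X + V\<close>, and
  \<open>U -> E\<close> has kernel \<open>A\<close>, so \<open>A -> U -> E\<close> is a
  coresolution. Hence \<open>([U] - [V]) - ([U] - [E]) = [E] - [V] = [X]\<close>.\<close>

lemma coindex_res:
  assumes X: "X \<in> T" and r: "res X A B" shows "coindex B c - coindex A c = int (count (K X) c)"
proof -
  obtain i p where cf: "CF A i B p X" using r unfolding res_def by blast
  have B: "B \<in> P" using r unfolding res_def by blast
  obtain j U q V where cf': "CF B j U q V" "U \<in> T" "V \<in> T" using coresolution_exists[OF B] by blast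
  obtain E j' f where po: "pushout B U X E j p j' f" using CF_pushout[OF cf'(1) CF_H(2)[OF cf]] by blast
  have "\<exists>g \<in> H U X. g * j = p" using extend[OF cf'(1,3) CF_H(2)[OF cf] X] .
  then obtain r s p' where b: "biprod X V E j' r s p'" using pushout_split[OF cf'(1) po] by blast
  have "E \<in> T" using summand_closed_iff[OF T_closed b] X cf' by simp
  then have "cores A U E" using pushout_CF_deflation[OF cf'(1) po cf] cf'(2) unfolding cores_def by blast
  moreover have "cores B U V" using cf' unfolding cores_def by blast
  ultimately show ?thesis using K_biprod[OF b] by (simp add: coindex_eq)
qed

text \<open>Dually, pull \<open>B -> C\<close> back along the resolution \<open>U -> V -> C\<close>.
  As \<open>V -> C\<close> lifts to \<open>B\<close>, the pullback \<open>E\<close> is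
  \<open>X + V\<close>, and \<open>U -> E -> B\<close> is a resolution.\<close>

lemma index_cores:
  assumes X: "X \<in> P" and r: "cores X B C" shows "index B c - index C c = int (count (K X) c)"
proof -
  obtain i p where cf: "CF X i B p C" using r unfolding cores_def by blast
  have B: "B \<in> T" "C \<in> T" using r unfolding cores_def by blast+
  obtain U j V q where cf': "CF U j V q C" "U \<in> P" "V \<in> P" using resolution_exists[OF B(2)] by blast
  obtain E q' f where pb: "pullback C B V E p q q' f" using CF_pullback[OF cf CF_H(2)[OF cf'(1)]] by blast
  have "\<exists>g \<in> H V B. p * g = q" using lift[OF cf _ CF_H(2)[OF cf'(1)] cf'(3)] B by blast
  then obtain i' r s where b: "biprod X V E i' r s q'" using pullback_split[OF cf pb] by blast
  have "E \<in> P" using summand_closed_iff[OF P_closed b] X cf' by simp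
  moreover obtain j' where "CF U j' E f B" using pullback_CF[OF cf'(1) pullback_sym[OF pb]] .
  ultimately have "res B U E" using cf'(2) unfolding res_def by blast
  moreover have "res C U V" using cf' unfolding res_def by blast
  ultimately show ?thesis using K_biprod[OF b] by (simp add: index_eq)
qed

theorem ordIso_indecomposables: "|cls ` {X \<in> P. loc X}| =o |cls ` {X \<in> T. loc X}|"
proof -
  let ?P = "cls ` {X \<in> P. loc X}" and ?T = "cls ` {X \<in> T. loc X}"
  \<comment> \<open>\<open>M c d\<close> is the matrix entry at the classes \<open>c\<close> from
    \<open>P\<close> and \<open>d\<close> from \<open>T\<close>; additivity makes these entries
    determine the index of every object of \<open>T\<close>.\<close>
  have "\<exists>f. (\<forall>X \<in> T. index X c = (\<Sum>d\<in>#K X. f d)) \<and> (\<forall>X \<in> T. loc X \<longrightarrow> f (cls X) = index X c)" for c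
    using additive_eq_sum_K[OF T_closed, of "\<lambda>X. index X c"] index_biprod by metis
  then obtain M where M: "\<And>X c. X \<in> T \<Longrightarrow> index X c = (\<Sum>d\<in>#K X. M c d)"
      "\<And>X c. X \<in> T \<Longrightarrow> loc X \<Longrightarrow> M c (cls X) = index X c"
    by metis
  have "\<exists>f. (\<forall>X \<in> P. coindex X c = (\<Sum>d\<in>#K X. f d)) \<and> (\<forall>X \<in> P. loc X \<longrightarrow> f (cls X) = coindex X c)" for c
    using additive_eq_sum_K[OF P_closed, of "\<lambda>X. coindex X c"] coindex_biprod by metis
  then obtain N where N: "\<And>X c. X \<in> P \<Longrightarrow> coindex X c = (\<Sum>d\<in>#K X. N c d)"
      "\<And>X c. X \<in> P \<Longrightarrow> loc X \<Longrightarrow> N c (cls X) = coindex X c"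
    by metis
  have T: "finite {a \<in> ?P. M a t \<noteq> 0} \<and> (\<Sum>a | a \<in> ?P \<and> M a t \<noteq> 0. M a t * N t a) = 1" if t: "t \<in> ?T" for t
  proof -
    obtain X where X: "X \<in> T" "loc X" "t = cls X" using t by blast
    obtain A B where r: "res X A B" using resolution_exists[OF X(1)] unfolding res_def by blast
    then have AB: "A \<in> P" "B \<in> P" unfolding res_def by auto
    have "M a t = int (count (K B) a) - int (count (K A) a)" for a using M(2) X index_eq[OF r] by simp
    note s = sum_mset_diff[OF set_K_subset[OF P_closed AB(2)] set_K_subset[OF P_closed AB(1)], of "\<lambda>a. M a t", OF this]
    \<comment> \<open>Read at the class \<open>t\<close> of the indecomposable \<open>X\<close>
      itself, \<open>coindex_res\<close> gives the diagonal entry 1 of the product.\<close>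
    have "(\<Sum>d\<in>#K B. N t d) - (\<Sum>d\<in>#K A. N t d) = int (count (K X) t)"
      using coindex_res[OF X(1) r, of t] N(1) AB by simp
    then show ?thesis using s(1) s(2)[of "N t"] K_loc[OF X(2)] X(3) by simp
  qed
  have P: "finite {t \<in> ?T. N t a \<noteq> 0} \<and> (\<Sum>t | t \<in> ?T \<and> N t a \<noteq> 0. N t a * M a t) = 1" if a: "a \<in> ?P" for a
  proof -
    obtain X where X: "X \<in> P" "loc X" "a = cls X" using a by blast
    obtain B C where r: "cores X B C" using coresolution_exists[OF X(1)] unfolding cores_def by blast
    then have BC: "B \<in> T" "C \<in> T" unfolding cores_def by auto
    have "N t a = int (count (K B) t) - int (count (K C) t)" for t using N(2) X coindex_eq[OF r] by simp
    note s = sum_mset_diff[OF set_K_subset[OF T_closed BC(1)] set_K_subset[OF T_closed BC(2)], of "\<lambda>t. N t a", OF this]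
    have "(\<Sum>d\<in>#K B. M a d) - (\<Sum>d\<in>#K C. M a d) = int (count (K X) a)"
      using index_cores[OF X(1) r, of a] M(1) BC by simp
    then show ?thesis using s(1) s(2)[of "M a"] K_loc[OF X(2)] X(3) by simp
  qed
  show ?thesis
    by (rule ordIso_of_inverse_matrices[of ?P ?T "\<lambda>a t. N t a" "\<lambda>t a. M a t"]) (use T P in blast)+
qed

end

section \<open>Support \<open>\<tau>\<close>-tilting subcategories\<close>

context ring_exact_category
begin

definition projective :: "'o \<Rightarrow> bool" where
  "projective Q \<longleftrightarrow> Q \<in> Ob \<and>
     (\<forall>B C p. deflation B C p \<longrightarrow> (\<forall>f \<in> H Q C. \<exists>g \<in> H Q B. p * g = f))"

definition fac :: "'o set \<Rightarrow> 'o set" where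
  "fac S = {X. \<exists>Y \<in> S. \<exists>p. deflation Y X p}"

lemma projective_lift:
  assumes "projective Q" "deflation B C p" "f \<in> H Q C"
  obtains g where "g \<in> H Q B" "p * g = f"
  using assms unfolding projective_def by blast

lemma projective_summand:
  assumes b: "biprod A B U i p j q" and U: "projective U" shows "projective A"
  unfolding projective_def
proof (intro conjI allI impI ballI)
  show "A \<in> Ob" using biprod_Ob[OF b] by blast
  fix X Y r f assume r: "deflation X Y r" and f: "f \<in> H A Y"
  note h = biprod_H[OF b]
  obtain g where g: "g \<in> H U X" "r * g = f * p" using projective_lift[OF U r H_comp[OF h(2) f]] .
  have "r * (g * i) = f" using g(2) by (simp add: mult.assoc[symmetric]) (simp add: mult.assoc biprod_simps[OF b] id_right[OF f])
  then show "\<exists>g \<in> H A X. r * g = f" using H_comp[OF h(1) g(1)] by blast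
qed

lemma deflation_id: "X \<in> Ob \<Longrightarrow> deflation X X (e X)"
  using CF_id_right unfolding deflation_def by blast

end

text \<open>Both images are the quotient of \<open>S\<close> by the same equivalence
  relation.\<close>

lemma card_of_image_eqI:
  assumes "\<And>x y. x \<in> S \<Longrightarrow> y \<in> S \<Longrightarrow> f x = f y \<longleftrightarrow> g x = g y"
  shows "|f ` S| =o |g ` S|"
proof (rule card_of_ordIsoI)
  have *: "inv_into S f (f x) \<in> S \<and> f (inv_into S f (f x)) = f x" if "x \<in> S" for x
    using that by (simp add: f_inv_into_f inv_into_into)
  then have "g (inv_into S f (f x)) = g x" if "x \<in> S" for x using that assms by blast
  then show "bij_betw (\<lambda>c. g (inv_into S f c)) (f ` S) (g ` S)"
    unfolding bij_betw_def inj_on_def using assms by (auto simp: image_image)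
qed

text \<open>A left approximation appears as its factorization \<open>j * d\<close> over the image
  \<open>J\<close>. A map from \<open>Q\<close> to \<open>T\<close> that factors through
  \<open>j * d\<close> factors through \<open>d\<close>, and conversely, since maps from
  \<open>J\<close> to \<open>T\<close> extend along \<open>j\<close> by vanishing of Ext.\<close>

locale tau_tilting = ring_exact_category Ob H e CF
  for Ob :: "'o set" and H :: "'o \<Rightarrow> 'o \<Rightarrow> 'a::ring set" and e :: "'o \<Rightarrow> 'a"
    and CF :: "'o \<Rightarrow> 'a \<Rightarrow> 'o \<Rightarrow> 'a \<Rightarrow> 'o \<Rightarrow> bool" +
  fixes T :: "'o set"
  assumes T_closed: "summand_closed T"
    and enough_projectives: "X \<in> Ob \<Longrightarrow> \<exists>Q p. projective Q \<and> deflation Q X p"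
    and Ext_vanishes: "CF Y i B p X \<Longrightarrow> X \<in> T \<Longrightarrow> Y \<in> fac T \<Longrightarrow> \<exists>r \<in> H B Y. r * i = e Y"
    and approximation_exists: "projective Q \<Longrightarrow> \<exists>J d j U g V. deflation Q J d \<and> CF J j U g V \<and>
      U \<in> T \<and> V \<in> T \<and> (\<forall>X \<in> T. \<forall>h \<in> H Q X. \<exists>w \<in> H J X. h = w * d)"
begin

text \<open>\<open>appr Q d J\<close>: the object \<open>J\<close> is the image of a left \<open>T\<close>-approximation of the
  projective object \<open>Q\<close>.\<close>

definition appr :: "'o \<Rightarrow> 'a \<Rightarrow> 'o \<Rightarrow> bool" where
  "appr Q d J \<longleftrightarrow> projective Q \<and> deflation Q J d \<and> (\<exists>j U g V. CF J j U g V \<and> U \<in> T \<and> V \<in> T) \<and>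
     (\<forall>X \<in> T. \<forall>h \<in> H Q X. \<exists>w \<in> H J X. h = w * d)"

text \<open>For finite-dimensional algebras, the next predicate says that \<open>Y\<close> is a module over the
  quotient by the annihilator of \<open>T\<close>. Among such objects, the images \<open>J\<close> are projective.\<close>

definition faithful :: "'o \<Rightarrow> bool" where
  "faithful Y \<longleftrightarrow> Y \<in> Ob \<and> (\<forall>Q d J. appr Q d J \<longrightarrow> (\<forall>x \<in> H Q Y. \<exists>w \<in> H J Y. x = w * d))"

lemma appr_exists: "projective Q \<Longrightarrow> \<exists>d J. appr Q d J"
  using approximation_exists unfolding appr_def by metis

lemma appr_H:
  assumes "appr Q d J" shows "d \<in> H Q J" "Q \<in> Ob" "J \<in> Ob"
  using assms deflation_H H_Ob unfolding appr_def by blast+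

lemma appr_epi: "appr Q d J \<Longrightarrow> f \<in> H J X \<Longrightarrow> g \<in> H J X \<Longrightarrow> f * d = g * d \<Longrightarrow> f = g"
  unfolding appr_def deflation_def using CF_epi by blast

lemma appr_id_zero: "appr Q d J \<Longrightarrow> d = 0 \<Longrightarrow> e J = 0"
  using appr_epi[OF _ H_id H_zero, of Q d J] appr_H by simp

lemma T_Ob: "X \<in> T \<Longrightarrow> X \<in> Ob"
  by (rule summand_closed_Ob[OF T_closed])

lemma T_subset_fac: "X \<in> T \<Longrightarrow> X \<in> fac T"
  unfolding fac_def using deflation_id[OF T_Ob] by blast

lemma faithful_factor:
  assumes "faithful Y" "appr Q d J" "x \<in> H Q Y"
  obtains w where "w \<in> H J Y" "x = w * d"
  using assms unfolding faithful_def by blast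

lemma faithful_T: "X \<in> T \<Longrightarrow> faithful X"
  using T_Ob unfolding faithful_def appr_def by blast

text \<open>The factorization \<open>w\<close> found in \<open>B\<close> becomes 0 in
  \<open>C\<close>, because \<open>d\<close> is epi, and so lands in \<open>A\<close>.\<close>

lemma faithful_kernel:
  assumes cf: "CF A i B p C" and B: "faithful B" shows "faithful A"
  unfolding faithful_def
proof (intro conjI allI impI ballI)
  note h = CF_H[OF cf]
  show "A \<in> Ob" by (rule h)
  fix Q d J x assume a: "appr Q d J" and x: "x \<in> H Q A"
  obtain w where w: "w \<in> H J B" "i * x = w * d" using faithful_factor[OF B a H_comp[OF x h(1)]] .
  have "p * w * d = p * i * x" by (simp add: mult.assoc w)
  then have "p * w * d = 0 * d" using h(3) by simp
  then have "p * w = 0"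
    by (rule appr_epi[OF a H_comp[OF w(1) h(2)] H_zero[OF appr_H(3)[OF a] h(6)]])
  then obtain v where v: "v \<in> H J A" "i * v = w" using CF_ker_ex[OF cf w(1)] by blast
  have "i * x = i * (v * d)" using v w by (simp add: mult.assoc[symmetric])
  then have "x = v * d" by (rule CF_mono[OF cf x H_comp[OF appr_H(1)[OF a] v(1)]])
  then show "\<exists>w \<in> H J A. x = w * d" using v by blast
qed

lemma faithful_appr:
  assumes "appr Q d J" shows "faithful J"
proof -
  obtain j U g V where "CF J j U g V" "U \<in> T" using assms unfolding appr_def by blast
  then show ?thesis using faithful_kernel faithful_T by blast
qed

text \<open>Lift \<open>f * d\<close> by projectivity of \<open>Q\<close>, let the lift descend to
  \<open>J\<close> because \<open>B\<close> is faithful, and cancel the epimorphism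
  \<open>d\<close>.\<close>

lemma appr_lift:
  assumes a: "appr Q d J" and p: "deflation B C p" and B: "faithful B" and f: "f \<in> H J C"
  obtains g where "g \<in> H J B" "p * g = f"
proof -
  have Q: "projective Q" using a unfolding appr_def by blast
  obtain x where x: "x \<in> H Q B" "p * x = f * d"
    using projective_lift[OF Q p H_comp[OF appr_H(1)[OF a] f]] .
  obtain w where w: "w \<in> H J B" "x = w * d" using faithful_factor[OF B a x(1)] .
  have "p * w * d = f * d" using x w by (simp add: mult.assoc)
  then have "p * w = f" by (rule appr_epi[OF a H_comp[OF w(1) deflation_H[OF p]] f])
  then show ?thesis using that w by blast
qed

text \<open>\<open>J\<close> is functorial in \<open>Q\<close>, because \<open>J'\<close> is itself
  faithful. As \<open>d\<close> is epi, induced maps are unique and identities between them can be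
  checked on the projective objects.\<close>

lemma appr_map:
  assumes a: "appr Q d J" and b: "appr Q' d' J'" and f: "f \<in> H Q Q'"
  obtains f' where "f' \<in> H J J'" "f' * d = d' * f"
  using faithful_factor[OF faithful_appr[OF b] a H_comp[OF f appr_H(1)[OF b]]] by metis

lemma appr_map_lift:
  assumes a: "appr Q d J" and b: "appr Q' d' J'" and f: "f \<in> H J J'"
  obtains f' where "f' \<in> H Q Q'" "d' * f' = f * d"
  using projective_lift[OF _ _ H_comp[OF appr_H(1)[OF a] f]] a b unfolding appr_def by metis

lemma appr_map_iso:
  assumes a: "appr Q d J" and b: "appr Q' d' J'" and f: "iso Q Q' f"
    and f': "f' \<in> H J J'" "f' * d = d' * f"
  shows "iso J J' f'"
proof -
  obtain g where g: "f \<in> H Q Q'" "g \<in> H Q' Q" "g * f = e Q" "f * g = e Q'" using f by (rule isoE)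
  obtain g' where g': "g' \<in> H J' J" "g' * d' = d * g" using appr_map[OF b a g(2)] .
  note A = appr_H[OF a] and B = appr_H[OF b]
  have "g' * f' * d = e J * d"
    by (simp add: mult.assoc f' mult_eq_assoc[OF g'(2)] g A(1)[THEN id_left] A(1)[THEN id_right])
  then have 1: "g' * f' = e J" by (rule appr_epi[OF a H_comp[OF f'(1) g'(1)] H_id[OF A(3)]])
  have "f' * g' * d' = e J' * d'"
    by (simp add: mult.assoc g' mult_eq_assoc[OF f'(2)] g B(1)[THEN id_left] B(1)[THEN id_right])
  then have 2: "f' * g' = e J'" by (rule appr_epi[OF b H_comp[OF g'(1) f'(1)] H_id[OF B(3)]])
  show ?thesis using isoI[OF f'(1) g'(1) 1 2] .
qed

lemma appr_isom:
  assumes a: "appr Q d J" and b: "appr Q' d' J'" and "isom Q Q'" shows "isom J J'"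
proof -
  obtain f where f: "iso Q Q' f" using assms(3) unfolding isom_def by blast
  obtain f' where "f' \<in> H J J'" "f' * d = d' * f" using appr_map[OF a b iso_H[OF f]] .
  from appr_map_iso[OF a b f this] show ?thesis unfolding isom_def by blast
qed

lemma appr_biprod:
  assumes b: "biprod Q Q' R i p j q" and a: "appr Q d J" "appr Q' d' J'" "appr R c M"
  shows "\<exists>i p j q. biprod J J' M i p j q"
proof -
  note h = biprod_H[OF b] and bs = biprod_simps[OF b]
  note A = appr_H[OF a(1)] and A' = appr_H[OF a(2)] and C = appr_H[OF a(3)]
  obtain i' where i: "i' \<in> H J M" "i' * d = c * i" using appr_map[OF a(1,3) h(1)] .
  obtain p' where p: "p' \<in> H M J" "p' * c = d * p" using appr_map[OF a(3,1) h(2)] .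
  obtain j' where j: "j' \<in> H J' M" "j' * d' = c * j" using appr_map[OF a(2,3) h(3)] .
  obtain q' where q: "q' \<in> H M J'" "q' * c = d' * q" using appr_map[OF a(3,2) h(4)] .
  note s = i(2) p(2) j(2) q(2) i(2)[THEN mult_eq_assoc] p(2)[THEN mult_eq_assoc]
    j(2)[THEN mult_eq_assoc] q(2)[THEN mult_eq_assoc] A(1)[THEN id_left] A(1)[THEN id_right]
    A'(1)[THEN id_left] A'(1)[THEN id_right] C(1)[THEN id_left] C(1)[THEN id_right]
  have "biprod J J' M i' p' j' q'"
  proof (rule biprodI)
    have "p' * i' * d = e J * d" by (simp add: mult.assoc s bs)
    then show "p' * i' = e J" by (rule appr_epi[OF a(1) H_comp[OF i(1) p(1)] H_id[OF A(3)]])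
    have "q' * j' * d' = e J' * d'" by (simp add: mult.assoc s bs)
    then show "q' * j' = e J'" by (rule appr_epi[OF a(2) H_comp[OF j(1) q(1)] H_id[OF A'(3)]])
    have "p' * j' * d' = 0 * d'" by (simp add: mult.assoc s bs)
    then show "p' * j' = 0" by (rule appr_epi[OF a(2) H_comp[OF j(1) p(1)] H_zero[OF A'(3) A(3)]])
    have "q' * i' * d = 0 * d" by (simp add: mult.assoc s bs)
    then show "q' * i' = 0" by (rule appr_epi[OF a(1) H_comp[OF i(1) q(1)] H_zero[OF A(3) A'(3)]])
    have "(i' * p' + j' * q') * c = e M * c" by (simp add: distrib_right mult.assoc s bs algebra_simps)
    then show "i' * p' + j' * q' = e M"
      by (rule appr_epi[OF a(3) H_add[OF H_comp[OF p(1) i(1)] H_comp[OF q(1) j(1)]] H_id[OF C(3)]])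
  qed (use i p j q in auto)
  then show ?thesis by blast
qed

text \<open>If \<open>g\<close> on \<open>Q\<close> lifts \<open>f\<close>, then
  \<open>e Q - g\<close> lifts \<open>e J - f\<close>. One of the lifts is invertible since
  \<open>Q\<close> is local, and invertibility descends to \<open>J\<close>.\<close>

lemma appr_loc:
  assumes Q: "loc Q" and a: "appr Q d J" and J: "e J \<noteq> 0" shows "loc J"
proof (rule locI[OF appr_H(3)[OF a] J])
  note A = appr_H[OF a]
  fix f assume f: "f \<in> H J J"
  obtain g where g: "g \<in> H Q Q" "d * g = f * d" using appr_map_lift[OF a a f] .
  have eg: "e Q - g \<in> H Q Q" by (rule H_diff[OF H_id[OF A(2)] g(1)])
  have 1: "iso J J f" if "iso Q Q g" using appr_map_iso[OF a a that f] g(2) by simp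
  have 2: "iso J J (e J - f)" if "iso Q Q (e Q - g)"
    by (rule appr_map_iso[OF a a that H_diff[OF H_id[OF A(3)] f]])
      (simp add: algebra_simps g(2) A(1)[THEN id_left] A(1)[THEN id_right])
  show "iso J J f \<or> iso J J (e J - f)" using loc_iso_or[OF Q g(1) eg] 1 2 by auto
qed

text \<open>\<open>d\<close> behaves like a projective cover. Lifts of an isomorphism and of its
  inverse satisfy \<open>d * (e Q - g' * f') = 0\<close>; as \<open>d\<close> is nonzero,
  \<open>e Q - g' * f'\<close> is not invertible, so \<open>g' * f'\<close> is.\<close>

lemma appr_loc_isom:
  assumes Q: "loc Q" "loc Q'" and a: "appr Q d J" and b: "appr Q' d' J'" and J: "e J \<noteq> 0" "isom J J'"
  shows "isom Q Q'"
proof -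
  note A = appr_H[OF a]
  obtain f g where fg: "f \<in> H J J'" "g \<in> H J' J" "g * f = e J" using J(2) unfolding isom_def iso_def by blast
  obtain f' where f': "f' \<in> H Q Q'" "d' * f' = f * d" using appr_map_lift[OF a b fg(1)] .
  obtain g' where g': "g' \<in> H Q' Q" "d * g' = g * d'" using appr_map_lift[OF b a fg(2)] .
  have gf: "g' * f' \<in> H Q Q" using f' g' H_comp by blast
  have z: "d * (e Q - g' * f') = 0"
    by (simp add: algebra_simps mult_eq_assoc[OF g'(2)] f' mult_eq_assoc[OF fg(3)]
      A(1)[THEN id_left] A(1)[THEN id_right])
  have "\<not> iso Q Q (e Q - g' * f')"
  proof
    assume "iso Q Q (e Q - g' * f')"
    then obtain u where u: "(e Q - g' * f') * u = e Q" by (metis isoE)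
    have "d = d * (e Q - g' * f') * u" by (simp add: mult.assoc u A(1)[THEN id_right])
    then show False using z J(1) appr_id_zero[OF a] by simp
  qed
  then have "iso Q Q (g' * f')" using loc_iso_or[OF Q(1) gf H_diff[OF H_id[OF A(2)] gf]] by simp
  from loc_iso[OF Q f'(1) g'(1) this] show ?thesis unfolding isom_def by blast
qed

text \<open>The approximation \<open>j * d\<close> is itself a map from \<open>Q\<close> to
  \<open>T\<close>. With \<open>j\<close> mono and \<open>d\<close> epi, it vanishes only if
  \<open>J\<close> does.\<close>

lemma Hom_T_nonzero_iff:
  assumes a: "appr Q d J" shows "(\<exists>X \<in> T. H Q X \<noteq> {0}) \<longleftrightarrow> e J \<noteq> 0"
proof
  note A = appr_H[OF a]
  assume "\<exists>X \<in> T. H Q X \<noteq> {0}"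
  then obtain X where X: "X \<in> T" "H Q X \<noteq> {0}" by blast
  then obtain h where h: "h \<in> H Q X" "h \<noteq> 0" using H_zero[OF A(2) T_Ob[OF X(1)]] by blast
  obtain w where "h = w * d" using faithful_factor[OF faithful_T[OF X(1)] a h(1)] .
  then show "e J \<noteq> 0" using h id_left[OF A(1)] by auto
next
  note A = appr_H[OF a]
  assume J: "e J \<noteq> 0"
  obtain j U g V where U: "CF J j U g V" "U \<in> T" using a unfolding appr_def by blast
  have "j * d \<noteq> 0" using CF_mono0[OF U(1) A(1)] J appr_id_zero[OF a] by blast
  then show "\<exists>X \<in> T. H Q X \<noteq> {0}" using U(2) H_comp[OF A(1) CF_H(1)[OF U(1)]] by blast
qed

section \<open>The additive closure of the images\<close>

definition good :: "'o \<Rightarrow> bool" where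
  "good X \<longleftrightarrow> loc X \<and> (\<exists>Q d. loc Q \<and> appr Q d X)"

text \<open>Additive closure of the good objects. Phrased through the classes in \<open>K X\<close>,
  closure under sums and summands is immediate from \<open>K_biprod\<close>.\<close>

definition P :: "'o set" where
  "P = {X \<in> Ob. set_mset (K X) \<subseteq> cls ` {Y. good Y}}"

lemma appr_comp_iso:
  assumes a: "appr Q d J" and f: "iso J J' f" shows "appr Q (f * d) J'"
proof -
  obtain g where g: "f \<in> H J J'" "g \<in> H J' J" "g * f = e J" "f * g = e J'" "iso J' J g" using f by (rule isoE)
  note A = appr_H[OF a]
  obtain L l where l: "CF L l Q d J" using a unfolding appr_def deflation_def by blast
  have "CF L l Q (f * d) J'"
    using CF_iso[OF l iso_id iso_id f, where i' = l and p' = "f * d"] CF_H[OF l] g H_comp[OF A(1) g(1)]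
    by (simp add: mult.assoc id_left id_right)
  moreover obtain j U h V where j: "CF J j U h V" "U \<in> T" "V \<in> T" using a unfolding appr_def by blast
  note hj = CF_H[OF j(1)]
  have "CF J' (j * g) U h V"
    using CF_iso[OF j(1) f iso_id iso_id, where i' = "j * g" and p' = h] hj g H_comp[OF g(2) hj(1)]
    by (simp add: mult.assoc id_left id_right)
  moreover have "\<exists>w \<in> H J' X. h = w * (f * d)" if X: "X \<in> T" "h \<in> H Q X" for X h
  proof -
    obtain w where w: "w \<in> H J X" "h = w * d" using faithful_factor[OF faithful_T[OF X(1)] a X(2)] .
    have "h = w * g * (f * d)" by (simp add: mult.assoc mult_eq_assoc[OF g(3)] w A(1)[THEN id_left])
    then show ?thesis using H_comp[OF g(2) w(1)] by blast
  qed
  ultimately show ?thesis using a j(2,3) unfolding appr_def deflation_def by blast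
qed

lemma good_isom:
  assumes "good X" "isom X Y" shows "good Y"
proof -
  obtain f where "iso X Y f" using assms(2) unfolding isom_def by blast
  then show ?thesis using assms appr_comp_iso loc_isom unfolding good_def by blast
qed

lemma P_loc: "{X \<in> P. loc X} = {X. good X}"
proof (intro equalityI subsetI)
  fix X assume "X \<in> {X \<in> P. loc X}"
  then have X: "loc X" "X \<in> P" by auto
  then obtain Y where Y: "good Y" "cls X = cls Y" using K_loc[OF X(1)] unfolding P_def by auto
  then have "isom Y X" using cls_eq[OF loc_Ob[OF X(1)]] isom_sym by blast
  then show "X \<in> {X. good X}" using Y good_isom by blast
next
  fix X assume "X \<in> {X. good X}"
  then have "good X" by simp
  then show "X \<in> {X \<in> P. loc X}" using K_loc loc_Ob unfolding P_def good_def by auto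
qed

lemma P_closed: "summand_closed P"
  unfolding summand_closed_def
proof (intro conjI allI impI)
  show "P \<subseteq> Ob" unfolding P_def by blast
  fix A B U i p j q assume b: "biprod A B U i p j q"
  show "U \<in> P \<longleftrightarrow> A \<in> P \<and> B \<in> P" using K_biprod[OF b] biprod_Ob[OF b] unfolding P_def by auto
qed

lemma P_induct [consumes 1, case_names zero biprod appr]:
  assumes "Y \<in> P"
    and zero: "\<And>Z. Z \<in> Ob \<Longrightarrow> e Z = 0 \<Longrightarrow> \<Phi> Z"
    and biprod: "\<And>A B U i p j q. biprod A B U i p j q \<Longrightarrow> \<Phi> A \<Longrightarrow> \<Phi> B \<Longrightarrow> \<Phi> U"
    and appr: "\<And>Q d X. appr Q d X \<Longrightarrow> \<Phi> X"
  shows "\<Phi> Y"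
proof -
  obtain Xs where Xs: "decomp Y Xs" using decomp_exists summand_closed_Ob[OF P_closed assms(1)] by blast
  then show ?thesis using assms(1)
  proof (induction rule: decomp.induct)
    case (Nil Z)
    then show ?case using zero by blast
  next
    case (Cons X A Z i p j q Xs)
    have XA: "X \<in> P" "A \<in> P" using Cons.prems summand_closed_iff[OF P_closed Cons.hyps(1)] by auto
    then have "good X" using P_loc Cons.hyps(2) by blast
    then have "\<Phi> X" using appr unfolding good_def by blast
    then show ?case using biprod[OF Cons.hyps(1)] Cons.IH XA by blast
  qed
qed

text \<open>The induction decomposes \<open>R\<close> rather than \<open>M\<close>: summands of
  projective objects are projective, \<open>appr_biprod\<close> carries the splitting over to the
  images, and by \<open>appr_loc\<close> the image of a local summand is zero or good.\<close>

lemma appr_P: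
  assumes "appr R c M" shows "M \<in> P"
proof -
  have R: "projective R" using assms unfolding appr_def by blast
  obtain Qs where "decomp R Qs" using decomp_exists appr_H(2)[OF assms] by blast
  then show ?thesis using assms R
  proof (induction arbitrary: c M rule: decomp.induct)
    case (Nil Z)
    have "c = 0" using appr_H(1)[OF Nil.prems(1), THEN id_right] Nil.hyps(2) by simp
    then have "e M = 0" by (rule appr_id_zero[OF Nil.prems(1)])
    then have "K M = {#}" using K_decomp[OF decomp.Nil] appr_H(3)[OF Nil.prems(1)] by simp
    then show ?case using appr_H(3)[OF Nil.prems(1)] unfolding P_def by simp
  next
    case (Cons Q A Z i p j q Qs)
    have pr: "projective Q" "projective A"
      using projective_summand[OF Cons.hyps(1) Cons.prems(2)]
        projective_summand[OF biprod_swap[OF Cons.hyps(1)] Cons.prems(2)] by auto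
    obtain d J where 1: "appr Q d J" using appr_exists[OF pr(1)] by blast
    obtain d' J' where 2: "appr A d' J'" using appr_exists[OF pr(2)] by blast
    obtain i' p' j' q' where b: "biprod J J' M i' p' j' q'"
      using appr_biprod[OF Cons.hyps(1) 1 2 Cons.prems(1)] by blast
    have "J \<in> P"
    proof (cases "e J = 0")
      case True
      then show ?thesis using K_decomp[OF decomp.Nil] appr_H(3)[OF 1] unfolding P_def by simp
    next
      case False
      then have "good J" using appr_loc[OF Cons.hyps(2) 1] Cons.hyps(2) 1 unfolding good_def by blast
      then show ?thesis using P_loc by blast
    qed
    then show ?case using Cons.IH[OF 2 pr(2)] summand_closed_iff[OF P_closed b] by blast
  qed
qed

lemma P_faithful: "Y \<in> P \<Longrightarrow> faithful Y"
proof (induction rule: P_induct)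
  case (zero Z)
  show ?case unfolding faithful_def
  proof (intro conjI allI impI ballI)
    fix Q d J x assume a: "appr Q d J" and x: "x \<in> H Q Z"
    have "x = 0 * d" using id_left[OF x] zero by simp
    then show "\<exists>w \<in> H J Z. x = w * d" using H_zero[OF appr_H(3)[OF a] zero(1)] by blast
  qed (rule zero)
next
  case (biprod A B U i p j q)
  note h = biprod_H[OF biprod(1)] and b = biprod_simps[OF biprod(1)]
  show ?case unfolding faithful_def
  proof (intro conjI allI impI ballI)
    show "U \<in> Ob" using biprod_Ob[OF biprod(1)] by blast
    fix Q d J x assume a: "appr Q d J" and x: "x \<in> H Q U"
    obtain v where v: "v \<in> H J A" "p * x = v * d" using faithful_factor[OF biprod(2) a H_comp[OF x h(2)]] .
    obtain w where w: "w \<in> H J B" "q * x = w * d" using faithful_factor[OF biprod(3) a H_comp[OF x h(4)]] .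
    have "x = i * (p * x) + j * (q * x)" by (simp add: b id_left[OF x])
    then have "x = (i * v + j * w) * d" by (simp add: v w distrib_right mult.assoc)
    moreover have "i * v + j * w \<in> H J U" using h v w by (blast intro: H_comp H_add)
    ultimately show "\<exists>w \<in> H J U. x = w * d" by blast
  qed
next
  case (appr Q d X)
  then show ?case by (rule faithful_appr)
qed

lemma P_lift: "Y \<in> P \<Longrightarrow> deflation B C p \<Longrightarrow> faithful B \<Longrightarrow> f \<in> H Y C \<Longrightarrow> \<exists>g \<in> H Y B. p * g = f"
proof (induction arbitrary: f rule: P_induct)
  case (zero Z)
  have "p * 0 = f" using id_right[OF zero(5)] zero(2) by simp
  moreover have "0 \<in> H Z B" using H_zero zero(1,4) unfolding faithful_def by blast
  ultimately show ?case by blast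
next
  case (biprod A A' U i q i' q')
  note h = biprod_H[OF biprod(1)] and b = biprod_simps[OF biprod(1)]
  obtain g where g: "g \<in> H A B" "p * g = f * i"
    using biprod(2)[OF biprod(4,5) H_comp[OF h(1) biprod(6)]] by blast
  obtain g' where g': "g' \<in> H A' B" "p * g' = f * i'"
    using biprod(3)[OF biprod(4,5) H_comp[OF h(3) biprod(6)]] by blast
  have "p * (g * q + g' * q') = f"
    by (simp add: distrib_left mult_eq_assoc[OF g(2)] mult_eq_assoc[OF g'(2)] mult.assoc b)
      (simp add: algebra_simps id_right[OF biprod(6)])
  moreover have "g * q + g' * q' \<in> H U B" using h g g' by (blast intro: H_comp H_add)
  ultimately show ?case by blast
next
  case (appr Q d X)
  then show ?case using appr_lift by metis
qed

lemma P_coresolution: "X \<in> P \<Longrightarrow> \<exists>i B p C. CF X i B p C \<and> B \<in> T \<and> C \<in> T"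
proof (induction rule: P_induct)
  case (zero Z)
  \<comment> \<open>A zero object is projective, and the image of its approximation is zero as well;
    the resulting conflation is transported along the isomorphism 0.\<close>
  have "projective Z"
    unfolding projective_def
  proof (intro conjI allI impI ballI zero(1))
    fix B C p f assume "deflation B C p" and f: "f \<in> H Z C"
    then have "B \<in> Ob" using deflation_H H_Ob by blast
    moreover have "p * 0 = f" using id_right[OF f] zero(2) by simp
    ultimately show "\<exists>g \<in> H Z B. p * g = f" using H_zero[OF zero(1)] by blast
  qed
  then obtain d J where a: "appr Z d J" using appr_exists by blast
  note A = appr_H[OF a]
  have "d = 0" using id_right[OF A(1)] zero(2) by simp
  then have J: "e J = 0" by (rule appr_id_zero[OF a])
  have i: "iso J Z 0" by (rule isoI[where g = 0]) (auto simp: zero J H_zero A)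
  obtain j U g V where c: "CF J j U g V" "U \<in> T" "V \<in> T" using a unfolding appr_def by blast
  note h = CF_H[OF c(1)]
  have "j = 0" using id_right[OF h(1)] J by simp
  then have "CF Z 0 U g V"
    using CF_iso[OF c(1) i iso_id iso_id, where i' = 0 and p' = g] h H_zero[OF zero(1) h(5)] by (simp add: id_left id_right)
  then show ?case using c by blast
next
  case (biprod A A' U i p j q)
  obtain f B g C where 1: "CF A f B g C" "B \<in> T" "C \<in> T" using biprod(2) by blast
  obtain f' B' g' C' where 2: "CF A' f' B' g' C'" "B' \<in> T" "C' \<in> T" using biprod(3) by blast
  obtain C'' ai ap aj aq where C: "biprod C C' C'' ai ap aj aq"
    using biprod_exists CF_H(6)[OF 1(1)] CF_H(6)[OF 2(1)] by blast
  obtain B'' bi bp bj bq where B: "biprod B B' B'' bi bp bj bq"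
    using biprod_exists CF_H(5)[OF 1(1)] CF_H(5)[OF 2(1)] by blast
  show ?case
    using CF_biprod[OF 1(1) 2(1) biprod(1) B C] 1 2 summand_closed_iff[OF T_closed C]
      summand_closed_iff[OF T_closed B] by blast
next
  case (appr Q d X)
  then show ?case unfolding appr_def by blast
qed

text \<open>The conflation pushed out along \<open>f\<close> starts in \<open>fac T\<close> and ends
  in \<open>T\<close>, hence has a retraction \<open>r\<close>, and \<open>r * f'\<close> extends
  \<open>f\<close>.\<close>

lemma extend_fac:
  assumes cf: "CF A i B p C" and C: "C \<in> T" and f: "f \<in> H A Y" and Y: "Y \<in> fac T"
  obtains g where "g \<in> H B Y" "g * i = f"
proof -
  obtain U i' f' where po: "pushout A B Y U i f i' f'" using CF_pushout[OF cf f] by blast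
  note h = pushout_eqs[OF po]
  obtain p' where p': "CF Y i' U p' C" using pushout_CF[OF cf po] .
  obtain r where r: "r \<in> H U Y" "r * i' = e Y" using Ext_vanishes[OF p' C Y] by blast
  have "r * f' * i = f" using r(2) h(5)
    by (metis h(2) id_left mult.assoc)
  then show ?thesis using that H_comp[OF h(4) r(1)] by blast
qed

text \<open>The kernel \<open>N\<close> of a deflation \<open>q\<close> from \<open>J0\<close> onto an object of \<open>T\<close> is a retract of the
  image \<open>J1\<close> attached to any projective object mapping onto \<open>N\<close>: the pushout \<open>E\<close> of a
  coresolution of \<open>J1\<close> along \<open>q1\<close> lies in \<open>fac T\<close>, hence \<open>N \<rightarrow> E\<close> extends to \<open>J0\<close> and then
  lifts to the middle term of the coresolution.\<close>

lemma T_resolution: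
  assumes X: "X \<in> T" shows "\<exists>A i B p. CF A i B p X \<and> A \<in> P \<and> B \<in> P"
proof -
  obtain P0 x where x: "projective P0" "deflation P0 X x" using enough_projectives[OF T_Ob[OF X]] by blast
  obtain d J0 where a: "appr P0 d J0" using appr_exists[OF x(1)] by blast
  obtain q where q: "q \<in> H J0 X" "x = q * d"
    using faithful_factor[OF faithful_T[OF X] a deflation_H[OF x(2)]] .
  \<comment> \<open>The composite \<open>q * d\<close> is the deflation \<open>x\<close>, so
    \<open>q\<close> is a deflation by the obscure axiom. The same reasoning applies to
    \<open>q1\<close> below.\<close>
  have "deflation J0 X q" using deflation_cancel[OF appr_H(1)[OF a] q(1)] x(2) q(2) by simp
  then obtain N k where N: "CF N k J0 q X" unfolding deflation_def by blast
  note hN = CF_H[OF N]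
  have fN: "faithful N" by (rule faithful_kernel[OF N faithful_appr[OF a]])
  obtain P1 y where y: "projective P1" "deflation P1 N y" using enough_projectives[OF hN(4)] by blast
  obtain d1 J1 where a1: "appr P1 d1 J1" using appr_exists[OF y(1)] by blast
  obtain q1 where q1: "q1 \<in> H J1 N" "y = q1 * d1" using faithful_factor[OF fN a1 deflation_H[OF y(2)]] .
  have "deflation J1 N q1" using deflation_cancel[OF appr_H(1)[OF a1] q1(1)] y(2) q1(2) by simp
  then obtain M m where M: "CF M m J1 q1 N" unfolding deflation_def by blast
  obtain j1 S0 g1 S1 where S: "CF J1 j1 S0 g1 S1" "S0 \<in> T" "S1 \<in> T" using a1 unfolding appr_def by blast
  note hS = CF_H[OF S(1)]
  obtain E u v where po: "pushout J1 S0 N E j1 q1 u v" using CF_pushout[OF S(1) q1(1)] by blast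
  note po' = pushout_eqs[OF po]
  obtain g' where g': "CF N u E g' S1" "g' * v = g1" using pushout_CF[OF S(1) po] .
  have v: "deflation S0 E v" using pushout_CF_deflation[OF S(1) po M] unfolding deflation_def by blast
  then have "E \<in> fac T" using S(2) unfolding fac_def by blast
  then obtain w where w: "w \<in> H J0 E" "w * k = u" using extend_fac[OF N X po'(3)] by blast
  \<comment> \<open>Lifting from \<open>J0\<close> along \<open>v\<close> is possible because the
    source \<open>S0\<close> lies in \<open>T\<close> and is therefore faithful.\<close>
  obtain b where b: "b \<in> H J0 S0" "v * b = w" using appr_lift[OF a v faithful_T[OF S(2)] w(1)] .
  have vbk: "v * (b * k) = u" using b w by (simp add: mult.assoc[symmetric])
  have "g1 * (b * k) = g' * (v * (b * k))" using g'(2) by (simp add: mult.assoc[symmetric])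
  then have "g1 * (b * k) = 0" using vbk CF_H(3)[OF g'(1)] by simp
  \<comment> \<open>\<open>b * k\<close> vanishes in \<open>S1\<close> and so factors through
    \<open>J1\<close>. The factor \<open>s\<close> is a section of \<open>q1\<close>, which is seen
    after composing with the monomorphism \<open>u\<close>.\<close>
  then obtain s where s: "s \<in> H N J1" "j1 * s = b * k" using CF_ker_ex[OF S(1) H_comp[OF hN(1) b(1)]] by blast
  have "u * (q1 * s) = v * (j1 * s)" using po'(5) by (simp add: mult.assoc[symmetric])
  then have "u * (q1 * s) = u * e N" using s vbk id_right[OF po'(3)] by simp
  then have "q1 * s = e N" by (rule CF_mono[OF g'(1) H_comp[OF s(1) q1(1)] H_id[OF hN(4)]])
  then obtain r where "biprod M N J1 m r s q1" using CF_split_section[OF M s(1)] by blast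
  then have "N \<in> P" using summand_closed_iff[OF P_closed] appr_P[OF a1] by blast
  then show ?thesis using N appr_P[OF a] by blast
qed

sublocale tilting_pair Ob H e CF P T
proof
  show "summand_closed P" by (rule P_closed)
  show "summand_closed T" by (rule T_closed)
  fix X assume "X \<in> T"
  then show "\<exists>A i B p. CF A i B p X \<and> A \<in> P \<and> B \<in> P" by (rule T_resolution)
next
  fix X assume "X \<in> P"
  then show "\<exists>i B p C. CF X i B p C \<and> B \<in> T \<and> C \<in> T" by (rule P_coresolution)
next
  fix A i B p C f Y assume "CF A i B p C" "C \<in> T" "f \<in> H A Y" "Y \<in> T"
  then show "\<exists>g \<in> H B Y. g * i = f" using extend_fac T_subset_fac by metis
next
  fix A i B p C f Y assume "CF A i B p C" "B \<in> P \<union> T" "f \<in> H Y C" "Y \<in> P"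
  then show "\<exists>g \<in> H Y B. p * g = f"
    using P_lift P_faithful faithful_T unfolding deflation_def by blast
qed

theorem ordIso_T_projectives:
  "|cls ` {X \<in> T. loc X}| =o |cls ` {Q. projective Q \<and> loc Q \<and> (\<exists>X \<in> T. H Q X \<noteq> {0})}|"
proof -
  let ?S = "{Q. projective Q \<and> loc Q \<and> (\<exists>X \<in> T. H Q X \<noteq> {0})}"
  obtain J where J: "\<And>Q. projective Q \<Longrightarrow> \<exists>d. appr Q d (J Q)" using appr_exists by metis
  have good: "good (J Q)" if Q: "Q \<in> ?S" for Q
  proof -
    obtain d where "appr Q d (J Q)" using J Q by blast
    then show ?thesis using Q appr_loc Hom_T_nonzero_iff unfolding good_def by blast
  qed
  have eq: "cls Q = cls Q' \<longleftrightarrow> cls (J Q) = cls (J Q')" if Q: "Q \<in> ?S" "Q' \<in> ?S" for Q Q'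
  proof -
    obtain d where d: "appr Q d (J Q)" using J Q by blast
    obtain d' where d': "appr Q' d' (J Q')" using J Q by blast
    have "e (J Q) \<noteq> 0" using good[OF Q(1)] unfolding good_def loc_def by blast
    then have "isom Q Q' \<longleftrightarrow> isom (J Q) (J Q')"
      using appr_isom[OF d d'] appr_loc_isom[OF _ _ d d'] Q by blast
    then show ?thesis using cls_eq appr_H(2,3)[OF d] by simp
  qed
  have "cls ` {X \<in> P. loc X} = (\<lambda>Q. cls (J Q)) ` ?S"
  proof (intro equalityI subsetI)
    fix c assume "c \<in> cls ` {X \<in> P. loc X}"
    then obtain X where X: "good X" "c = cls X" using P_loc by blast
    then obtain Q d where Q: "loc Q" "appr Q d X" unfolding good_def by blast
    then have pr: "projective Q" unfolding appr_def by blast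
    have "e X \<noteq> 0" using X unfolding good_def loc_def by blast
    then have "Q \<in> ?S" using pr Q Hom_T_nonzero_iff by blast
    \<comment> \<open>\<open>X\<close> and \<open>J Q\<close> are images of possibly different
      approximations of the same \<open>Q\<close>, hence isomorphic.\<close>
    moreover obtain d' where "appr Q d' (J Q)" using J[OF pr] by blast
    then have "isom X (J Q)" using appr_isom[OF Q(2)] isom_refl[OF loc_Ob[OF Q(1)]] by blast
    then have "c = cls (J Q)" using X cls_eq isom_Ob by blast
    ultimately show "c \<in> (\<lambda>Q. cls (J Q)) ` ?S" by blast
  qed (use good P_loc in blast)
  then have "|cls ` {X \<in> P. loc X}| =o |cls ` ?S|"
    using card_of_image_eqI[of ?S "\<lambda>Q. cls (J Q)" cls] eq by simp
  then show ?thesis using ordIso_indecomposables ordIso_symmetric ordIso_transitive by blast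
qed

end

section \<open>Embedding the arrows of a preadditive category into a ring\<close>

context preadditive_category
begin

definition neg where
  "neg X Y f = m_inv (Hom_group C X Y) f"

lemma Hom_Obj: "f \<in> Hom C X Y \<Longrightarrow> X \<in> Obj C \<and> Y \<in> Obj C"
  using Dom_Obj Cod_Obj by (auto simp: Hom_def)

lemma Add_Hom: "f \<in> Hom C X Y \<Longrightarrow> g \<in> Hom C X Y \<Longrightarrow> Add C f g \<in> Hom C X Y"
  using monoid.m_closed[OF comm_monoid.axioms(1)[OF comm_group.axioms(1)[OF Hom_comm_group]], of X Y f g] Hom_Obj[of f X Y]
  by (simp add: Hom_group_def)

lemma Zero_Hom: "X \<in> Obj C \<Longrightarrow> Y \<in> Obj C \<Longrightarrow> Zero C X Y \<in> Hom C X Y"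
  using monoid.one_closed[OF comm_monoid.axioms(1)[OF comm_group.axioms(1)[OF Hom_comm_group]], of X Y]
  by (simp add: Hom_group_def)

lemma neg_Hom: "f \<in> Hom C X Y \<Longrightarrow> neg X Y f \<in> Hom C X Y"
  using group.inv_closed[OF comm_group.axioms(2)[OF Hom_comm_group], of X Y f] Hom_Obj[of f X Y]
  by (simp add: Hom_group_def neg_def)

lemma Add_assoc:
  "f \<in> Hom C X Y \<Longrightarrow> g \<in> Hom C X Y \<Longrightarrow> h \<in> Hom C X Y \<Longrightarrow> Add C (Add C f g) h = Add C f (Add C g h)"
  using monoid.m_assoc[OF comm_monoid.axioms(1)[OF comm_group.axioms(1)[OF Hom_comm_group]], of X Y f g h]
    Hom_Obj[of f X Y]
  by (simp add: Hom_group_def)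

lemma Add_comm: "f \<in> Hom C X Y \<Longrightarrow> g \<in> Hom C X Y \<Longrightarrow> Add C f g = Add C g f"
  using comm_monoid.m_comm[OF comm_group.axioms(1)[OF Hom_comm_group], of X Y f g] Hom_Obj[of f X Y]
  by (simp add: Hom_group_def)

lemma Add_Zero: "f \<in> Hom C X Y \<Longrightarrow> Add C (Zero C X Y) f = f"
  using monoid.l_one[OF comm_monoid.axioms(1)[OF comm_group.axioms(1)[OF Hom_comm_group]], of X Y f]
    Hom_Obj[of f X Y]
  by (simp add: Hom_group_def)

lemma Add_neg: "f \<in> Hom C X Y \<Longrightarrow> Add C (neg X Y f) f = Zero C X Y"
  using group.l_inv[OF comm_group.axioms(2)[OF Hom_comm_group], of X Y f] Hom_Obj[of f X Y]
  by (simp add: Hom_group_def neg_def)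

lemma Zero_eqI: "f \<in> Hom C X Y \<Longrightarrow> Add C f f = f \<Longrightarrow> f = Zero C X Y"
  by (metis Add_assoc Add_Zero Add_neg neg_Hom)

lemma Comp_Zero: "X \<in> Obj C \<Longrightarrow> g \<in> Hom C Y Z \<Longrightarrow> g \<odot> Zero C X Y = Zero C X Z"
  using Comp_Add[of "Zero C X Y" X Y "Zero C X Y" g Z] Zero_Hom[of X Y] Add_Zero[of "Zero C X Y" X Y]
    Comp_Hom[of "Zero C X Y" X Y g Z] Hom_Obj[of g Y Z] Zero_eqI by metis

end

text \<open>A ring type cannot depend on a category. Its elements therefore range over all preadditive
  categories at once: a family assigns to every such category an arrow in each Hom group.\<close>

definition active :: "('o, 'm) exact_cat \<Rightarrow> 'o \<Rightarrow> 'o \<Rightarrow> bool" where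
  "active C W Y \<longleftrightarrow> preadditive_category C \<and> W \<in> Obj C \<and> Y \<in> Obj C"

lemma active_Zero_Hom: "active C W Y \<Longrightarrow> Zero C W Y \<in> Hom C W Y"
  by (simp add: active_def preadditive_category.Zero_Hom)

lemma active_Add_Zero: "active C W Y \<Longrightarrow> f \<in> Hom C W Y \<Longrightarrow> Add C (Zero C W Y) f = f"
  by (simp add: active_def preadditive_category.Add_Zero)

typedef ('o, 'm) family =
  "{F :: ('o, 'm) exact_cat \<Rightarrow> 'o \<Rightarrow> 'o \<Rightarrow> 'm.
     \<forall>C W Y. if active C W Y then F C W Y \<in> Hom C W Y else F C W Y = undefined}"
proof
  show "(\<lambda>C W Y. if active C W Y then Zero C W Y else undefined) \<in>
    {F. \<forall>C W Y. if active C W Y then F C W Y \<in> Hom C W Y else F C W Y = undefined}"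
    by (auto simp: active_Zero_Hom)
qed

setup_lifting type_definition_family

lemma Rep_family_Hom: "active C W Y \<Longrightarrow> Rep_family F C W Y \<in> Hom C W Y"
  using Rep_family[of F] by auto

lemma Rep_family_undefined: "\<not> active C W Y \<Longrightarrow> Rep_family F C W Y = undefined"
  using Rep_family[of F] by auto

lemma family_eqI:
  assumes "\<And>C W Y. active C W Y \<Longrightarrow> Rep_family F C W Y = Rep_family G C W Y" shows "F = G"
proof -
  have "Rep_family F C W Y = Rep_family G C W Y" for C W Y
    using assms[of C W Y] Rep_family_undefined[of C W Y F] Rep_family_undefined[of C W Y G]
    by (cases "active C W Y") simp_all
  then show ?thesis by (simp add: Rep_family_inject[symmetric] fun_eq_iff)
qed

instantiation family :: (type, type) ab_group_add
begin

lift_definition zero_family :: "('a, 'b) family" is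
  "\<lambda>C W Y. if active C W Y then Zero C W Y else undefined"
  by (auto simp: active_def preadditive_category.Zero_Hom)

lift_definition plus_family :: "('a, 'b) family \<Rightarrow> ('a, 'b) family \<Rightarrow> ('a, 'b) family" is
  "\<lambda>F G C W Y. if active C W Y then Add C (F C W Y) (G C W Y) else undefined"
  by (auto simp: active_def preadditive_category.Add_Hom)

lift_definition uminus_family :: "('a, 'b) family \<Rightarrow> ('a, 'b) family" is
  "\<lambda>F C W Y. if active C W Y then preadditive_category.neg C W Y (F C W Y) else undefined"
  by (auto simp: active_def preadditive_category.neg_Hom)

definition minus_family :: "('a, 'b) family \<Rightarrow> ('a, 'b) family \<Rightarrow> ('a, 'b) family" where
  "minus_family F G = F + - G"

instance
proof
  fix F G K :: "('a, 'b) family"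
  note rep = plus_family.rep_eq zero_family.rep_eq uminus_family.rep_eq
  have pre: "active C W Y \<Longrightarrow> preadditive_category C" for C :: "('a, 'b) exact_cat" and W Y
    by (simp add: active_def)
  show "F + G + K = F + (G + K)"
    by (rule family_eqI) (simp add: rep preadditive_category.Add_assoc[OF pre Rep_family_Hom Rep_family_Hom Rep_family_Hom])
  show "F + G = G + F"
    by (rule family_eqI) (simp add: rep preadditive_category.Add_comm[OF pre Rep_family_Hom Rep_family_Hom])
  show "0 + F = F"
    by (rule family_eqI) (simp add: rep preadditive_category.Add_Zero[OF pre Rep_family_Hom])
  show "- F + F = 0"
    by (rule family_eqI) (simp add: rep preadditive_category.Add_neg[OF pre Rep_family_Hom])
  show "F - G = F + - G" by (rule minus_family_def)
qed

end

text \<open>Arrows will act on families by additive maps. These form a ring under composition, which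
  turns composition of arrows into multiplication.\<close>

typedef (overloaded) 'v endo = "{f :: 'v::ab_group_add \<Rightarrow> 'v. \<forall>x y. f (x + y) = f x + f y}"
  by (rule exI[of _ "\<lambda>x. x"]) simp

setup_lifting type_definition_endo

instantiation endo :: (ab_group_add) ring
begin

lift_definition zero_endo :: "'a endo" is "\<lambda>x. 0" by simp
lift_definition plus_endo :: "'a endo \<Rightarrow> 'a endo \<Rightarrow> 'a endo" is "\<lambda>f g x. f x + g x" by simp
lift_definition uminus_endo :: "'a endo \<Rightarrow> 'a endo" is "\<lambda>f x. - f x" by simp
lift_definition minus_endo :: "'a endo \<Rightarrow> 'a endo \<Rightarrow> 'a endo" is "\<lambda>f g x. f x - g x" by simp
lift_definition times_endo :: "'a endo \<Rightarrow> 'a endo \<Rightarrow> 'a endo" is "\<lambda>f g x. f (g x)" by simp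

instance
  by standard (transfer, auto simp: fun_eq_iff)+

end

context
  fixes C :: "('o, 'm) exact_cat"
  assumes C: "preadditive_category C"
begin

interpretation preadditive_category C by (rule C)

lemma active_iff: "active C W Y \<longleftrightarrow> W \<in> Obj C \<and> Y \<in> Obj C"
  by (simp add: active_def C)

text \<open>Regular representation: \<open>f\<close> composes with the components that end in
  \<open>Dom C f\<close> and places the results at \<open>Cod C f\<close>; all other components of
  the result are zero. As with matrix units, source and target are built into the operator.\<close>

definition act :: "'m \<Rightarrow> ('o, 'm) family \<Rightarrow> ('o, 'm) family" where
  "act f F = Abs_family (\<lambda>D W Z. if active D W Z
     then if D = C \<and> f \<in> Arr C \<and> Z = Cod C f then f \<odot>\<^bsub>C\<^esub> Rep_family F C W (Dom C f) else Zero D W Z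
     else undefined)"

lemma Rep_act:
  "Rep_family (act f F) D W Z = (if active D W Z
     then if D = C \<and> f \<in> Arr C \<and> Z = Cod C f then f \<odot>\<^bsub>C\<^esub> Rep_family F C W (Dom C f) else Zero D W Z
     else undefined)"
proof -
  have 1: "f \<odot>\<^bsub>C\<^esub> Rep_family F C W (Dom C f) \<in> Hom C W (Cod C f)"
    if "active C W (Cod C f)" "f \<in> Arr C" for W
  proof (rule Comp_Hom)
    show "Rep_family F C W (Dom C f) \<in> Hom C W (Dom C f)"
      using that Dom_Obj by (intro Rep_family_Hom) (simp add: active_iff)
    show "f \<in> Hom C (Dom C f) (Cod C f)" using that by (simp add: Hom_def)
  qed
  show ?thesis
    unfolding act_def by (subst Abs_family_inverse) (auto simp: 1 active_Zero_Hom)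
qed

lemma act_add: "act f (F + G) = act f F + act f G"
proof (rule family_eqI)
  fix D :: "('o, 'm) exact_cat" and W Z assume a: "active D W Z"
  show "Rep_family (act f (F + G)) D W Z = Rep_family (act f F + act f G) D W Z"
  proof (cases "D = C \<and> f \<in> Arr C \<and> Z = Cod C f")
    case True
    then have "active C W (Dom C f)" "f \<in> Hom C (Dom C f) (Cod C f)"
      using a Dom_Obj by (auto simp: active_iff Hom_def)
    then show ?thesis using a True
      by (simp add: Rep_act plus_family.rep_eq Comp_Add[OF Rep_family_Hom Rep_family_Hom])
  next
    case False
    then show ?thesis using a
      by (auto simp: Rep_act plus_family.rep_eq active_Add_Zero active_Zero_Hom)
  qed
qed

definition emb :: "'m \<Rightarrow> ('o, 'm) family endo" where
  "emb f = Abs_endo (act f)"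

lemma Rep_emb: "Rep_endo (emb f) = act f"
  unfolding emb_def by (rule Abs_endo_inverse) (simp add: act_add)

lemma emb_Comp:
  assumes f: "f \<in> Hom C X Y" and g: "g \<in> Hom C Y Z" shows "emb (g \<odot>\<^bsub>C\<^esub> f) = emb g * emb f"
proof -
  have gf: "g \<odot>\<^bsub>C\<^esub> f \<in> Hom C X Z" by (rule Comp_Hom[OF f g])
  have "act (g \<odot>\<^bsub>C\<^esub> f) F = act g (act f F)" for F
  proof (rule family_eqI)
    fix D :: "('o, 'm) exact_cat" and W V assume a: "active D W V"
    have "active C W Y \<and> active C W X" if "D = C"
      using a that Hom_Obj[OF f] by (simp add: active_iff)
    then show "Rep_family (act (g \<odot>\<^bsub>C\<^esub> f) F) D W V = Rep_family (act g (act f F)) D W V"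
      using a f g gf Comp_assoc[OF Rep_family_Hom f g] by (auto simp: Rep_act Hom_def)
  qed
  then show ?thesis by (simp add: Rep_endo_inject[symmetric] times_endo.rep_eq Rep_emb fun_eq_iff)
qed

lemma emb_Add:
  assumes f: "f \<in> Hom C X Y" and g: "g \<in> Hom C X Y" shows "emb (Add C f g) = emb f + emb g"
proof -
  have fg: "Add C f g \<in> Hom C X Y" by (rule Add_Hom[OF f g])
  have "act (Add C f g) F = act f F + act g F" for F
  proof (rule family_eqI)
    fix D :: "('o, 'm) exact_cat" and W V assume a: "active D W V"
    have 1: "active C W X" if "D = C" using a that Hom_Obj[OF f] by (simp add: active_iff)
    have 2: "Add D (Zero D W V) (Zero D W V) = Zero D W V"
      by (rule active_Add_Zero[OF a active_Zero_Hom[OF a]])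
    show "Rep_family (act (Add C f g) F) D W V = Rep_family (act f F + act g F) D W V"
      using a f g fg 1 2 Add_Comp[OF Rep_family_Hom f g] by (auto simp: Rep_act plus_family.rep_eq Hom_def)
  qed
  then show ?thesis by (simp add: Rep_endo_inject[symmetric] plus_endo.rep_eq Rep_emb fun_eq_iff)
qed

lemma emb_Zero:
  assumes "X \<in> Obj C" "Y \<in> Obj C" shows "emb (Zero C X Y) = 0"
  using emb_Add[OF Zero_Hom Zero_Hom, OF assms assms] Add_Zero[OF Zero_Hom[OF assms]] by simp

lemma emb_neg:
  assumes f: "f \<in> Hom C X Y" shows "emb (neg X Y f) = - emb f"
  using emb_Add[OF neg_Hom[OF f] f] emb_Zero[of X Y] Hom_Obj[OF f] Add_neg[OF f]
  by (simp add: eq_neg_iff_add_eq_0)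

text \<open>Yoneda: acting on the family that is \<open>Id C X\<close> at the pair \<open>X\<close>,
  \<open>X\<close> recovers the arrow.\<close>

lemma emb_inj:
  assumes f: "f \<in> Hom C X Y" and g: "g \<in> Hom C X Y" and eq: "emb f = emb g" shows "f = g"
proof -
  have XY: "X \<in> Obj C" "Y \<in> Obj C" using Hom_Obj[OF f] by auto
  define F where "F = Abs_family (\<lambda>D W Z. if active D W Z
    then if D = C \<and> W = X \<and> Z = X then Id C X else Zero D W Z else undefined)"
  have "Rep_family F D W Z = (if active D W Z
    then if D = C \<and> W = X \<and> Z = X then Id C X else Zero D W Z else undefined)" for D W Z
    unfolding F_def by (subst Abs_family_inverse) (auto simp: Id_Hom[OF XY(1)] active_Zero_Hom)
  then have F: "Rep_family F C X X = Id C X" using XY by (simp add: active_iff)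
  have "act f F = act g F" using eq by (metis Rep_emb)
  then have "Rep_family (act f F) C X Y = Rep_family (act g F) C X Y" by simp
  then show ?thesis
    using f g XY F Comp_Id[OF f] Comp_Id[OF g] by (auto simp: Rep_act active_iff Hom_def)
qed

definition homs :: "'o \<Rightarrow> 'o \<Rightarrow> ('o, 'm) family endo set" where
  "homs X Y = emb ` Hom C X Y"

lemma homsI: "f \<in> Hom C X Y \<Longrightarrow> emb f \<in> homs X Y"
  by (simp add: homs_def)

lemma homsE:
  assumes "a \<in> homs X Y" obtains f where "f \<in> Hom C X Y" "a = emb f"
  using assms by (auto simp: homs_def)

lemma ring_category_homs: "ring_category (Obj C) homs (\<lambda>X. emb (Id C X))"
proof
  fix a b X Y Z
  show "X \<in> Obj C \<and> Y \<in> Obj C" if "a \<in> homs X Y" using that Hom_Obj by (auto simp: homs_def)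
  show "0 \<in> homs X Y" if "X \<in> Obj C" "Y \<in> Obj C" using emb_Zero[OF that] homsI[OF Zero_Hom[OF that]] by simp
  show "a + b \<in> homs X Y" if ab: "a \<in> homs X Y" "b \<in> homs X Y"
  proof -
    obtain f where f: "f \<in> Hom C X Y" "a = emb f" using ab(1) by (rule homsE)
    obtain g where g: "g \<in> Hom C X Y" "b = emb g" using ab(2) by (rule homsE)
    show ?thesis using homsI[OF Add_Hom[OF f(1) g(1)]] by (simp add: f g emb_Add[OF f(1) g(1)])
  qed
  show "- a \<in> homs X Y" if a: "a \<in> homs X Y"
  proof -
    obtain f where f: "f \<in> Hom C X Y" "a = emb f" using a by (rule homsE)
    show ?thesis using homsI[OF neg_Hom[OF f(1)]] by (simp add: f emb_neg[OF f(1)])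
  qed
  show "emb (Id C X) \<in> homs X X" if "X \<in> Obj C" using homsI[OF Id_Hom[OF that]] .
  show "b * a \<in> homs X Z" if ab: "a \<in> homs X Y" "b \<in> homs Y Z"
  proof -
    obtain f where f: "f \<in> Hom C X Y" "a = emb f" using ab(1) by (rule homsE)
    obtain g where g: "g \<in> Hom C Y Z" "b = emb g" using ab(2) by (rule homsE)
    show ?thesis using homsI[OF Comp_Hom[OF f(1) g(1)]] by (simp add: f g emb_Comp[OF f(1) g(1)])
  qed
  show "a * emb (Id C X) = a" "emb (Id C Y) * a = a" if a: "a \<in> homs X Y"
  proof -
    obtain f where f: "f \<in> Hom C X Y" "a = emb f" using a by (rule homsE)
    have O: "X \<in> Obj C" "Y \<in> Obj C" using Hom_Obj[OF f(1)] by auto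
    show "a * emb (Id C X) = a"
      using emb_Comp[OF Id_Hom[OF O(1)] f(1)] Comp_Id[OF f(1)] by (simp add: f)
    show "emb (Id C Y) * a = a"
      using emb_Comp[OF f(1) Id_Hom[OF O(2)]] Id_Comp[OF f(1)] by (simp add: f)
  qed
qed

end

section \<open>Exact categories as ring categories\<close>

definition conf ::
    "('o, 'm) exact_cat \<Rightarrow> 'o \<Rightarrow> ('o, 'm) family endo \<Rightarrow> 'o \<Rightarrow> ('o, 'm) family endo \<Rightarrow> 'o \<Rightarrow> bool" where
  "conf E A i B p C \<longleftrightarrow> (\<exists>j q. (j, q) \<in> conflations E \<and> Dom E j = A \<and> Cod E j = B \<and> Cod E q = C \<and>
     i = emb E j \<and> p = emb E q)"

abbreviation ident :: "('o, 'm) exact_cat \<Rightarrow> 'o \<Rightarrow> ('o, 'm) family endo" where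
  "ident E X \<equiv> emb E (Id E X)"

context
  fixes E :: "('o, 'm) exact_cat"
  assumes E: "exact_category E"
begin

interpretation exact_category E by (rule E)

lemma pre: "preadditive_category E"
  by (rule preadditive_category_axioms)

interpretation R: ring_category "Obj E" "homs E" "ident E"
  by (rule ring_category_homs[OF pre])

lemma emb_eq_iff: "f \<in> Hom E X Y \<Longrightarrow> g \<in> Hom E X Y \<Longrightarrow> emb E f = emb E g \<longleftrightarrow> f = g"
  using emb_inj[OF pre] by blast

lemma emb_Comp_eq_iff:
  "f \<in> Hom E X Y \<Longrightarrow> g \<in> Hom E Y Z \<Longrightarrow> h \<in> Hom E X Z \<Longrightarrow> emb E g * emb E f = emb E h \<longleftrightarrow> g \<odot>\<^bsub>E\<^esub> f = h"
  using emb_eq_iff[OF Comp_Hom[of f X Y g Z]] emb_Comp[OF pre] by metis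

lemma emb_eq_0_iff: "f \<in> Hom E X Y \<Longrightarrow> emb E f = 0 \<longleftrightarrow> f = Zero E X Y"
  using emb_eq_iff[OF _ Zero_Hom, of f X Y] emb_Zero[OF pre, of X Y] Hom_Obj[of f X Y] by simp

lemma emb_Comp_eq_0_iff:
  "f \<in> Hom E X Y \<Longrightarrow> g \<in> Hom E Y Z \<Longrightarrow> emb E g * emb E f = 0 \<longleftrightarrow> g \<odot>\<^bsub>E\<^esub> f = Zero E X Z"
  using emb_eq_0_iff[OF Comp_Hom[of f X Y g Z]] emb_Comp[OF pre] by metis

lemma Hom_DC: "f \<in> Hom E X Y \<Longrightarrow> f \<in> Arr E \<and> Dom E f = X \<and> Cod E f = Y"
  by (simp add: Hom_def)

lemma homs_zero_iff:
  assumes "X \<in> Obj E" "Y \<in> Obj E" shows "homs E X Y = {0} \<longleftrightarrow> Hom E X Y = {Zero E X Y}"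
proof
  assume h: "homs E X Y = {0}"
  have "f = Zero E X Y" if "f \<in> Hom E X Y" for f
    using homsI[OF pre that] h emb_eq_0_iff[OF that] by simp
  then show "Hom E X Y = {Zero E X Y}" using Zero_Hom[OF assms] by blast
qed (simp add: homs_def[OF pre] emb_Zero[OF pre assms])

lemma iso_emb_iff:
  assumes f: "f \<in> Hom E X Y" shows "R.iso X Y (emb E f) \<longleftrightarrow> is_iso E f"
proof
  note O = Hom_Obj[OF f]
  assume "R.iso X Y (emb E f)"
  then obtain b where b: "b \<in> homs E Y X" "b * emb E f = ident E X" "emb E f * b = ident E Y"
    unfolding R.iso_def by blast
  obtain g where g: "g \<in> Hom E Y X" "b = emb E g" using b(1) by (rule homsE[OF pre])
  have "g \<odot>\<^bsub>E\<^esub> f = Id E X" "f \<odot>\<^bsub>E\<^esub> g = Id E Y"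
    using b emb_Comp_eq_iff[OF f g(1) Id_Hom] emb_Comp_eq_iff[OF g(1) f Id_Hom] O by (simp_all add: g)
  then show "is_iso E f" using f g(1) unfolding is_iso_def by (auto simp: Hom_def)
next
  note O = Hom_Obj[OF f]
  assume "is_iso E f"
  then obtain g where g: "g \<in> Hom E Y X" "g \<odot>\<^bsub>E\<^esub> f = Id E X" "f \<odot>\<^bsub>E\<^esub> g = Id E Y"
    using f unfolding is_iso_def by (auto simp: Hom_def)
  show "R.iso X Y (emb E f)"
  proof (rule R.isoI)
    show "emb E g * emb E f = ident E X" using emb_Comp[OF pre f g(1)] g(2) by simp
    show "emb E f * emb E g = ident E Y" using emb_Comp[OF pre g(1) f] g(3) by simp
  qed (use homsI[OF pre] f g in auto)
qed

lemma isom_iff: "R.isom X Y \<longleftrightarrow> isomorphic E X Y"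
proof
  assume "R.isom X Y"
  then obtain a where a: "R.iso X Y a" unfolding R.isom_def by blast
  obtain f where f: "f \<in> Hom E X Y" "a = emb E f" using R.iso_H[OF a] by (rule homsE[OF pre])
  then show "isomorphic E X Y" using iso_emb_iff[OF f(1)] a unfolding isomorphic_def by blast
next
  assume "isomorphic E X Y"
  then obtain f where f: "f \<in> Hom E X Y" "is_iso E f" unfolding isomorphic_def by blast
  then show "R.isom X Y" using iso_emb_iff[OF f(1)] unfolding R.isom_def by blast
qed

lemma cls_eq_iso_class: "R.cls X = iso_class E X"
  unfolding R.cls_def iso_class_def using isom_iff R.isom_Ob by blast

lemma is_zero_object_iff: "is_zero_object E Z \<longleftrightarrow> Z \<in> Obj E \<and> ident E Z = 0"
proof
  assume z: "is_zero_object E Z"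
  then have Z: "Z \<in> Obj E" unfolding is_zero_object_def by blast
  then have "Id E Z = Zero E Z Z" using z Id_Hom[OF Z] Zero_Hom[OF Z Z] unfolding is_zero_object_def by blast
  then show "Z \<in> Obj E \<and> ident E Z = 0" using Z emb_Zero[OF pre Z Z] by simp
next
  assume z: "Z \<in> Obj E \<and> ident E Z = 0"
  have 1: "f = Zero E X Z" if f: "f \<in> Hom E X Z" for f X
    using R.id_left[OF homsI[OF pre f]] emb_eq_0_iff[OF f] z by simp
  have 2: "f = Zero E Z X" if f: "f \<in> Hom E Z X" for f X
    using R.id_right[OF homsI[OF pre f]] emb_eq_0_iff[OF f] z by simp
  show "is_zero_object E Z"
    unfolding is_zero_object_def using z 1 2 Zero_Hom by metis
qed

lemma emb_finprod:
  fixes n :: nat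
  assumes Z: "Z \<in> Obj E" and f: "\<And>k. k < n \<Longrightarrow> f k \<in> Hom E Z Z"
  shows "finprod (Hom_group E Z Z) f {..<n} \<in> Hom E Z Z \<and>
    emb E (finprod (Hom_group E Z Z) f {..<n}) = (\<Sum>k<n. emb E (f k))"
  using f
proof (induction n)
  interpret G: comm_group "Hom_group E Z Z" by (rule Hom_comm_group[OF Z Z])
  case 0
  have "finprod (Hom_group E Z Z) f {} = Zero E Z Z" by (simp add: G.finprod_empty) (simp add: Hom_group_def)
  then show ?case using Zero_Hom[OF Z Z] emb_Zero[OF pre Z Z] by simp
next
  interpret G: comm_group "Hom_group E Z Z" by (rule Hom_comm_group[OF Z Z])
  case (Suc n)
  have IH: "finprod (Hom_group E Z Z) f {..<n} \<in> Hom E Z Z"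
    "emb E (finprod (Hom_group E Z Z) f {..<n}) = (\<Sum>k<n. emb E (f k))" using Suc by auto
  have "finprod (Hom_group E Z Z) f {..<Suc n} = Add E (f n) (finprod (Hom_group E Z Z) f {..<n})"
    unfolding lessThan_Suc using Suc.prems
    by (subst G.finprod_insert) (auto simp: Hom_group_def)
  then show ?case
    using IH Add_Hom[OF Suc.prems[of n] IH(1)] emb_Add[OF pre Suc.prems[of n] IH(1)] by (simp add: add.commute)
qed

lemma is_direct_sum_iff: "is_direct_sum E Z Xs \<longleftrightarrow> (\<exists>i p. R.direct_sum Z Xs i p)"
proof
  let ?n = "length Xs"
  assume "is_direct_sum E Z Xs"
  then obtain i p where Z: "Z \<in> Obj E" "set Xs \<subseteq> Obj E"
    and H: "\<And>k. k < ?n \<Longrightarrow> i k \<in> Hom E (Xs ! k) Z" "\<And>k. k < ?n \<Longrightarrow> p k \<in> Hom E Z (Xs ! k)"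
    and o: "\<And>j k. j < ?n \<Longrightarrow> k < ?n \<Longrightarrow>
      p j \<odot>\<^bsub>E\<^esub> i k = (if j = k then Id E (Xs ! k) else Zero E (Xs ! k) (Xs ! j))"
    and s: "finprod (Hom_group E Z Z) (\<lambda>k. i k \<odot>\<^bsub>E\<^esub> p k) {..<?n} = Id E Z"
    unfolding is_direct_sum_def by blast
  have O: "Xs ! k \<in> Obj E" if "k < ?n" for k using Z(2) that by auto
  have "emb E (p j) * emb E (i k) = (if j = k then ident E (Xs ! k) else 0)" if "j < ?n" "k < ?n" for j k
    using emb_Comp[OF pre H(1)[OF that(2)] H(2)[OF that(1)]] o[OF that] emb_Zero[OF pre O[OF that(2)] O[OF that(1)]]
    by auto
  moreover have "(\<Sum>k < ?n. emb E (i k) * emb E (p k)) = ident E Z"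
  proof -
    have ip: "i k \<odot>\<^bsub>E\<^esub> p k \<in> Hom E Z Z" if "k < ?n" for k by (rule Comp_Hom[OF H(2)[OF that] H(1)[OF that]])
    have "(\<Sum>k < ?n. emb E (i k) * emb E (p k)) = (\<Sum>k < ?n. emb E (i k \<odot>\<^bsub>E\<^esub> p k))"
      by (intro sum.cong refl) (simp add: emb_Comp[OF pre H(2) H(1)])
    then show ?thesis using emb_finprod[OF Z(1), of ?n "\<lambda>k. i k \<odot>\<^bsub>E\<^esub> p k", OF ip] s by simp
  qed
  ultimately have "R.direct_sum Z Xs (\<lambda>k. emb E (i k)) (\<lambda>k. emb E (p k))"
    using Z H homsI[OF pre] unfolding R.direct_sum_def by auto
  then show "\<exists>i p. R.direct_sum Z Xs i p" by blast
next
  let ?n = "length Xs"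
  assume "\<exists>i p. R.direct_sum Z Xs i p"
  then obtain a b where Z: "Z \<in> Obj E" "set Xs \<subseteq> Obj E"
    and H: "\<And>k. k < ?n \<Longrightarrow> a k \<in> homs E (Xs ! k) Z" "\<And>k. k < ?n \<Longrightarrow> b k \<in> homs E Z (Xs ! k)"
    and o: "\<And>j k. j < ?n \<Longrightarrow> k < ?n \<Longrightarrow> b j * a k = (if j = k then ident E (Xs ! k) else 0)"
    and s: "(\<Sum>k < ?n. a k * b k) = ident E Z"
    unfolding R.direct_sum_def by blast
  have O: "Xs ! k \<in> Obj E" if "k < ?n" for k using Z(2) that by auto
  have "\<forall>k. \<exists>f. k < ?n \<longrightarrow> f \<in> Hom E (Xs ! k) Z \<and> a k = emb E f" using H(1) homsE[OF pre] by metis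
  then obtain i where i: "\<And>k. k < ?n \<Longrightarrow> i k \<in> Hom E (Xs ! k) Z" "\<And>k. k < ?n \<Longrightarrow> a k = emb E (i k)" by metis
  have "\<forall>k. \<exists>f. k < ?n \<longrightarrow> f \<in> Hom E Z (Xs ! k) \<and> b k = emb E f" using H(2) homsE[OF pre] by metis
  then obtain p where p: "\<And>k. k < ?n \<Longrightarrow> p k \<in> Hom E Z (Xs ! k)" "\<And>k. k < ?n \<Longrightarrow> b k = emb E (p k)" by metis
  have "p j \<odot>\<^bsub>E\<^esub> i k = (if j = k then Id E (Xs ! k) else Zero E (Xs ! k) (Xs ! j))"
    if jk: "j < ?n" "k < ?n" for j k
  proof (cases "j = k")
    case True
    then show ?thesis
      using o[OF jk(2,2)] emb_Comp_eq_iff[OF i(1)[OF jk(2)] p(1)[OF jk(2)] Id_Hom[OF O[OF jk(2)]]]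
      by (simp add: i(2)[OF jk(2)] p(2)[OF jk(2)])
  next
    case False
    then show ?thesis
      using o[OF jk] emb_Comp_eq_0_iff[OF i(1)[OF jk(2)] p(1)[OF jk(1)]]
      by (simp add: i(2)[OF jk(2)] p(2)[OF jk(1)])
  qed
  moreover have "finprod (Hom_group E Z Z) (\<lambda>k. i k \<odot>\<^bsub>E\<^esub> p k) {..<?n} = Id E Z"
  proof -
    have ip: "i k \<odot>\<^bsub>E\<^esub> p k \<in> Hom E Z Z" if "k < ?n" for k using i(1) p(1) that Comp_Hom by blast
    note fp = emb_finprod[OF Z(1), of ?n "\<lambda>k. i k \<odot>\<^bsub>E\<^esub> p k", OF ip]
    have "(\<Sum>k < ?n. emb E (i k \<odot>\<^bsub>E\<^esub> p k)) = ident E Z"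
      unfolding s[symmetric] by (intro sum.cong refl) (simp add: i(2) p(2) emb_Comp[OF pre p(1) i(1)])
    then have "emb E (finprod (Hom_group E Z Z) (\<lambda>k. i k \<odot>\<^bsub>E\<^esub> p k) {..<?n}) = ident E Z"
      using fp by simp
    then show ?thesis using emb_eq_iff[OF conjunct1[OF fp] Id_Hom[OF Z(1)]] by simp
  qed
  ultimately show "is_direct_sum E Z Xs" using Z i(1) p(1) unfolding is_direct_sum_def by blast
qed

lemma biprod_iff: "is_direct_sum E Z [A, B] \<longleftrightarrow> (\<exists>i p j q. R.biprod A B Z i p j q)"
  unfolding is_direct_sum_iff R.direct_sum_pair ..

lemma ring_additive_category_homs: "ring_additive_category (Obj E) (homs E) (ident E)"
proof
  fix A B assume "A \<in> Obj E" "B \<in> Obj E"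
  then obtain Z where "is_direct_sum E Z [A, B]" using direct_sum_exists[of "[A, B]"] by auto
  then show "\<exists>U i p j q. R.biprod A B U i p j q" using biprod_iff by blast
next
  obtain Z where "is_direct_sum E Z []" using direct_sum_exists[of "[]"] by auto
  then show "\<exists>Z \<in> Obj E. ident E Z = 0" unfolding is_direct_sum_iff R.direct_sum_def by auto
qed

lemma loc_of_local_ring:
  assumes Y: "Y \<in> Obj E" and l: "local_ring (End_ring E Y)" shows "R.loc Y"
  unfolding R.loc_def
proof (intro conjI ballI impI Y)
  have "Id E Y \<noteq> Zero E Y Y" using l unfolding local_ring_def by (simp add: End_ring_def)
  then show "ident E Y \<noteq> 0" using emb_eq_0_iff[OF Id_Hom[OF Y]] by simp
  have U: "f \<in> Units (End_ring E Y) \<longleftrightarrow> R.iso Y Y (emb E f)" if f: "f \<in> Hom E Y Y" for f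
    unfolding iso_emb_iff[OF f] is_iso_def Units_def using f by (auto simp: End_ring_def Hom_def)
  fix a b assume ab: "a \<in> homs E Y Y" "b \<in> homs E Y Y" and i: "R.iso Y Y (a + b)"
  obtain f where f: "f \<in> Hom E Y Y" "a = emb E f" using ab(1) by (rule homsE[OF pre])
  obtain g where g: "g \<in> Hom E Y Y" "b = emb E g" using ab(2) by (rule homsE[OF pre])
  have "Add E f g \<in> Units (End_ring E Y)"
    using i U[OF Add_Hom[OF f(1) g(1)]] emb_Add[OF pre f(1) g(1)] f g by simp
  then have "f \<in> Units (End_ring E Y) \<or> g \<in> Units (End_ring E Y)"
    using l f(1) g(1) unfolding local_ring_def by (auto simp: End_ring_def)
  then show "R.iso Y Y a \<or> R.iso Y Y b" using U f g by simp
qed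

lemma ring_krull_schmidt_homs:
  assumes KS: "krull_schmidt E" shows "ring_krull_schmidt (Obj E) (homs E) (ident E)"
proof -
  interpret A: ring_additive_category "Obj E" "homs E" "ident E" by (rule ring_additive_category_homs)
  show ?thesis
  proof
    fix X assume "X \<in> Obj E"
    then obtain Xs where Xs: "is_direct_sum E X Xs" "\<And>Y. Y \<in> set Xs \<Longrightarrow> local_ring (End_ring E Y)"
      using KS unfolding krull_schmidt_def by blast
    then have "set Xs \<subseteq> Obj E" unfolding is_direct_sum_def by blast
    then have l: "R.loc Y" if "Y \<in> set Xs" for Y using Xs(2) loc_of_local_ring that by blast
    obtain i p where ip: "R.direct_sum X Xs i p" using Xs(1) is_direct_sum_iff by blast
    have "\<exists>Z i p. R.direct_sum Z Xs i p" if "set Xs \<subseteq> Obj E" for Xs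
      using direct_sum_exists[OF that] is_direct_sum_iff by blast
    from A.direct_sum_decomp[OF this ip l] show "\<exists>Xs. A.decomp X Xs" by blast
  qed
qed

lemma kernel_emb:
  assumes k: "is_kernel E i p" and H: "i \<in> Hom E A B" "p \<in> Hom E B C"
  shows "R.kernel A (emb E i) B (emb E p) C"
proof (rule R.kernelI)
  show "emb E p * emb E i = 0"
    using k H emb_Comp_eq_0_iff[OF H] unfolding is_kernel_def by (simp add: Hom_def)
  have DC: "Dom E i = A" "Cod E i = B" "Dom E p = B" "Cod E p = C" using H by (auto simp: Hom_def)
  have ex: "\<exists>!g. g \<in> Hom E W A \<and> i \<odot>\<^bsub>E\<^esub> g = f"
    if "f \<in> Hom E W B" "p \<odot>\<^bsub>E\<^esub> f = Zero E W C" for W f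
    using k that unfolding is_kernel_def DC by blast
  fix W a assume a: "a \<in> homs E W B" "emb E p * a = 0"
  obtain f where f: "f \<in> Hom E W B" "a = emb E f" using a(1) by (rule homsE[OF pre])
  then obtain g where g: "g \<in> Hom E W A" "i \<odot>\<^bsub>E\<^esub> g = f"
    using ex[OF f(1)] a(2) emb_Comp_eq_0_iff[OF f(1) H(2)] by auto
  then show "\<exists>g \<in> homs E W A. emb E i * g = a" using homsI[OF pre g(1)] emb_Comp[OF pre g(1) H(1)] f(2) by auto
next
  have DC: "Dom E i = A" "Cod E i = B" "Dom E p = B" "Cod E p = C" using H by (auto simp: Hom_def)
  have ex: "\<exists>!g. g \<in> Hom E W A \<and> i \<odot>\<^bsub>E\<^esub> g = f"
    if "f \<in> Hom E W B" "p \<odot>\<^bsub>E\<^esub> f = Zero E W C" for W f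
    using k that unfolding is_kernel_def DC by blast
  fix W a assume a: "a \<in> homs E W A" "emb E i * a = 0"
  obtain g where g: "g \<in> Hom E W A" "a = emb E g" using a(1) by (rule homsE[OF pre])
  have W: "W \<in> Obj E" using Hom_Obj[OF g(1)] by blast
  have O: "A \<in> Obj E" "B \<in> Obj E" "C \<in> Obj E" using Hom_Obj H by blast+
  have "i \<odot>\<^bsub>E\<^esub> g = Zero E W B" using a(2) emb_Comp_eq_0_iff[OF g(1) H(1)] g(2) by simp
  \<comment> \<open>Both \<open>g\<close> and the zero arrow factor the zero arrow through
    \<open>i\<close>.\<close>
  then have "g = Zero E W A"
    using ex[OF Zero_Hom[OF W O(2)] Comp_Zero[OF W H(2)]] g(1) Zero_Hom[OF W O(1)] Comp_Zero[OF W H(1)] by blast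
  then show "a = 0" using g(2) emb_Zero[OF pre W O(1)] by simp
qed (use H homsI[OF pre] in auto)

lemma cokernel_emb:
  assumes k: "is_cokernel E p i" and H: "i \<in> Hom E A B" "p \<in> Hom E B C"
  shows "R.cokernel A (emb E i) B (emb E p) C"
proof (rule R.cokernelI)
  show "emb E p * emb E i = 0"
    using k H emb_Comp_eq_0_iff[OF H] unfolding is_cokernel_def by (simp add: Hom_def)
  have DC: "Dom E i = A" "Cod E i = B" "Dom E p = B" "Cod E p = C" using H by (auto simp: Hom_def)
  have ex: "\<exists>!g. g \<in> Hom E C W \<and> g \<odot>\<^bsub>E\<^esub> p = f"
    if "f \<in> Hom E B W" "f \<odot>\<^bsub>E\<^esub> i = Zero E A W" for W f
    using k that unfolding is_cokernel_def DC by blast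
  fix W a assume a: "a \<in> homs E B W" "a * emb E i = 0"
  obtain f where f: "f \<in> Hom E B W" "a = emb E f" using a(1) by (rule homsE[OF pre])
  then obtain g where g: "g \<in> Hom E C W" "g \<odot>\<^bsub>E\<^esub> p = f"
    using ex[OF f(1)] a(2) emb_Comp_eq_0_iff[OF H(1) f(1)] by auto
  then show "\<exists>g \<in> homs E C W. g * emb E p = a" using homsI[OF pre g(1)] emb_Comp[OF pre H(2) g(1)] f(2) by auto
next
  have DC: "Dom E i = A" "Cod E i = B" "Dom E p = B" "Cod E p = C" using H by (auto simp: Hom_def)
  have ex: "\<exists>!g. g \<in> Hom E C W \<and> g \<odot>\<^bsub>E\<^esub> p = f"
    if "f \<in> Hom E B W" "f \<odot>\<^bsub>E\<^esub> i = Zero E A W" for W f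
    using k that unfolding is_cokernel_def DC by blast
  fix W a assume a: "a \<in> homs E C W" "a * emb E p = 0"
  obtain g where g: "g \<in> Hom E C W" "a = emb E g" using a(1) by (rule homsE[OF pre])
  have W: "W \<in> Obj E" using Hom_Obj[OF g(1)] by blast
  have O: "A \<in> Obj E" "B \<in> Obj E" "C \<in> Obj E" using Hom_Obj H by blast+
  have z: "Zero E Y W \<odot>\<^bsub>E\<^esub> f = Zero E X W" if f: "f \<in> Hom E X Y" for X Y f
    using emb_Comp_eq_0_iff[OF f Zero_Hom[OF _ W]] emb_Zero[OF pre _ W] Hom_Obj[OF f] by auto
  have "g \<odot>\<^bsub>E\<^esub> p = Zero E B W" using a(2) emb_Comp_eq_0_iff[OF H(2) g(1)] g(2) by simp
  then have "g = Zero E C W"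
    using ex[OF Zero_Hom[OF O(2) W] z[OF H(1)]] g(1) Zero_Hom[OF O(3) W] z[OF H(2)] by blast
  then show "a = 0" using g(2) emb_Zero[OF pre O(3) W] by simp
qed (use H homsI[OF pre] in auto)

text \<open>In \<open>E\<close> itself an arrow determines its source and target, so the objects
  quantified in \<open>is_pushout\<close> are the given \<open>A\<close> and
  \<open>B\<close>.\<close>

lemma pushout_emb:
  assumes po: "is_pushout E i f i' f'" and i: "i \<in> Hom E A B"
  obtains A' B' where "f \<in> Hom E A A'" "i' \<in> Hom E A' B'" "f' \<in> Hom E B B'"
    "R.pushout A B A' B' (emb E i) (emb E f) (emb E i') (emb E f')"
proof -
  obtain A' B' where H: "f \<in> Hom E A A'" "i' \<in> Hom E A' B'" "f' \<in> Hom E B B'"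
    and c: "i' \<odot>\<^bsub>E\<^esub> f = f' \<odot>\<^bsub>E\<^esub> i"
    and u: "\<And>W u v. u \<in> Hom E A' W \<Longrightarrow> v \<in> Hom E B W \<Longrightarrow> u \<odot>\<^bsub>E\<^esub> f = v \<odot>\<^bsub>E\<^esub> i \<Longrightarrow>
        (\<exists>!w. w \<in> Hom E B' W \<and> w \<odot>\<^bsub>E\<^esub> i' = u \<and> w \<odot>\<^bsub>E\<^esub> f' = v)"
    using po i unfolding is_pushout_def by (auto simp: Hom_def)
  have "R.pushout A B A' B' (emb E i) (emb E f) (emb E i') (emb E f')"
    unfolding R.pushout_def
  proof (intro conjI allI ballI impI)
    show "emb E i' * emb E f = emb E f' * emb E i"
      using c emb_Comp[OF pre H(1,2)] emb_Comp[OF pre i H(3)] by simp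
    fix W a b assume a: "a \<in> homs E A' W" and b: "b \<in> homs E B W" and ab: "a * emb E f = b * emb E i"
    obtain g where g: "g \<in> Hom E A' W" "a = emb E g" using a by (rule homsE[OF pre])
    obtain h where h: "h \<in> Hom E B W" "b = emb E h" using b by (rule homsE[OF pre])
    have "g \<odot>\<^bsub>E\<^esub> f = h \<odot>\<^bsub>E\<^esub> i"
      using ab emb_Comp_eq_iff[OF H(1) g(1) Comp_Hom[OF i h(1)]] emb_Comp[OF pre i h(1)] g h by simp
    from u[OF g(1) h(1) this] obtain w where w: "w \<in> Hom E B' W" "w \<odot>\<^bsub>E\<^esub> i' = g" "w \<odot>\<^bsub>E\<^esub> f' = h"
      and uw: "\<And>z. z \<in> Hom E B' W \<Longrightarrow> z \<odot>\<^bsub>E\<^esub> i' = g \<Longrightarrow> z \<odot>\<^bsub>E\<^esub> f' = h \<Longrightarrow> z = w" by blast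
    show "\<exists>!w. w \<in> homs E B' W \<and> w * emb E i' = a \<and> w * emb E f' = b"
    proof (rule ex1I[of _ "emb E w"])
      show "emb E w \<in> homs E B' W \<and> emb E w * emb E i' = a \<and> emb E w * emb E f' = b"
        using homsI[OF pre w(1)] emb_Comp[OF pre H(2) w(1)] emb_Comp[OF pre H(3) w(1)] w g h by simp
      fix c assume c: "c \<in> homs E B' W \<and> c * emb E i' = a \<and> c * emb E f' = b"
      then obtain z where z: "z \<in> Hom E B' W" "c = emb E z" using homsE[OF pre] by metis
      have "z = w"
        using uw[OF z(1)] c emb_Comp_eq_iff[OF H(2) z(1) g(1)] emb_Comp_eq_iff[OF H(3) z(1) h(1)] z g h by simp
      then show "c = emb E w" using z by simp
    qed
  qed (use i H homsI[OF pre] in auto)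
  then show ?thesis using that H by blast
qed

lemma pullback_emb:
  assumes pb: "is_pullback E p f p' f'" and p: "p \<in> Hom E B A"
  obtains A' B' where "f \<in> Hom E A' A" "p' \<in> Hom E B' A'" "f' \<in> Hom E B' B"
    "R.pullback A B A' B' (emb E p) (emb E f) (emb E p') (emb E f')"
proof -
  obtain A' B' where H: "f \<in> Hom E A' A" "p' \<in> Hom E B' A'" "f' \<in> Hom E B' B"
    and c: "f \<odot>\<^bsub>E\<^esub> p' = p \<odot>\<^bsub>E\<^esub> f'"
    and u: "\<And>W u v. u \<in> Hom E W A' \<Longrightarrow> v \<in> Hom E W B \<Longrightarrow> f \<odot>\<^bsub>E\<^esub> u = p \<odot>\<^bsub>E\<^esub> v \<Longrightarrow>
        (\<exists>!w. w \<in> Hom E W B' \<and> p' \<odot>\<^bsub>E\<^esub> w = u \<and> f' \<odot>\<^bsub>E\<^esub> w = v)"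
    using pb p unfolding is_pullback_def by (auto simp: Hom_def)
  have "R.pullback A B A' B' (emb E p) (emb E f) (emb E p') (emb E f')"
    unfolding R.pullback_def
  proof (intro conjI allI ballI impI)
    show "emb E f * emb E p' = emb E p * emb E f'"
      using c emb_Comp[OF pre H(2,1)] emb_Comp[OF pre H(3) p] by simp
    fix W a b assume a: "a \<in> homs E W A'" and b: "b \<in> homs E W B" and ab: "emb E f * a = emb E p * b"
    obtain g where g: "g \<in> Hom E W A'" "a = emb E g" using a by (rule homsE[OF pre])
    obtain h where h: "h \<in> Hom E W B" "b = emb E h" using b by (rule homsE[OF pre])
    have "f \<odot>\<^bsub>E\<^esub> g = p \<odot>\<^bsub>E\<^esub> h"
      using ab emb_Comp_eq_iff[OF g(1) H(1) Comp_Hom[OF h(1) p]] emb_Comp[OF pre h(1) p] g h by simp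
    from u[OF g(1) h(1) this] obtain w where w: "w \<in> Hom E W B'" "p' \<odot>\<^bsub>E\<^esub> w = g" "f' \<odot>\<^bsub>E\<^esub> w = h"
      and uw: "\<And>z. z \<in> Hom E W B' \<Longrightarrow> p' \<odot>\<^bsub>E\<^esub> z = g \<Longrightarrow> f' \<odot>\<^bsub>E\<^esub> z = h \<Longrightarrow> z = w" by blast
    show "\<exists>!w. w \<in> homs E W B' \<and> emb E p' * w = a \<and> emb E f' * w = b"
    proof (rule ex1I[of _ "emb E w"])
      show "emb E w \<in> homs E W B' \<and> emb E p' * emb E w = a \<and> emb E f' * emb E w = b"
        using homsI[OF pre w(1)] emb_Comp[OF pre w(1) H(2)] emb_Comp[OF pre w(1) H(3)] w g h by simp
      fix c assume c: "c \<in> homs E W B' \<and> emb E p' * c = a \<and> emb E f' * c = b"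
      then obtain z where z: "z \<in> Hom E W B'" "c = emb E z" using homsE[OF pre] by metis
      have "z = w"
        using uw[OF z(1)] c emb_Comp_eq_iff[OF z(1) H(2) g(1)] emb_Comp_eq_iff[OF z(1) H(3) h(1)] z g h by simp
      then show "c = emb E w" using z by simp
    qed
  qed (use p H homsI[OF pre] in auto)
  then show ?thesis using that H by blast
qed

lemma conflation_Hom:
  assumes "(i, p) \<in> conflations E"
  shows "i \<in> Hom E (Dom E i) (Cod E i)" "p \<in> Hom E (Cod E i) (Cod E p)"
  using conflation_kernel[OF assms] unfolding is_kernel_def by (auto simp: Hom_def)

lemma confI: "(i, p) \<in> conflations E \<Longrightarrow> conf E (Dom E i) (emb E i) (Cod E i) (emb E p) (Cod E p)"
  unfolding conf_def by blast

lemma confE: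
  assumes "conf E A a B b C"
  obtains i p where "(i, p) \<in> conflations E" "i \<in> Hom E A B" "p \<in> Hom E B C" "a = emb E i" "b = emb E p"
  using assms conflation_Hom unfolding conf_def by metis

lemma inflation_conf:
  assumes "inflation E i" "i \<in> Hom E A B" obtains b C where "conf E A (emb E i) B b C"
  using assms confI unfolding inflation_def by (metis Hom_DC)

lemma deflation_conf:
  assumes "deflation E p" "p \<in> Hom E B C" obtains A a where "conf E A a B (emb E p) C"
proof -
  obtain i where i: "(i, p) \<in> conflations E" using assms(1) unfolding deflation_def by blast
  then have "Cod E i = B" "Cod E p = C" using conflation_Hom(2)[OF i] assms(2) by (auto simp: Hom_def)
  then show ?thesis using that confI[OF i] by metis
qed

lemma ring_exact_category_homs:
  assumes KS: "krull_schmidt E" shows "ring_exact_category (Obj E) (homs E) (ident E) (conf E)"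
proof -
  interpret K: ring_krull_schmidt "Obj E" "homs E" "ident E" by (rule ring_krull_schmidt_homs[OF KS])
  show ?thesis
  proof
    fix A a B b C assume cf: "conf E A a B b C"
    then obtain i p where ip: "(i, p) \<in> conflations E" "i \<in> Hom E A B" "p \<in> Hom E B C" "a = emb E i" "b = emb E p"
      by (rule confE)
    show "R.kernel A a B b C" using kernel_emb[OF conflation_kernel[OF ip(1)] ip(2,3)] ip by simp
    show "R.cokernel A a B b C" using cokernel_emb[OF conflation_cokernel[OF ip(1)] ip(2,3)] ip by simp
    show "\<exists>r G. conf E A (c * a) D r G" if cf': "conf E B c D d F" for c D d F
    proof -
      obtain j q where jq: "(j, q) \<in> conflations E" "j \<in> Hom E B D" "c = emb E j" using cf' by (rule confE)
      have "inflation E (j \<odot>\<^bsub>E\<^esub> i)"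
        using ip jq by (intro inflation_Comp) (auto simp: inflation_def Hom_def)
      from inflation_conf[OF this Comp_Hom[OF ip(2) jq(2)]]
      show ?thesis using emb_Comp[OF pre ip(2) jq(2)] ip jq by metis
    qed
    show "\<exists>G k. conf E G k B (d * b) F" if cf': "conf E D c C d F" for c D d F
    proof -
      obtain j q where jq: "(j, q) \<in> conflations E" "q \<in> Hom E C F" "d = emb E q" using cf' by (rule confE)
      have "deflation E (q \<odot>\<^bsub>E\<^esub> p)"
        using ip jq by (intro deflation_Comp) (auto simp: deflation_def Hom_def)
      from deflation_conf[OF this Comp_Hom[OF ip(3) jq(2)]]
      show ?thesis using emb_Comp[OF pre ip(3) jq(2)] ip jq by metis
    qed
    show "\<exists>B' i' f' p' C'. R.pushout A B A' B' a c i' f' \<and> conf E A' i' B' p' C'" if c: "c \<in> homs E A A'" for c A'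
    proof -
      obtain f where f: "f \<in> Hom E A A'" "c = emb E f" using c by (rule homsE[OF pre])
      obtain i' f' where po: "is_pushout E i f i' f'" "inflation E i'"
        using inflation_pushout[of i f] ip f unfolding inflation_def by (auto simp: Hom_def)
      obtain A2 B' where P: "f \<in> Hom E A A2" "i' \<in> Hom E A2 B'"
        "R.pushout A B A2 B' (emb E i) (emb E f) (emb E i') (emb E f')" using pushout_emb[OF po(1) ip(2)] .
      have "A2 = A'" using P(1) f(1) by (simp add: Hom_def)
      then show ?thesis using inflation_conf[OF po(2) P(2)] P(3) ip f by metis
    qed
    show "\<exists>B' p' f' A' i'. R.pullback C B C' B' b c p' f' \<and> conf E A' i' B' p' C'" if c: "c \<in> homs E C' C" for c C'
    proof -
      obtain f where f: "f \<in> Hom E C' C" "c = emb E f" using c by (rule homsE[OF pre])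
      obtain p' f' where pb: "is_pullback E p f p' f'" "deflation E p'"
        using deflation_pullback[of p f] ip f unfolding deflation_def by (auto simp: Hom_def)
      obtain C2 B' where P: "f \<in> Hom E C2 C" "p' \<in> Hom E B' C2"
        "R.pullback C B C2 B' (emb E p) (emb E f) (emb E p') (emb E f')" using pullback_emb[OF pb(1) ip(3)] .
      have "C2 = C'" using P(1) f(1) by (simp add: Hom_def)
      then show ?thesis using deflation_conf[OF pb(2) P(2)] P(3) ip f by metis
    qed
    show "conf E A' a' B' b' C'"
      if h: "R.iso A A' f" "R.iso B B' g" "R.iso C C' h" "a' \<in> homs E A' B'" "b' \<in> homs E B' C'"
        "g * a = a' * f" "h * b = b' * g" for A' f B' g C' h a' b'
    proof -
      obtain u where u: "u \<in> Hom E A A'" "f = emb E u" using R.iso_H[OF h(1)] by (rule homsE[OF pre])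
      obtain v where v: "v \<in> Hom E B B'" "g = emb E v" using R.iso_H[OF h(2)] by (rule homsE[OF pre])
      obtain w where w: "w \<in> Hom E C C'" "h = emb E w" using R.iso_H[OF h(3)] by (rule homsE[OF pre])
      obtain i' where i': "i' \<in> Hom E A' B'" "a' = emb E i'" using h(4) by (rule homsE[OF pre])
      obtain p' where p': "p' \<in> Hom E B' C'" "b' = emb E p'" using h(5) by (rule homsE[OF pre])
      have isos: "is_iso E u" "is_iso E v" "is_iso E w" using iso_emb_iff u v w h by auto
      have 1: "v \<odot>\<^bsub>E\<^esub> i = i' \<odot>\<^bsub>E\<^esub> u"
        using h(6) emb_Comp_eq_iff[OF ip(2) v(1) Comp_Hom[OF u(1) i'(1)]] emb_Comp[OF pre u(1) i'(1)] ip v u i' by simp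
      have 2: "w \<odot>\<^bsub>E\<^esub> p = p' \<odot>\<^bsub>E\<^esub> v"
        using h(7) emb_Comp_eq_iff[OF ip(3) w(1) Comp_Hom[OF v(1) p'(1)]] emb_Comp[OF pre v(1) p'(1)] ip w v p' by simp
      have "(i', p') \<in> conflations E"
        by (rule conflation_iso[OF ip(1) isos _ _ _ i'(1) p'(1) 1 2]) (use ip u v w in \<open>auto simp: Hom_def\<close>)
      then show ?thesis using i' p' unfolding conf_def by (auto simp: Hom_def)
    qed
  next
    fix X assume X: "X \<in> Obj E"
    show "\<exists>p C. conf E X (ident E X) X p C" using inflation_conf[OF inflation_Id[OF X] Id_Hom[OF X]] by metis
    show "\<exists>i A. conf E A i X (ident E X) X" using deflation_conf[OF deflation_Id[OF X] Id_Hom[OF X]] by metis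
  qed
qed

end

section \<open>Translation of the support \<tau>-tilting hypotheses\<close>

context
  fixes E :: "('o, 'm) exact_cat" and T :: "'o set"
  assumes E: "exact_category E" and KS: "krull_schmidt E"
    and EP: "enough_projectives E" and ST: "support_tau_tilting E T"
begin

interpretation exact_category E by (rule E)

interpretation R: ring_exact_category "Obj E" "homs E" "ident E" "conf E"
  by (rule ring_exact_category_homs[OF E KS])

lemmas pr = pre[OF E]

lemma deflation_emb_iff:
  assumes p: "p \<in> Hom E B C" shows "R.deflation B C (emb E p) \<longleftrightarrow> deflation E p"
proof
  assume "R.deflation B C (emb E p)"
  then obtain A a where "conf E A a B (emb E p) C" unfolding R.deflation_def by blast
  then obtain j q where "(j, q) \<in> conflations E" "q \<in> Hom E B C" "emb E p = emb E q" by (rule confE[OF E])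
  then show "deflation E p" using emb_eq_iff[OF E p] unfolding deflation_def by blast
next
  assume "deflation E p"
  then show "R.deflation B C (emb E p)" using deflation_conf[OF E _ p] unfolding R.deflation_def by blast
qed

lemma deflation_Hom: "deflation E p \<Longrightarrow> p \<in> Hom E (Dom E p) (Cod E p)"
  using conflation_Hom(2)[OF E] unfolding deflation_def by (metis Hom_DC[OF E])

lemma projective_iff: "R.projective Q \<longleftrightarrow> Q \<in> projectives E"
proof
  assume Q: "R.projective Q"
  show "Q \<in> projectives E"
    unfolding projectives_def
  proof (intro CollectI conjI allI impI ballI)
    show "Q \<in> Obj E" using Q unfolding R.projective_def by blast
    fix p f assume p: "deflation E p" and f: "f \<in> Hom E Q (Cod E p)"
    note pH = deflation_Hom[OF p]
    have d: "R.deflation (Dom E p) (Cod E p) (emb E p)" using deflation_emb_iff[OF pH] p by blast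
    obtain a where a: "a \<in> homs E Q (Dom E p)" "emb E p * a = emb E f"
      using R.projective_lift[OF Q d homsI[OF pr f]] .
    obtain g where g: "g \<in> Hom E Q (Dom E p)" "a = emb E g" using a(1) by (rule homsE[OF pr])
    then show "\<exists>g \<in> Hom E Q (Dom E p). p \<odot>\<^bsub>E\<^esub> g = f"
      using a(2) emb_Comp_eq_iff[OF E g(1) pH f] by blast
  qed
next
  assume Q: "Q \<in> projectives E"
  show "R.projective Q"
    unfolding R.projective_def
  proof (intro conjI allI impI ballI)
    show "Q \<in> Obj E" using Q unfolding projectives_def by blast
    fix B C b a assume b: "R.deflation B C b" and a: "a \<in> homs E Q C"
    obtain p where p: "p \<in> Hom E B C" "b = emb E p" using R.deflation_H[OF b] by (rule homsE[OF pr])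
    obtain f where f: "f \<in> Hom E Q C" "a = emb E f" using a by (rule homsE[OF pr])
    have "deflation E p" using deflation_emb_iff[OF p(1)] b p(2) by simp
    then obtain g where g: "g \<in> Hom E Q B" "p \<odot>\<^bsub>E\<^esub> g = f"
      using Q f(1) Hom_DC[OF E p(1)] unfolding projectives_def by auto
    have "b * emb E g = a" using emb_Comp[OF pr g(1) p(1)] g p f by simp
    then show "\<exists>c \<in> homs E Q B. b * c = a" using homsI[OF pr g(1)] by blast
  qed
qed

lemma summand_closed_T: "R.summand_closed T"
  unfolding R.summand_closed_def
proof (intro conjI allI impI iffI)
  have ac: "subcategory E T"
    "\<And>Xs Z X. set Xs \<subseteq> T \<Longrightarrow> is_direct_sum E Z Xs \<Longrightarrow> direct_summand E X Z \<Longrightarrow> X \<in> T"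
    using ST unfolding support_tau_tilting_def additively_closed_def by blast+
  show TO: "T \<subseteq> Obj E" using ac(1) unfolding subcategory_def by blast
  fix A B U i p j q assume b: "R.biprod A B U i p j q"
  note O = R.biprod_Ob[OF b]
  have AB: "is_direct_sum E U [A, B]" "is_direct_sum E U [B, A]"
    using biprod_iff[OF E] b R.biprod_swap[OF b] by blast+
  \<comment> \<open>\<open>additively_closed\<close> speaks of summands of sums of objects of
    \<open>T\<close>. For the summands of \<open>U\<close>, the one-term sum is taken.\<close>
  have "R.direct_sum U [U] (\<lambda>_. ident E U) (\<lambda>_. ident E U)"
    unfolding R.direct_sum_def using O R.H_id[OF O(3)] R.id_left[OF R.H_id[OF O(3)]] by simp
  then have UU: "is_direct_sum E U [U]" using is_direct_sum_iff[OF E] by blast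
  show "A \<in> T" "B \<in> T" if "U \<in> T"
    using ac(2)[OF _ UU] AB that unfolding direct_summand_def by auto
  \<comment> \<open>For closure under sums, \<open>U\<close> is viewed as a summand of itself with
    zero complement.\<close>
  obtain Z where Z: "Z \<in> Obj E" "ident E Z = 0" using R.zero_exists by blast
  have "is_direct_sum E U [U, Z]" using biprod_iff[OF E] R.biprod_zero_right[OF O(3) Z] by blast
  then show "U \<in> T" if "A \<in> T \<and> B \<in> T"
    using ac(2)[OF _ AB(1)] that unfolding direct_summand_def by auto
qed

text \<open>If \<open>Ext1 E X Y\<close> has one element, every extension is equivalent to the split one.\<close>

lemma Ext1_retraction:
  assumes cf: "conf E Y a B b X" and s: "is_singleton (Ext1 E X Y)"
  shows "\<exists>r \<in> homs E B Y. r * a = ident E Y"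
proof -
  note O = R.CF_H(4-6)[OF cf]
  obtain i p where ip: "(i, p) \<in> conflations E" "i \<in> Hom E Y B" "p \<in> Hom E B X" "a = emb E i" "b = emb E p"
    using cf by (rule confE[OF E])
  obtain U k r l t where bp: "R.biprod Y X U k r l t" using R.biprod_exists[OF O(1,3)] by blast
  obtain i' p' where ip': "(i', p') \<in> conflations E" "i' \<in> Hom E Y U" "p' \<in> Hom E U X" "k = emb E i'" "t = emb E p'"
    using R.CF_of_biprod[OF bp] by (rule confE[OF E])
  have ext: "(i, p) \<in> extensions E X Y" "(i', p') \<in> extensions E X Y"
    using ip ip' unfolding extensions_def by (auto simp: Hom_def)
  have "U \<in> Obj E" using R.biprod_Ob[OF bp] by blast
  have "((i', p'), (i', p')) \<in> extension_equiv E X Y"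
  proof -
    have "is_iso E (Id E U)" using iso_emb_iff[OF E Id_Hom[OF \<open>U \<in> Obj E\<close>]] R.iso_id[OF \<open>U \<in> Obj E\<close>] by blast
    then show ?thesis
      using ext(2) Id_Hom[OF \<open>U \<in> Obj E\<close>] Id_Comp[OF ip'(2)] Comp_Id[OF ip'(3)] Hom_DC[OF E ip'(2)]
      unfolding extension_equiv_def by auto
  qed
  moreover have "extension_equiv E X Y `` {(i, p)} = extension_equiv E X Y `` {(i', p')}"
    using s quotientI[OF ext(1)] quotientI[OF ext(2)] unfolding Ext1_def by (metis is_singletonE singletonD)
  ultimately have "((i, p), (i', p')) \<in> extension_equiv E X Y" by blast
  then obtain h where h: "h \<in> Hom E B U" "h \<odot>\<^bsub>E\<^esub> i = i'"
    using Hom_DC[OF E ip(2)] Hom_DC[OF E ip'(2)] unfolding extension_equiv_def by auto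
  have "r * emb E h * a = ident E Y"
    using emb_Comp[OF pr ip(2) h(1)] h(2) ip(4) ip'(4) R.biprod_simps(1)[OF bp] by (simp add: mult.assoc)
  moreover have "r * emb E h \<in> homs E B Y"
    by (rule R.H_comp[OF homsI[OF pr h(1)] R.biprod_H(2)[OF bp]])
  ultimately show ?thesis by blast
qed

lemma tau_tilting_homs: "tau_tilting (Obj E) (homs E) (ident E) (conf E) T"
proof
  show "R.summand_closed T" by (rule summand_closed_T)
next
  fix X assume "X \<in> Obj E"
  then obtain P p where P: "P \<in> projectives E" "p \<in> Hom E P X" "deflation E p"
    using EP unfolding enough_projectives_def by blast
  then show "\<exists>Q p. R.projective Q \<and> R.deflation Q X p"
    using projective_iff deflation_emb_iff by blast
next
  fix Y i B p X assume cf: "conf E Y i B p X" and X: "X \<in> T" and Y: "Y \<in> R.fac T"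
  obtain Z b where Z: "Z \<in> T" "R.deflation Z Y b" using Y unfolding R.fac_def by blast
  obtain q where q: "q \<in> Hom E Z Y" "b = emb E q" using R.deflation_H[OF Z(2)] by (rule homsE[OF pr])
  have "deflation E q" using deflation_emb_iff[OF q(1)] Z(2) q(2) by simp
  then have "Y \<in> Fac E T" using Z(1) q(1) Hom_Obj[OF q(1)] unfolding Fac_def by blast
  then have "is_singleton (Ext1 E X Y)" using ST X unfolding support_tau_tilting_def by blast
  from Ext1_retraction[OF cf this] show "\<exists>r \<in> homs E B Y. r * i = ident E Y" .
next
  fix Q assume "R.projective Q"
  then have "Q \<in> projectives E" using projective_iff by blast
  then obtain U V f g where UV: "U \<in> T" "V \<in> T" and f: "f \<in> Hom E Q U" and g: "g \<in> Hom E U V"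
    and ex: "exact_sequence E [f, g]" and dg: "deflation E g" and la: "left_approximation E T Q f"
    using ST unfolding support_tau_tilting_def by blast
  \<comment> \<open>Exactness at the middle term lets the inflation of the image factorization of
    \<open>f\<close> serve as a kernel of \<open>g\<close>.\<close>
  have "\<exists>i. is_image E i f \<and> is_kernel E i g" using ex unfolding exact_sequence_def by force
  then obtain i d where i: "is_kernel E i g" and d: "deflation E d" "Cod E d = Dom E i" "f = i \<odot>\<^bsub>E\<^esub> d"
    unfolding is_image_def by blast
  let ?J = "Dom E i"
  have iH: "i \<in> Hom E ?J U" using i g unfolding is_kernel_def by (simp add: Hom_def)
  have dH: "d \<in> Hom E (Dom E d) ?J" using deflation_Hom[OF d(1)] d(2) by simp
  have "Dom E d = Q" using Comp_Hom[OF dH iH] d(3) f by (simp add: Hom_def)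
  then have dH: "d \<in> Hom E Q ?J" using dH by simp
  obtain A a where "conf E A a U (emb E g) V" using deflation_conf[OF E dg g] .
  \<comment> \<open>The deflation \<open>g\<close> comes with some inflation \<open>a\<close>;
    uniqueness of kernels puts \<open>i\<close> in its place.\<close>
  then have cf: "conf E ?J (emb E i) U (emb E g) V"
    using R.CF_of_kernel kernel_emb[OF E i iH g] by blast
  have "\<exists>w \<in> homs E ?J X. h = w * emb E d" if X: "X \<in> T" and h: "h \<in> homs E Q X" for X h
  proof -
    obtain u where u: "u \<in> Hom E Q X" "h = emb E u" using h by (rule homsE[OF pr])
    obtain v where v: "v \<in> Hom E U X" "u = v \<odot>\<^bsub>E\<^esub> f"
      using la X u(1) f unfolding left_approximation_def by (auto simp: Hom_def)
    \<comment> \<open>Restricting the factor \<open>v\<close> along \<open>i\<close> turns a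
      factorization through the approximation into one through its image.\<close>
    have "h = emb E (v \<odot>\<^bsub>E\<^esub> i) * emb E d"
      using u v d(3) emb_Comp[OF pr f v(1)] emb_Comp[OF pr dH iH] emb_Comp[OF pr iH v(1)]
      by (simp add: mult.assoc)
    then show ?thesis using homsI[OF pr Comp_Hom[OF iH v(1)]] by blast
  qed
  moreover have "R.deflation Q ?J (emb E d)" using deflation_emb_iff[OF dH] d(1) by simp
  ultimately show "\<exists>J d j U g V. R.deflation Q J d \<and> conf E J j U g V \<and> U \<in> T \<and> V \<in> T \<and>
      (\<forall>X \<in> T. \<forall>h \<in> homs E Q X. \<exists>w \<in> homs E J X. h = w * d)"
    using cf UV by blast
qed

lemma indecomposable_iff: "indecomposable E X \<longleftrightarrow> R.loc X"
  unfolding R.loc_iff_indecomposable indecomposable_def is_zero_object_iff[OF E] biprod_iff[OF E]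
  using R.biprod_Ob by metis

lemma num_indec_eq: "num_indec E S = |R.cls ` {X \<in> S. R.loc X}|"
  unfolding num_indec_def using cls_eq_iso_class[OF E] indecomposable_iff by simp

lemma num_indec_support_tau_tilting:
  "num_indec E T =o num_indec E {Q \<in> projectives E. \<exists>X \<in> T. Hom E Q X \<noteq> {Zero E Q X}}"
proof -
  interpret tau_tilting "Obj E" "homs E" "ident E" "conf E" T by (rule tau_tilting_homs)
  have nonzero: "(\<exists>X \<in> T. Hom E Q X \<noteq> {Zero E Q X}) \<longleftrightarrow> (\<exists>X \<in> T. homs E Q X \<noteq> {0})" if "Q \<in> Obj E" for Q
    using homs_zero_iff[OF E that T_Ob] by (intro bex_cong refl) simp
  have "{X \<in> {Q \<in> projectives E. \<exists>X \<in> T. Hom E Q X \<noteq> {Zero E Q X}}. R.loc X} =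
    {Q. R.projective Q \<and> R.loc Q \<and> (\<exists>X \<in> T. homs E Q X \<noteq> {0})}"
  proof (rule Set.set_eqI)
    fix Q
    have "R.projective Q \<Longrightarrow> Q \<in> Obj E" unfolding R.projective_def by blast
    then show "Q \<in> {X \<in> {Q \<in> projectives E. \<exists>X \<in> T. Hom E Q X \<noteq> {Zero E Q X}}. R.loc X} \<longleftrightarrow>
        Q \<in> {Q. R.projective Q \<and> R.loc Q \<and> (\<exists>X \<in> T. homs E Q X \<noteq> {0})}"
      unfolding mem_Collect_eq projective_iff[symmetric] using nonzero[of Q] by metis
  qed
  then show ?thesis unfolding num_indec_eq using ordIso_T_projectives by simp
qed

end

theorem theorem1p4:
  fixes E :: "('o, 'm) exact_cat" and T :: "'o set"
  assumes "exact_category E"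
    and "krull_schmidt E"
    and "enough_projectives E"
    and "support_tau_tilting E T"
  shows "num_indec E T =o
    num_indec E {Q \<in> projectives E. \<exists>X \<in> T. Hom E Q X \<noteq> {Zero E Q X}}"
  using num_indec_support_tau_tilting[OF assms] .

end
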